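(* Let $\mathbb{K}\in\{\mathbb{R},\mathbb{C}\}$, let $(X,\pi)$ be a Poisson manifold, let $\star=\sum_{k=0}^\infty\lambda^kC_k$ be a star product on $(X,\pi)$, and let $\Omega\subset X$ be an open set. Put $K=\mathbb{K}[[\lambda]]$, let $R$ be the unital $K$-algebra $(\mathcal{C}^\infty(X,\mathbb{K})[[\lambda]],\star)$, let $R_\Omega$ be the unital $K$-algebra $(\mathcal{C}^\infty(\Omega,\mathbb{K})[[\lambda]],\star_\Omega)$, and let $\eta:R\to R_\Omega$, $f\mapsto f|_\Omega$, be the restriction morphism. Put $$S_\Omega=\{g_0\in\mathcal{C}^\infty(X,\mathbb{K})\mid \forall x\in\Omega:\ g_0(x)\neq 0\},\qquad S=S_\Omega+\lambda R .$$ Then: 1. $(R_\Omega,\star_\Omega)$ equipped with the restriction morphism $\eta$ is a right $K$-algebra of fractions of $(R,S)$. 2. $S$ is a right denominator set in $R$. 3. The algebraic localization $RS^{-1}$ of $R$ with respect to $S$ is isomorphic to $R_\Omega$ as a unital $K$-algebra.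
   Context: All algebras are associative and unital (the zero algebra is allowed). Manifolds are smooth, Hausdorff and second countable; $\mathcal{C}^\infty(X,\mathbb{K})$ is the algebra of smooth $\mathbb{K}$-valued functions. A bilinear map $C:\mathcal{C}^\infty(X,\mathbb{K})\times\mathcal{C}^\infty(X,\mathbb{K})\to\mathcal{C}^\infty(X,\mathbb{K})$ is a bidifferential operator if there is $l\in\mathbb{N}$ such that in every chart $(U,(x^1,\dots,x^N))$ one has $C(f,g)(x)=\sum_{|\alpha|,|\beta|\le l}C^{\alpha\beta}(x)\,\partial^{\alpha}f(x)\,\partial^{\beta}g(x)$ with smooth functions $C^{\alpha\beta}$ on $U$. For every open $U\subset X$ it has a unique localization $C_U$, a bidifferential operator on $\mathcal{C}^\infty(U,\mathbb{K})$ with $C(f,g)|_U=C_U(f|_U,g|_U)$. A (formal) star product on $X$ is a $\mathbb{K}[[\lambda]]$-bilinear associative multiplication on $\mathcal{C}^\infty(X,\mathbb{K})[[\lambda]]$ given by $f\star g=\sum_{k\ge0}\lambda^kC_k(f,g)$ for $f,g\in\mathcal{C}^\infty(X,\mathbb{K})$ (so $(f\star g)_k=\sum_{l+p+q=k}C_l(f_p,g_q)$ for formal series $f=\sum_p\lambda^pf_p$, $g=\sum_q\lambda^qg_q$), with all $C_k$ bidifferential operators, $C_0(f,g)=fg$, and $1\star f=f\star1=f$. It is a star product on the Poisson manifold $(X,\pi)$ if $\frac12(C_1(f,g)-C_1(g,f))=\{f,g\}=\pi(df,dg)$. The star product $\star_\Omega$ on $\mathcal{C}^\infty(\Omega,\mathbb{K})[[\lambda]]$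 is $\sum_k\lambda^k(C_k)_\Omega$. For a formal series $g$, $g_0$ denotes its $\lambda^0$-term. A multiplicative subset $S$ of an algebra $R$ is a subset containing $1$ and closed under multiplication; here $S$ is a multiplicative subset of $(R,\star)$. A right $K$-algebra of fractions of $(R,S)$ is a unital $K$-algebra $\check R$ with a morphism of unital $K$-algebras $\check\eta:R\to\check R$ such that (a) $\check\eta(s)$ is invertible for all $s\in S$; (b) every element of $\check R$ is of the form $\check\eta(r)\check\eta(s)^{-1}$ with $r\in R$, $s\in S$; (c) $\ker\check\eta=\{r\in R\mid rs=0\text{ for some }s\in S\}$. $S$ is a right denominator set if (a) (right Ore) for all $r\in R,s\in S$ there are $r'\in R,s'\in S$ with $rs'=sr'$; and (b) (right reversible) for all $r\in R,s'\in S$ with $s'r=0$ there is $s\in S$ with $rs=0$. For a right denominator set, $RS^{-1}=(R\times S)/\sim$, where $(r_1,s_1)\sim(r_2,s_2)$ iff there are $b_1,b_2\in R$ with $s_1b_1=s_2b_2\in S$ and $r_1b_1=r_2b_2$; it is a unital $K$-algebra with $r_1s_1^{-1}+r_2s_2^{-1}=(r_1c_1+r_2c_2)s^{-1}$ where $s_1c_1=s_2c_2=s\in S$ ($c_1\in S$, $c_2\in R$), and $(r_1s_1^{-1})(r_2s_2^{-1})=(r_1r')(s_2s')^{-1}$ where $r_2s'=s_1r'$ ($s'\in S$, $r'\in R$). All products in $R$ here are taken with respect to $\star$. *)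

theory Defs
  imports
    "HOL-Analysis.Analysis"
    "HOL-Algebra.Algebra"
    "HOL-Algebra.Algebraic_Closure_Type"
    "HOL-Computational_Algebra.Formal_Power_Series"
begin

section \<open>Calculus on open subsets of Euclidean space\<close>

text \<open>
  Scalars range over a type of sort \<open>{real_normed_field, euclidean_space}\<close>: its instances include
  \<^typ>\<open>real\<close> and \<^typ>\<open>complex\<close>, and by Frobenius' theorem every instance is isomorphic to one of them.
  Definitions are stated for the weaker sorts that suffice for them.

  Points of N-dimensional Euclidean space are the points of \<^term>\<open>Euclidean_space N\<close>, i.e. sequences
  that vanish from index N on; the dimension is an arbitrary natural number, zero included.
\<close>

definition partial :: "nat \<Rightarrow> ((nat \<Rightarrow> real) \<Rightarrow> 'k::real_normed_vector) \<Rightarrow> (nat \<Rightarrow> real) \<Rightarrow> 'k" where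
  "partial i F = (\<lambda>y. vector_derivative (\<lambda>t. F (y(i := t))) (at (y i)))"

definition iterated_partial ::
  "nat list \<Rightarrow> ((nat \<Rightarrow> real) \<Rightarrow> 'k::real_normed_vector) \<Rightarrow> (nat \<Rightarrow> real) \<Rightarrow> 'k" where
  "iterated_partial is F = foldr partial is F"

text \<open>
  All iterated partial derivatives exist and are continuous. Only the values of \<open>F\<close> on the open
  set \<open>V\<close> matter.
\<close>

definition smooth_on :: "nat \<Rightarrow> (nat \<Rightarrow> real) set \<Rightarrow> ((nat \<Rightarrow> real) \<Rightarrow> 'k::real_normed_vector) \<Rightarrow> bool" where
  "smooth_on N V F \<longleftrightarrow>
    (\<forall>is. set is \<subseteq> {..<N} \<longrightarrow>
       continuous_on V (iterated_partial is F) \<and>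
       (\<forall>i<N. \<forall>y\<in>V. (\<lambda>t. iterated_partial is F (y(i := t))) differentiable (at (y i))))"

definition multi_indices :: "nat \<Rightarrow> nat \<Rightarrow> (nat \<Rightarrow> nat) set" where
  "multi_indices N l = {\<alpha>. (\<forall>i\<ge>N. \<alpha> i = 0) \<and> (\<Sum>i<N. \<alpha> i) \<le> l}"

definition multi_partial ::
  "nat \<Rightarrow> (nat \<Rightarrow> nat) \<Rightarrow> ((nat \<Rightarrow> real) \<Rightarrow> 'k::real_normed_vector) \<Rightarrow> (nat \<Rightarrow> real) \<Rightarrow> 'k" where
  "multi_partial N \<alpha> F = foldr (\<lambda>i. partial i ^^ \<alpha> i) [0..<N] F"


section \<open>Smooth manifolds\<close>

type_synonym 'a chart = "'a set \<times> ('a \<Rightarrow> nat \<Rightarrow> real)"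

record 'a mfd =
  mtop :: "'a topology"
  mdim :: nat
  charts :: "'a chart set"

definition local_rep :: "'a chart \<Rightarrow> ('a \<Rightarrow> 'k) \<Rightarrow> (nat \<Rightarrow> real) \<Rightarrow> 'k" where
  "local_rep c f = (\<lambda>y. f (inv_into (fst c) (snd c) y))"

definition topological_chart :: "'a topology \<Rightarrow> nat \<Rightarrow> 'a chart \<Rightarrow> bool" where
  "topological_chart T N c \<longleftrightarrow>
    openin T (fst c) \<and> openin (Euclidean_space N) (snd c ` fst c) \<and>
    homeomorphic_map (subtopology T (fst c)) (subtopology (Euclidean_space N) (snd c ` fst c)) (snd c)"

definition smooth_transition :: "nat \<Rightarrow> 'a chart \<Rightarrow> 'a chart \<Rightarrow> bool" where
  "smooth_transition N c c' \<longleftrightarrow>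
    (\<forall>i<N. smooth_on N (snd c ` (fst c \<inter> fst c')) (local_rep c (\<lambda>x. snd c' x i)))"

definition compatible_charts :: "nat \<Rightarrow> 'a chart \<Rightarrow> 'a chart \<Rightarrow> bool" where
  "compatible_charts N c c' \<longleftrightarrow> smooth_transition N c c' \<and> smooth_transition N c' c"

text \<open>The last condition says that \<open>charts M\<close> is a maximal smooth atlas.\<close>

definition smooth_manifold :: "'a mfd \<Rightarrow> bool" where
  "smooth_manifold M \<longleftrightarrow>
    Hausdorff_space (mtop M) \<and> second_countable (mtop M) \<and>
    (\<Union>c\<in>charts M. fst c) = topspace (mtop M) \<and>
    (\<forall>c. c \<in> charts M \<longleftrightarrow>
       topological_chart (mtop M) (mdim M) c \<and> (\<forall>c'\<in>charts M. compatible_charts (mdim M) c c'))"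

text \<open>For a maximal atlas, the charts of an open submanifold are the charts with domain inside it.\<close>

definition open_submanifold :: "'a mfd \<Rightarrow> 'a set \<Rightarrow> 'a mfd" where
  "open_submanifold M U =
    \<lparr>mtop = subtopology (mtop M) U, mdim = mdim M, charts = {c \<in> charts M. fst c \<subseteq> U}\<rparr>"

abbreviation points :: "'a mfd \<Rightarrow> 'a set" where
  "points M \<equiv> topspace (mtop M)"

text \<open>Functions on M are taken to be \<^const>\<open>extensional\<close>, so that equality is equality on M.\<close>

definition smooth_functions :: "'a mfd \<Rightarrow> ('a \<Rightarrow> 'k::real_normed_vector) set" where
  "smooth_functions M =
    {f \<in> extensional (points M). \<forall>c\<in>charts M. smooth_on (mdim M) (snd c ` fst c) (local_rep c f)}"

definition chart_partial :: "'a chart \<Rightarrow> nat \<Rightarrow> ('a \<Rightarrow> 'k::real_normed_vector) \<Rightarrow> 'a \<Rightarrow> 'k" where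
  "chart_partial c i f x = partial i (local_rep c f) (snd c x)"

definition chart_multi_partial ::
  "nat \<Rightarrow> 'a chart \<Rightarrow> (nat \<Rightarrow> nat) \<Rightarrow> ('a \<Rightarrow> 'k::real_normed_vector) \<Rightarrow> 'a \<Rightarrow> 'k" where
  "chart_multi_partial N c \<alpha> f x = multi_partial N \<alpha> (local_rep c f) (snd c x)"


section \<open>Poisson manifolds\<close>

text \<open>
  A bivector field is given by its real components \<open>\<pi> c i j\<close> in every chart \<open>c\<close>, subject to
  antisymmetry and to the transformation law of contravariant 2-tensors.
\<close>

type_synonym 'a bivector_components = "'a chart \<Rightarrow> nat \<Rightarrow> nat \<Rightarrow> 'a \<Rightarrow> real"

definition bivector_field :: "'a mfd \<Rightarrow> 'a bivector_components \<Rightarrow> bool" where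
  "bivector_field M \<pi> \<longleftrightarrow>
    (\<forall>c\<in>charts M. \<forall>i<mdim M. \<forall>j<mdim M.
       restrict (\<pi> c i j) (fst c) \<in> smooth_functions (open_submanifold M (fst c)) \<and>
       (\<forall>x\<in>fst c. \<pi> c i j x = - \<pi> c j i x)) \<and>
    (\<forall>c\<in>charts M. \<forall>c'\<in>charts M. \<forall>x\<in>fst c \<inter> fst c'. \<forall>i<mdim M. \<forall>j<mdim M.
       \<pi> c' i j x =
         (\<Sum>k<mdim M. \<Sum>l<mdim M.
            chart_partial c k (\<lambda>y. snd c' y i) x * chart_partial c l (\<lambda>y. snd c' y j) x * \<pi> c k l x))"

text \<open>
  The function \<open>\<pi>(df, dg)\<close>, computed at each point in some chart around it; by the transformation
  law the chart does not matter. The real bivector is extended bilinearly to scalar-valued functions.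
\<close>

definition poisson_bracket ::
  "'a mfd \<Rightarrow> 'a bivector_components \<Rightarrow> ('a \<Rightarrow> 'k) \<Rightarrow> ('a \<Rightarrow> 'k) \<Rightarrow> 'a \<Rightarrow> 'k::real_normed_field" where
  "poisson_bracket M \<pi> f g =
    (\<lambda>x\<in>points M. let c = (SOME c. c \<in> charts M \<and> x \<in> fst c) in
       \<Sum>i<mdim M. \<Sum>j<mdim M. of_real (\<pi> c i j x) * chart_partial c i f x * chart_partial c j g x)"

definition poisson_manifold :: "'a mfd \<Rightarrow> 'a bivector_components \<Rightarrow> bool" where
  "poisson_manifold M \<pi> \<longleftrightarrow>
    smooth_manifold M \<and> bivector_field M \<pi> \<and>
    (\<forall>f\<in>smooth_functions M. \<forall>g\<in>smooth_functions M. \<forall>h\<in>smooth_functions M. \<forall>x\<in>points M.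
       poisson_bracket M \<pi> f (poisson_bracket M \<pi> g h) x
       + poisson_bracket M \<pi> g (poisson_bracket M \<pi> h f) x
       + poisson_bracket M \<pi> h (poisson_bracket M \<pi> f g) x = (0::real))"


section \<open>Bidifferential operators\<close>

type_synonym ('a, 'k) bi_op = "('a \<Rightarrow> 'k) \<Rightarrow> ('a \<Rightarrow> 'k) \<Rightarrow> 'a \<Rightarrow> 'k"

definition bilinear_on_smooth :: "'a mfd \<Rightarrow> ('a, 'k::real_normed_field) bi_op \<Rightarrow> bool" where
  "bilinear_on_smooth M C \<longleftrightarrow>
    (\<forall>f\<in>smooth_functions M. \<forall>g\<in>smooth_functions M. C f g \<in> smooth_functions M) \<and>
    (\<forall>f\<in>smooth_functions M. \<forall>g\<in>smooth_functions M. \<forall>h\<in>smooth_functions M. \<forall>a b. \<forall>x\<in>points M.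
       C (\<lambda>y\<in>points M. a * f y + b * g y) h x = a * C f h x + b * C g h x \<and>
       C h (\<lambda>y\<in>points M. a * f y + b * g y) x = a * C h f x + b * C h g x)"

definition bidifferential_operator :: "'a mfd \<Rightarrow> ('a, 'k::real_normed_field) bi_op \<Rightarrow> bool" where
  "bidifferential_operator M C \<longleftrightarrow>
    bilinear_on_smooth M C \<and>
    (\<exists>l. \<forall>c\<in>charts M. \<exists>A.
       (\<forall>\<alpha>\<in>multi_indices (mdim M) l. \<forall>\<beta>\<in>multi_indices (mdim M) l.
          A \<alpha> \<beta> \<in> smooth_functions (open_submanifold M (fst c))) \<and>
       (\<forall>f\<in>smooth_functions M. \<forall>g\<in>smooth_functions M. \<forall>x\<in>fst c.
          C f g x =
            (\<Sum>\<alpha>\<in>multi_indices (mdim M) l. \<Sum>\<beta>\<in>multi_indices (mdim M) l.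
               A \<alpha> \<beta> x * chart_multi_partial (mdim M) c \<alpha> f x * chart_multi_partial (mdim M) c \<beta> g x)))"

text \<open>
  The localization is unique as an operation on smooth functions on \<open>U\<close>; its values on other
  arguments are arbitrary, hence \<open>SOME\<close> rather than \<open>THE\<close>.
\<close>

definition localization :: "'a mfd \<Rightarrow> 'a set \<Rightarrow> ('a, 'k::real_normed_field) bi_op \<Rightarrow> ('a, 'k) bi_op" where
  "localization M U C =
    (SOME D. bidifferential_operator (open_submanifold M U) D \<and>
       (\<forall>f\<in>smooth_functions M. \<forall>g\<in>smooth_functions M.
          restrict (C f g) U = D (restrict f U) (restrict g U)))"


section \<open>Unital algebras, fractions and localization\<close>

text \<open>The library's \<open>algebra\<close> locale is restricted to commutative algebras.\<close>

locale unital_algebra = Module.module K A + ring A for K and A (structure) +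
  assumes smult_mult_left:
      "\<lbrakk>a \<in> carrier K; x \<in> carrier A; y \<in> carrier A\<rbrakk> \<Longrightarrow> (a \<odot> x) \<otimes> y = a \<odot> (x \<otimes> y)"
    and smult_mult_right:
      "\<lbrakk>a \<in> carrier K; x \<in> carrier A; y \<in> carrier A\<rbrakk> \<Longrightarrow> x \<otimes> (a \<odot> y) = a \<odot> (x \<otimes> y)"

definition algebra_hom ::
  "'c ring \<Rightarrow> ('c, 'r) module \<Rightarrow> ('c, 'q) module \<Rightarrow> ('r \<Rightarrow> 'q) set" where
  "algebra_hom K A B =
    {h \<in> ring_hom A B. \<forall>a\<in>carrier K. \<forall>x\<in>carrier A. h (a \<odot>\<^bsub>A\<^esub> x) = a \<odot>\<^bsub>B\<^esub> h x}"

definition algebra_isomorphic :: "'c ring \<Rightarrow> ('c, 'r) module \<Rightarrow> ('c, 'q) module \<Rightarrow> bool" where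
  "algebra_isomorphic K A B \<longleftrightarrow>
    unital_algebra K A \<and> unital_algebra K B \<and>
    (\<exists>h\<in>algebra_hom K A B. bij_betw h (carrier A) (carrier B))"

definition right_algebra_of_fractions ::
  "'c ring \<Rightarrow> ('c, 'r) module \<Rightarrow> 'r set \<Rightarrow> ('c, 'q) module \<Rightarrow> ('r \<Rightarrow> 'q) \<Rightarrow> bool" where
  "right_algebra_of_fractions K R S Q \<eta> \<longleftrightarrow>
    unital_algebra K R \<and> submonoid S R \<and> unital_algebra K Q \<and> \<eta> \<in> algebra_hom K R Q \<and>
    (\<forall>s\<in>S. \<eta> s \<in> Units Q) \<and>
    (\<forall>q\<in>carrier Q. \<exists>r\<in>carrier R. \<exists>s\<in>S. q = \<eta> r \<otimes>\<^bsub>Q\<^esub> inv\<^bsub>Q\<^esub> (\<eta> s)) \<and>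
    a_kernel R Q \<eta> = {r \<in> carrier R. \<exists>s\<in>S. r \<otimes>\<^bsub>R\<^esub> s = \<zero>\<^bsub>R\<^esub>}"

definition right_denominator_set :: "('c, 'r) module \<Rightarrow> 'r set \<Rightarrow> bool" where
  "right_denominator_set R S \<longleftrightarrow>
    submonoid S R \<and>
    (\<forall>r\<in>carrier R. \<forall>s\<in>S. \<exists>r'\<in>carrier R. \<exists>s'\<in>S. r \<otimes>\<^bsub>R\<^esub> s' = s \<otimes>\<^bsub>R\<^esub> r') \<and>
    (\<forall>r\<in>carrier R. \<forall>s'\<in>S. s' \<otimes>\<^bsub>R\<^esub> r = \<zero>\<^bsub>R\<^esub> \<longrightarrow> (\<exists>s\<in>S. r \<otimes>\<^bsub>R\<^esub> s = \<zero>\<^bsub>R\<^esub>))"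

definition fraction_rel :: "('c, 'r) module \<Rightarrow> 'r set \<Rightarrow> (('r \<times> 'r) \<times> ('r \<times> 'r)) set" where
  "fraction_rel R S =
    {((r\<^sub>1, s\<^sub>1), (r\<^sub>2, s\<^sub>2)).
       r\<^sub>1 \<in> carrier R \<and> s\<^sub>1 \<in> S \<and> r\<^sub>2 \<in> carrier R \<and> s\<^sub>2 \<in> S \<and>
       (\<exists>b\<^sub>1\<in>carrier R. \<exists>b\<^sub>2\<in>carrier R.
          s\<^sub>1 \<otimes>\<^bsub>R\<^esub> b\<^sub>1 = s\<^sub>2 \<otimes>\<^bsub>R\<^esub> b\<^sub>2 \<and> s\<^sub>1 \<otimes>\<^bsub>R\<^esub> b\<^sub>1 \<in> S \<and> r\<^sub>1 \<otimes>\<^bsub>R\<^esub> b\<^sub>1 = r\<^sub>2 \<otimes>\<^bsub>R\<^esub> b\<^sub>2)}"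

definition fraction :: "('c, 'r) module \<Rightarrow> 'r set \<Rightarrow> 'r \<Rightarrow> 'r \<Rightarrow> ('r \<times> 'r) set" where
  "fraction R S r s = fraction_rel R S `` {(r, s)}"

text \<open>
  In each operation \<open>THE\<close> picks the common value of the formula over all admissible choices of
  representatives and of the auxiliary elements.
\<close>

definition right_localization :: "('c, 'r) module \<Rightarrow> 'r set \<Rightarrow> ('c, ('r \<times> 'r) set) module" where
  "right_localization R S =
    \<lparr>carrier = (carrier R \<times> S) // fraction_rel R S,
     monoid.mult = (\<lambda>p q. THE z. \<exists>r\<^sub>1 s\<^sub>1 r\<^sub>2 s\<^sub>2 r' s'.
       (r\<^sub>1, s\<^sub>1) \<in> p \<and> (r\<^sub>2, s\<^sub>2) \<in> q \<and> r' \<in> carrier R \<and> s' \<in> S \<and>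
       r\<^sub>2 \<otimes>\<^bsub>R\<^esub> s' = s\<^sub>1 \<otimes>\<^bsub>R\<^esub> r' \<and>
       z = fraction R S (r\<^sub>1 \<otimes>\<^bsub>R\<^esub> r') (s\<^sub>2 \<otimes>\<^bsub>R\<^esub> s')),
     one = fraction R S \<one>\<^bsub>R\<^esub> \<one>\<^bsub>R\<^esub>,
     ring.zero = fraction R S \<zero>\<^bsub>R\<^esub> \<one>\<^bsub>R\<^esub>,
     add = (\<lambda>p q. THE z. \<exists>r\<^sub>1 s\<^sub>1 r\<^sub>2 s\<^sub>2 c\<^sub>1 c\<^sub>2.
       (r\<^sub>1, s\<^sub>1) \<in> p \<and> (r\<^sub>2, s\<^sub>2) \<in> q \<and> c\<^sub>1 \<in> S \<and> c\<^sub>2 \<in> carrier R \<and>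
       s\<^sub>1 \<otimes>\<^bsub>R\<^esub> c\<^sub>1 = s\<^sub>2 \<otimes>\<^bsub>R\<^esub> c\<^sub>2 \<and> s\<^sub>1 \<otimes>\<^bsub>R\<^esub> c\<^sub>1 \<in> S \<and>
       z = fraction R S (r\<^sub>1 \<otimes>\<^bsub>R\<^esub> c\<^sub>1 \<oplus>\<^bsub>R\<^esub> r\<^sub>2 \<otimes>\<^bsub>R\<^esub> c\<^sub>2) (s\<^sub>1 \<otimes>\<^bsub>R\<^esub> c\<^sub>1)),
     smult = (\<lambda>a p. THE z. \<exists>r s. (r, s) \<in> p \<and> z = fraction R S (a \<odot>\<^bsub>R\<^esub> r) s)\<rparr>"


section \<open>Star products\<close>

text \<open>
  A formal power series of functions is an element of \<^typ>\<open>('a \<Rightarrow> 'k) fps\<close>, used only as a sequence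
  of coefficients: none of the arithmetic of the type \<open>fps\<close> is involved here. The scalars are the ring
  \<^typ>\<open>'k fps\<close>, in which \<open>\<lambda>\<close> is \<^const>\<open>fps_X\<close>.
\<close>

definition constant_series :: "'a mfd \<Rightarrow> ('a \<Rightarrow> 'k) \<Rightarrow> ('a \<Rightarrow> 'k::zero) fps" where
  "constant_series M f = Abs_fps (\<lambda>n. if n = 0 then f else (\<lambda>x\<in>points M. 0))"

definition star_algebra ::
  "'a mfd \<Rightarrow> (nat \<Rightarrow> ('a, 'k::real_normed_field) bi_op) \<Rightarrow> ('k fps, ('a \<Rightarrow> 'k) fps) module" where
  "star_algebra M C =
    \<lparr>carrier = {f. \<forall>n. fps_nth f n \<in> smooth_functions M},
     monoid.mult = (\<lambda>f g. Abs_fps (\<lambda>k. \<lambda>x\<in>points M.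
       \<Sum>(l, p, q) \<in> {(l, p, q). l + p + q = k}. C l (fps_nth f p) (fps_nth g q) x)),
     one = constant_series M (\<lambda>x\<in>points M. 1),
     ring.zero = constant_series M (\<lambda>x\<in>points M. 0),
     add = (\<lambda>f g. Abs_fps (\<lambda>k. \<lambda>x\<in>points M. fps_nth f k x + fps_nth g k x)),
     smult = (\<lambda>a f. Abs_fps (\<lambda>k. \<lambda>x\<in>points M. \<Sum>i\<le>k. fps_nth a i * fps_nth f (k - i) x))\<rparr>"

text \<open>
  The third condition comprises associativity, bilinearity over the formal power series ring, and
  the unit law for the constant function 1.
\<close>

definition star_product :: "'a mfd \<Rightarrow> (nat \<Rightarrow> ('a, 'k::real_normed_field) bi_op) \<Rightarrow> bool" where
  "star_product M C \<longleftrightarrow>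
    (\<forall>k. bidifferential_operator M (C k)) \<and>
    (\<forall>f\<in>smooth_functions M. \<forall>g\<in>smooth_functions M. C 0 f g = (\<lambda>x\<in>points M. f x * g x)) \<and>
    unital_algebra ring_of_type_algebra (star_algebra M C)"

definition poisson_star_product ::
  "'a mfd \<Rightarrow> 'a bivector_components \<Rightarrow> (nat \<Rightarrow> ('a, 'k::real_normed_field) bi_op) \<Rightarrow> bool" where
  "poisson_star_product M \<pi> C \<longleftrightarrow>
    star_product M C \<and>
    (\<forall>f\<in>smooth_functions M. \<forall>g\<in>smooth_functions M. \<forall>x\<in>points M.
       (C 1 f g x - C 1 g f x) / 2 = poisson_bracket M \<pi> f g x)"

definition localized_star_algebra ::
  "'a mfd \<Rightarrow> (nat \<Rightarrow> ('a, 'k::real_normed_field) bi_op) \<Rightarrow> 'a set \<Rightarrow> ('k fps, ('a \<Rightarrow> 'k) fps) module" where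
  "localized_star_algebra M C U =
    star_algebra (open_submanifold M U) (\<lambda>k. localization M U (C k))"

definition restrict_series :: "'a set \<Rightarrow> ('a \<Rightarrow> 'k) fps \<Rightarrow> ('a \<Rightarrow> 'k) fps" where
  "restrict_series U f = Abs_fps (\<lambda>n. restrict (fps_nth f n) U)"

definition nonvanishing_functions :: "'a mfd \<Rightarrow> 'a set \<Rightarrow> ('a \<Rightarrow> 'k::real_normed_field) set" where
  "nonvanishing_functions M U = {g \<in> smooth_functions M. \<forall>x\<in>U. g x \<noteq> 0}"

definition nonvanishing_series ::
  "'a mfd \<Rightarrow> (nat \<Rightarrow> ('a, 'k::real_normed_field) bi_op) \<Rightarrow> 'a set \<Rightarrow> ('a \<Rightarrow> 'k) fps set" where
  "nonvanishing_series M C U =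
    constant_series M ` nonvanishing_functions M U
    <+>\<^bsub>star_algebra M C\<^esub>
    {fps_X \<odot>\<^bsub>star_algebra M C\<^esub> r | r. r \<in> carrier (star_algebra M C)}"

end

theory Submission
  imports Defs
begin

text \<open>
  Every formal series over \<open>\<Omega>\<close> has a right denominator, and it can even be chosen classical. Cover \<open>\<Omega>\<close>
  by countably many bump functions \<open>\<beta>\<^sub>m\<close> with support in \<open>\<Omega>\<close> and put \<open>g = \<Sum>\<^sub>m \<epsilon>\<^sub>m \<beta>\<^sub>m\<close>. As the smooth functions
  form a Frechet space, the \<open>\<epsilon>\<^sub>m > 0\<close> can be chosen so small that this series and the countably many
  series \<open>\<Sum>\<^sub>m \<epsilon>\<^sub>m C\<^sub>l(q\<^sub>p, \<beta>\<^sub>m)\<close> converge in the smooth functions on the whole manifold. Then \<open>g\<close> vanishes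
  nowhere on \<open>\<Omega>\<close>, every \<open>C\<^sub>l(q\<^sub>p, g)\<close> extends smoothly from \<open>\<Omega>\<close>, and \<open>C\<^sub>l(f, g)\<close> vanishes off \<open>\<Omega>\<close> for every
  smooth \<open>f\<close>. The first two properties make every series over \<open>\<Omega>\<close> a right fraction, the last one
  determines the kernel of the restriction. The Ore condition and the isomorphism with the
  algebraic localization hold for every algebra of right fractions.
\<close>

section \<open>Calculus on open subsets of Euclidean space\<close>

text \<open>Clearing denominators order by order would not work: the coefficients of a series over
  the open set may grow faster and faster towards the boundary, and a new factor for each power of
  lambda leads to an infinite product. One function has to be small enough for all orders at once.
  This is possible because a denominator \<open>g\<close> constant in lambda produces only the
  functions \<open>C\<^sub>l(q\<^sub>p, g)\<close>, which are countably many, and because locality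
  makes each \<open>C\<^sub>l(q\<^sub>p, \<beta>\<^sub>m)\<close> smooth on the whole manifold,
  whatever \<open>q\<^sub>p\<close> does at the boundary. Since the series for \<open>g\<close>
  converges together with its derivatives, \<open>g\<close> vanishes to infinite order off the open
  set. The dimension is a variable, so points are sequences and calculus is carried out with partial
  derivatives along coordinate lines. On the algebraic side, a class of fractions is described as
  the set of solutions \<open>(r, s)\<close> of \<open>\<eta> r = q \<otimes> \<eta> s\<close>, so
  that calculations with fractions become calculations in the algebra over the open set.\<close>

lemma Euclidean_space_eq_top_of_set: "Euclidean_space N = top_of_set {y. \<forall>i\<ge>N. y i = 0}"
  by (simp add: Euclidean_space_def euclidean_product_topology)

section \<open>Cubes as compact neighbourhoods in Euclidean space\<close>

definition cube :: "nat \<Rightarrow> (nat \<Rightarrow> real) \<Rightarrow> real \<Rightarrow> (nat \<Rightarrow> real) set" where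
  "cube N a r = {y. (\<forall>i\<ge>N. y i = 0) \<and> (\<forall>i<N. \<bar>y i - a i\<bar> \<le> r)}"

lemma cube_eq_PiE:
  "cube N a r = PiE UNIV (\<lambda>i. if i < N then {a i - r..a i + r} else {0})"
  by (auto simp: cube_def PiE_UNIV_domain Pi_iff abs_le_iff split: if_splits)
    (force simp: algebra_simps)+

text \<open>Tychonoff: a cube is a product of compact intervals, the factors from index
  \<open>N\<close> on being \<open>{0}\<close>.\<close>

lemma compact_cube: "compact (cube N a r)"
proof -
  have "compactin (product_topology (\<lambda>i. euclidean) UNIV)
      (PiE UNIV (\<lambda>i. if i < N then {a i - r..a i + r} else {0}))"
    by (subst compactin_PiE) auto
  then show ?thesis
    by (simp add: euclidean_product_topology cube_eq_PiE)
qed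

lemma open_cube_openin: "openin (Euclidean_space N) {y. (\<forall>i\<ge>N. y i = 0) \<and> (\<forall>i<N. \<bar>y i - a i\<bar> < r)}"
proof -
  have "open {y::nat \<Rightarrow> real. \<bar>y i - a i\<bar> < r}" for i
    by (intro open_Collect_less continuous_intros)
       (auto intro!: continuous_intros continuous_on_product_coordinates)
  then have "open (\<Inter>i\<in>{..<N}. {y::nat \<Rightarrow> real. \<bar>y i - a i\<bar> < r})"
    by (intro open_INT) auto
  moreover have "{y. (\<forall>i\<ge>N. y i = 0) \<and> (\<forall>i<N. \<bar>y i - a i\<bar> < r)} =
      {y. \<forall>i\<ge>N. y i = 0} \<inter> (\<Inter>i\<in>{..<N}. {y. \<bar>y i - a i\<bar> < r})"
    by auto
  ultimately show ?thesis
    unfolding Euclidean_space_eq_top_of_set openin_open by blast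
qed

lemma openin_contains_cube:
  assumes "openin (Euclidean_space N) V" "a \<in> V"
  obtains r where "r > 0" "cube N a r \<subseteq> V"
proof -
  obtain T where T: "open T" "V = {y. \<forall>i\<ge>N. y i = 0} \<inter> T"
    using assms(1) unfolding Euclidean_space_eq_top_of_set openin_open by blast
  have "openin (product_topology (\<lambda>i::nat. euclidean :: real topology) UNIV) T"
    using T(1) by (simp add: euclidean_product_topology)
  moreover have "a \<in> T" using assms T by auto
  ultimately obtain B where B: "a \<in> PiE UNIV B" "\<And>i. openin euclidean (B i)" "PiE UNIV B \<subseteq> T"
    using product_topology_open_contains_basis[of "\<lambda>i. euclidean" UNIV T a] by blast
  have "\<exists>r>0. cball (a i) r \<subseteq> B i" for i
  proof -
    have "a i \<in> B i" using B(1) by auto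
    moreover have "open (B i)" using B(2) by simp
    ultimately show ?thesis using open_contains_cball by blast
  qed
  then obtain e where e: "\<And>i. e i > 0" "\<And>i. cball (a i) (e i) \<subseteq> B i"
    by metis
  \<comment> \<open>Only the coordinates below \<open>N\<close> constrain the radius; the inserted 1
    keeps the set nonempty when \<open>N\<close> is 0.\<close>
  define r where "r = Min (insert 1 (e ` {..<N}))"
  have "r > 0" unfolding r_def using e(1) by (subst Min_gr_iff) auto
  moreover have "cube N a r \<subseteq> V"
  proof
    fix y assume y: "y \<in> cube N a r"
    have "y i \<in> B i" for i
    proof (cases "i < N")
      case True
      then have "\<bar>y i - a i\<bar> \<le> r" using y by (auto simp: cube_def)
      also have "r \<le> e i" unfolding r_def using True by (intro Min_le) auto
      finally have "y i \<in> cball (a i) (e i)" by (simp add: dist_real_def abs_minus_commute)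
      then show ?thesis using e(2)[of i] by (metis subsetD)
    next
      case False
      have "y i = 0" "a i = 0" using False y assms(2) T by (auto simp: cube_def)
      moreover have "a i \<in> B i" using B(1) by auto
      ultimately show ?thesis by simp
    qed
    then have "y \<in> T" using B(3) by (auto simp: PiE_UNIV_domain)
    then show "y \<in> V" using y T by (auto simp: cube_def)
  qed
  ultimately show ?thesis using that by blast
qed

text \<open>Partial derivatives are taken along coordinate lines, and only those with
  \<open>i < N\<close> stay in Euclidean space. The filter is \<open>nhds\<close> rather than
  \<open>at\<close>, so that the point itself is included when two functions are compared.\<close>

lemma eventually_line_in:
  assumes "openin (Euclidean_space N) V" "y \<in> V" "i < N"
  shows "\<forall>\<^sub>F t in nhds (y i). y(i := t) \<in> V"
proof -
  obtain r where r: "r > 0" "cube N y r \<subseteq> V"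
    using openin_contains_cube assms by blast
  have "y j = 0" if "j \<ge> N" for j
    using openin_subset[OF assms(1)] assms(2) that by (auto simp: topspace_Euclidean_space)
  then have "y(i := t) \<in> cube N y r" if "dist t (y i) < r" for t
    using that r assms(3) by (auto simp: cube_def dist_real_def)
  then show ?thesis
    using r unfolding eventually_nhds_metric by blast
qed

section \<open>Functions of class C^k and their rules of calculus\<close>

primrec cont_diff_on ::
  "nat \<Rightarrow> nat \<Rightarrow> (nat \<Rightarrow> real) set \<Rightarrow> ((nat \<Rightarrow> real) \<Rightarrow> 'k::real_normed_vector) \<Rightarrow> bool" where
  "cont_diff_on 0 N V F \<longleftrightarrow> continuous_on V F"
| "cont_diff_on (Suc k) N V F \<longleftrightarrow> continuous_on V F \<and>
     (\<forall>i<N. (\<forall>y\<in>V. (\<lambda>t. F (y(i := t))) differentiable (at (y i))) \<and> cont_diff_on k N V (partial i F))"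

lemma cont_diff_on_imp_continuous: "cont_diff_on k N V F \<Longrightarrow> continuous_on V F"
  by (cases k) auto

lemma cont_diff_on_SucD: "cont_diff_on (Suc k) N V F \<Longrightarrow> cont_diff_on k N V F"
  by (induction k arbitrary: F) auto

lemma cont_diff_on_le: "cont_diff_on k N V F \<Longrightarrow> m \<le> k \<Longrightarrow> cont_diff_on m N V F"
  by (induction k) (auto simp: le_Suc_eq dest: cont_diff_on_SucD simp del: cont_diff_on.simps)

lemma cont_diff_on_subset: "cont_diff_on k N V F \<Longrightarrow> W \<subseteq> V \<Longrightarrow> cont_diff_on k N W F"
  by (induction k arbitrary: F) (auto intro: continuous_on_subset)

lemma has_partial:
  assumes "cont_diff_on (Suc k) N V F" "i < N" "y \<in> V"
  shows "((\<lambda>t. F (y(i := t))) has_vector_derivative partial i F y) (at (y i))"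
  using assms vector_derivative_works unfolding partial_def by auto

lemma partial_eqI:
  "((\<lambda>t. F (y(i := t))) has_vector_derivative D) (at (y i)) \<Longrightarrow> partial i F y = D"
  unfolding partial_def by (rule vector_derivative_at)

lemma has_partial_cong:
  assumes "openin (Euclidean_space N) V" "y \<in> V" "i < N" "\<And>z. z \<in> V \<Longrightarrow> F z = G z"
  shows "((\<lambda>t. F (y(i := t))) has_vector_derivative D) (at (y i)) \<longleftrightarrow>
         ((\<lambda>t. G (y(i := t))) has_vector_derivative D) (at (y i))"
proof -
  have "\<forall>\<^sub>F t in nhds (y i). F (y(i := t)) = G (y(i := t))"
    using eventually_line_in[OF assms(1-3)] by eventually_elim (use assms in auto)
  then show ?thesis
    by (intro has_vector_derivative_cong_ev) (auto dest: eventually_nhds_x_imp_x)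
qed

lemma partial_cong:
  assumes "openin (Euclidean_space N) V" "y \<in> V" "i < N" "\<And>z. z \<in> V \<Longrightarrow> F z = G z"
  shows "partial i F y = partial i G y"
  using has_partial_cong[OF assms(1-3), where F = F and G = G] assms(4) unfolding partial_def vector_derivative_def by simp

lemma differentiable_line_cong:
  fixes F G :: "(nat \<Rightarrow> real) \<Rightarrow> 'a::real_normed_vector"
  assumes "openin (Euclidean_space N) V" "y \<in> V" "i < N" "\<And>z. z \<in> V \<Longrightarrow> F z = G z"
  shows "(\<lambda>t. F (y(i := t))) differentiable (at (y i)) \<longleftrightarrow>
         (\<lambda>t. G (y(i := t))) differentiable (at (y i))"
proof -
  have *: "f differentiable (at t) \<longleftrightarrow> (\<exists>D. (f has_vector_derivative D) (at t))"
    for f :: "real \<Rightarrow> 'a" and t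
    using differentiableI_vector vector_derivative_works by blast
  show ?thesis
    unfolding * using has_partial_cong[OF assms(1-3), where F = F and G = G] assms(4) by simp
qed

lemma cont_diff_on_cong_imp:
  assumes "openin (Euclidean_space N) V"
  shows "(\<And>z. z \<in> V \<Longrightarrow> F z = G z) \<Longrightarrow> cont_diff_on k N V F \<Longrightarrow> cont_diff_on k N V G"
proof (induction k arbitrary: F G)
  case 0
  then show ?case using continuous_on_eq by (metis cont_diff_on.simps(1))
next
  case (Suc k)
  show ?case
    unfolding cont_diff_on.simps
  proof (intro conjI allI impI ballI)
    show "continuous_on V G"
      using Suc.prems continuous_on_eq by (metis cont_diff_on.simps(2))
    fix i assume i: "i < N"
    show "(\<lambda>t. G (y(i := t))) differentiable at (y i)" if "y \<in> V" for y
      using differentiable_line_cong[OF assms that i, of F G] Suc.prems that i by auto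
    show "cont_diff_on k N V (partial i G)"
      by (rule Suc.IH[of "partial i F"])
        (use Suc.prems i partial_cong[OF assms, of _ i F G] in auto)
  qed
qed

lemma cont_diff_on_cong:
  assumes "openin (Euclidean_space N) V" "\<And>z. z \<in> V \<Longrightarrow> F z = G z"
  shows "cont_diff_on k N V F \<longleftrightarrow> cont_diff_on k N V G"
  using cont_diff_on_cong_imp[OF assms(1), of F G k] cont_diff_on_cong_imp[OF assms(1), of G F k]
    assms(2) by auto

text \<open>The working rule for the closure properties below: the derivatives are given by a
  formula \<open>D\<close>, which by congruence replaces \<open>partial i F\<close> on the open
  set.\<close>

lemma cont_diff_on_SucI:
  assumes "openin (Euclidean_space N) V" "continuous_on V F"
    and "\<And>i y. i < N \<Longrightarrow> y \<in> V \<Longrightarrow> ((\<lambda>t. F (y(i := t))) has_vector_derivative D i y) (at (y i))"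
    and "\<And>i. i < N \<Longrightarrow> cont_diff_on k N V (D i)"
  shows "cont_diff_on (Suc k) N V F"
proof -
  have "cont_diff_on k N V (partial i F)" if "i < N" for i
  proof (rule cont_diff_on_cong_imp[OF assms(1) _ assms(4)[OF that]])
    show "D i y = partial i F y" if "y \<in> V" for y
      using partial_eqI[OF assms(3)[OF \<open>i < N\<close> that]] by simp
  qed
  then show ?thesis
    using assms(2,3) differentiableI_vector by (fastforce intro: differentiableI_vector)
qed

lemma cont_diff_on_local:
  assumes "openin (Euclidean_space N) V"
    and "\<And>y. y \<in> V \<Longrightarrow> \<exists>W. openin (Euclidean_space N) W \<and> y \<in> W \<and> cont_diff_on k N W F"
  shows "cont_diff_on k N V F"
  using assms(2)
proof (induction k arbitrary: F)
  case 0
  \<comment> \<open>A set open in Euclidean space is the trace of an open set of sequences, and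
    continuity within \<open>V\<close> can be tested on the latter.\<close>
  have *: "\<exists>W. open W \<and> y \<in> W \<and> continuous_on (V \<inter> W) F" if y: "y \<in> V" for y
  proof -
    obtain W where W: "openin (Euclidean_space N) W" "y \<in> W" "continuous_on W F"
      using 0 y by (metis cont_diff_on.simps(1))
    obtain T where "open T" "W = {y. \<forall>i\<ge>N. y i = 0} \<inter> T"
      using W(1) unfolding Euclidean_space_eq_top_of_set openin_open by blast
    moreover have "V \<subseteq> {y. \<forall>i\<ge>N. y i = 0}"
      using openin_subset[OF assms(1)] by (simp add: topspace_Euclidean_space)
    ultimately show ?thesis
      using W by (intro exI[of _ T]) (auto intro: continuous_on_subset)
  qed
  then have "continuous (at y within V) F" if "y \<in> V" for y
  proof -
    obtain W where W: "open W" "y \<in> W" "continuous_on (V \<inter> W) F"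
      using * \<open>y \<in> V\<close> by blast
    have "at y within V = at y within (V \<inter> W)"
      by (rule at_within_nhd[OF W(2,1)]) auto
    then show ?thesis
      using W that by (simp add: continuous_on_eq_continuous_within)
  qed
  then show ?case
    by (simp add: continuous_on_eq_continuous_within)
next
  case (Suc k)
  show ?case
    unfolding cont_diff_on.simps
  proof (intro conjI allI impI ballI)
    have "cont_diff_on k N V F"
      by (rule Suc.IH) (metis Suc.prems cont_diff_on_SucD)
    then show "continuous_on V F" by (rule cont_diff_on_imp_continuous)
    fix i assume i: "i < N"
    show "(\<lambda>t. F (y(i := t))) differentiable at (y i)" if "y \<in> V" for y
      using Suc.prems[OF that] i by (metis cont_diff_on.simps(2))
    show "cont_diff_on k N V (partial i F)"
      by (rule Suc.IH) (metis Suc.prems i cont_diff_on.simps(2))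
  qed
qed

lemma cont_diff_on_const: "openin (Euclidean_space N) V \<Longrightarrow> cont_diff_on k N V (\<lambda>y. c)"
proof (induction k arbitrary: c)
  case (Suc k)
  then show ?case
    by (intro cont_diff_on_SucI[where D = "\<lambda>i y. 0"]) auto
qed auto

lemma cont_diff_on_coordinate:
  assumes "openin (Euclidean_space N) V"
  shows "cont_diff_on k N V (\<lambda>y. y j)"
proof (cases k)
  case (Suc m)
  show ?thesis
    unfolding Suc
  proof (rule cont_diff_on_SucI[OF assms, where D = "\<lambda>i y. if i = j then 1 else 0"])
    show "((\<lambda>t. (y(i := t)) j) has_vector_derivative (if i = j then 1 else 0)) (at (y i))" for i y
      by (auto intro!: derivative_eq_intros)
    show "cont_diff_on m N V (\<lambda>y. if i = j then 1 else 0)" for i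
      using cont_diff_on_const[OF assms] by (cases "i = j") auto
  qed (auto intro: continuous_on_subset[OF continuous_on_product_coordinates])
qed (auto intro: continuous_on_subset[OF continuous_on_product_coordinates])

lemma cont_diff_on_add:
  assumes "openin (Euclidean_space N) V"
  shows "cont_diff_on k N V F \<Longrightarrow> cont_diff_on k N V G \<Longrightarrow> cont_diff_on k N V (\<lambda>y. F y + G y)"
proof (induction k arbitrary: F G)
  case (Suc k)
  show ?case
    by (rule cont_diff_on_SucI[OF assms, where D = "\<lambda>i y. partial i F y + partial i G y"])
      (use Suc has_partial[OF Suc.prems(1)] has_partial[OF Suc.prems(2)] in
        \<open>auto intro!: continuous_intros has_vector_derivative_add\<close>)
qed (auto intro: continuous_on_add)

lemma cont_diff_on_sum:
  assumes "openin (Euclidean_space N) V" "\<And>j. j \<in> J \<Longrightarrow> cont_diff_on k N V (F j)"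
  shows "cont_diff_on k N V (\<lambda>y. \<Sum>j\<in>J. F j y)"
  using assms(2)
  by (induction J rule: infinite_finite_induct)
    (auto intro!: cont_diff_on_add cont_diff_on_const assms(1))

text \<open>One induction serves ordinary products and scalar multiples. The product rule pairs each
  function with the derivatives of the other, so the induction runs over all pairs.\<close>

lemma (in bounded_bilinear) cont_diff_on:
  assumes "openin (Euclidean_space N) V"
  shows "cont_diff_on k N V F \<Longrightarrow> cont_diff_on k N V G \<Longrightarrow> cont_diff_on k N V (\<lambda>y. prod (F y) (G y))"
proof (induction k arbitrary: F G)
  case (Suc k)
  have FG: "cont_diff_on k N V F" "cont_diff_on k N V G"
    using Suc.prems cont_diff_on_SucD by blast+
  show ?case
  proof (rule cont_diff_on_SucI[OF assms,
        where D = "\<lambda>i y. prod (F y) (partial i G y) + prod (partial i F y) (G y)"])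
    show "continuous_on V (\<lambda>y. prod (F y) (G y))"
      using Suc.prems by (auto intro!: continuous_on)
    fix i assume i: "i < N"
    show "((\<lambda>t. prod (F (y(i := t))) (G (y(i := t)))) has_vector_derivative
           prod (F y) (partial i G y) + prod (partial i F y) (G y)) (at (y i))" if "y \<in> V" for y
      using has_vector_derivative[OF has_partial[OF Suc.prems(1) i that] has_partial[OF Suc.prems(2) i that]]
      unfolding fun_upd_triv .
    show "cont_diff_on k N V (\<lambda>y. prod (F y) (partial i G y) + prod (partial i F y) (G y))"
      using Suc.IH FG Suc.prems i by (intro cont_diff_on_add[OF assms]) auto
  qed
qed (auto intro: continuous_on)

lemmas cont_diff_on_mult = bounded_bilinear.cont_diff_on[OF bounded_bilinear_mult]
lemmas cont_diff_on_scaleR = bounded_bilinear.cont_diff_on[OF bounded_bilinear_scaleR]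

lemma (in bounded_linear) cont_diff_on:
  assumes "openin (Euclidean_space N) V"
  shows "cont_diff_on k N V F \<Longrightarrow> cont_diff_on k N V (\<lambda>y. f (F y))"
proof (induction k arbitrary: F)
  case (Suc k)
  show ?case
    by (rule cont_diff_on_SucI[OF assms, where D = "\<lambda>i y. f (partial i F y)"])
      (use Suc has_vector_derivative[OF has_partial[OF Suc.prems]] in
        \<open>auto intro!: continuous_on\<close>)
qed (auto intro: continuous_on)

lemma cont_diff_on_prod:
  fixes F :: "'i \<Rightarrow> (nat \<Rightarrow> real) \<Rightarrow> 'k::real_normed_field"
  assumes "openin (Euclidean_space N) V" "\<And>j. j \<in> J \<Longrightarrow> cont_diff_on k N V (F j)"
  shows "cont_diff_on k N V (\<lambda>y. \<Prod>j\<in>J. F j y)"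
  using assms(2)
  by (induction J rule: infinite_finite_induct)
    (auto intro!: cont_diff_on_mult cont_diff_on_const assms(1))

text \<open>The derivative of 1/F again contains 1/F, but only to order \<open>k\<close>, where the
  induction hypothesis supplies it.\<close>

lemma cont_diff_on_inverse:
  fixes F :: "(nat \<Rightarrow> real) \<Rightarrow> 'k::real_normed_field"
  assumes "openin (Euclidean_space N) V" "\<And>y. y \<in> V \<Longrightarrow> F y \<noteq> 0"
  shows "cont_diff_on k N V F \<Longrightarrow> cont_diff_on k N V (\<lambda>y. inverse (F y))"
proof (induction k)
  case 0
  then show ?case using assms(2) by (auto intro!: continuous_intros)
next
  case (Suc k)
  have F: "cont_diff_on k N V F"
    using Suc.prems cont_diff_on_SucD by blast
  show ?case
  proof (rule cont_diff_on_SucI[OF assms(1),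
        where D = "\<lambda>i y. (-1) * ((inverse (F y) * partial i F y) * inverse (F y))"])
    show "continuous_on V (\<lambda>y. inverse (F y))"
      using Suc.prems assms(2) by (auto intro!: continuous_intros)
    fix i assume i: "i < N"
    show "((\<lambda>t. inverse (F (y(i := t)))) has_vector_derivative
           (-1) * ((inverse (F y) * partial i F y) * inverse (F y))) (at (y i))" if "y \<in> V" for y
    proof -
      have "((\<lambda>t. F (y(i := t))) has_derivative (\<lambda>h. h *\<^sub>R partial i F y)) (at (y i))"
        using has_partial[OF Suc.prems i that] unfolding has_vector_derivative_def .
      from Deriv.has_derivative_inverse[OF _ this] assms(2)[OF that] show ?thesis
        by (simp add: has_vector_derivative_def)
    qed
    show "cont_diff_on k N V (\<lambda>y. (-1) * ((inverse (F y) * partial i F y) * inverse (F y)))"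
      using Suc F i by (intro cont_diff_on_mult cont_diff_on_const assms(1)) auto
  qed
qed

section \<open>Iterated partial derivatives and smoothness\<close>

lemma iterated_partial_Nil [simp]: "iterated_partial [] F = F"
  and iterated_partial_Cons: "iterated_partial (i # is) F = partial i (iterated_partial is F)"
  and iterated_partial_append: "iterated_partial (is @ js) F = iterated_partial is (iterated_partial js F)"
  by (simp_all add: iterated_partial_def)

lemma cont_diff_on_partial: "cont_diff_on (Suc k) N V F \<Longrightarrow> i < N \<Longrightarrow> cont_diff_on k N V (partial i F)"
  by simp

lemma cont_diff_on_iterated_partial:
  "cont_diff_on (k + length is) N V F \<Longrightarrow> set is \<subseteq> {..<N} \<Longrightarrow> cont_diff_on k N V (iterated_partial is F)"
proof (induction "is" arbitrary: k)
  case (Cons i "is")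
  then have "cont_diff_on (Suc k) N V (iterated_partial is F)"
    by (metis Cons.IH add_Suc_shift length_Cons set_subset_Cons subset_trans)
  then show ?case
    using Cons.prems cont_diff_on_partial unfolding iterated_partial_Cons by auto
qed simp

lemma smooth_on_partial:
  assumes "smooth_on N V F" "i < N"
  shows "smooth_on N V (partial i F)"
  unfolding smooth_on_def
proof (intro allI impI)
  fix "is" assume "set is \<subseteq> {..<N}"
  then have "set (is @ [i]) \<subseteq> {..<N}" using assms(2) by auto
  from assms(1)[unfolded smooth_on_def, rule_format, OF this]
  show "continuous_on V (iterated_partial is (partial i F)) \<and>
      (\<forall>j<N. \<forall>y\<in>V. (\<lambda>t. iterated_partial is (partial i F) (y(j := t))) differentiable (at (y j)))"
    by (simp add: iterated_partial_append iterated_partial_Cons)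
qed

text \<open>Finite orders admit induction: product, quotient and chain rule reduce order
  \<open>k + 1\<close> to order \<open>k\<close>, while smoothness itself offers nothing to descend
  on.\<close>

lemma smooth_on_iff_cont_diff_on: "smooth_on N V F \<longleftrightarrow> (\<forall>k. cont_diff_on k N V F)"
proof
  show "\<forall>k. cont_diff_on k N V F" if "smooth_on N V F"
  proof
    fix k
    show "cont_diff_on k N V F" using that
    proof (induction k arbitrary: F)
      case 0
      from 0[unfolded smooth_on_def, rule_format, of "[]"] show ?case by simp
    next
      case (Suc k)
      from Suc.prems[unfolded smooth_on_def, rule_format, of "[]"] show ?case
        using Suc.IH[OF smooth_on_partial[OF Suc.prems]] by auto
    qed
  qed
next
  assume *: "\<forall>k. cont_diff_on k N V F"
  show "smooth_on N V F"
    unfolding smooth_on_def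
  proof (intro allI impI)
    fix "is" assume "set is \<subseteq> {..<N}"
    then have "cont_diff_on (Suc 0) N V (iterated_partial is F)"
      using * cont_diff_on_iterated_partial by blast
    then show "continuous_on V (iterated_partial is F) \<and>
      (\<forall>i<N. \<forall>y\<in>V. (\<lambda>t. iterated_partial is F (y(i := t))) differentiable (at (y i)))"
      by auto
  qed
qed

lemma partial_funpow: "(partial i ^^ n) F = iterated_partial (replicate n i) F"
  by (induction n) (simp_all add: iterated_partial_Cons)

lemma multi_partial_eq_iterated_partial:
  "multi_partial N \<alpha> F = iterated_partial (concat (map (\<lambda>i. replicate (\<alpha> i) i) [0..<N])) F"
proof -
  have "foldr (\<lambda>i. partial i ^^ \<alpha> i) xs F = iterated_partial (concat (map (\<lambda>i. replicate (\<alpha> i) i) xs)) F" for xs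
    by (induction xs) (simp_all add: iterated_partial_append partial_funpow)
  then show ?thesis by (simp add: multi_partial_def)
qed

lemma iterated_partial_cong:
  assumes "openin (Euclidean_space N) V" "\<And>z. z \<in> V \<Longrightarrow> F z = G z"
  shows "set is \<subseteq> {..<N} \<Longrightarrow> y \<in> V \<Longrightarrow> iterated_partial is F y = iterated_partial is G y"
proof (induction "is" arbitrary: y)
  case (Cons i "is")
  show ?case
    unfolding iterated_partial_Cons
    by (rule partial_cong[OF assms(1)]) (use Cons in auto)
qed (use assms in auto)

lemma multi_partial_cong:
  assumes "openin (Euclidean_space N) V" "\<And>z. z \<in> V \<Longrightarrow> F z = G z" "y \<in> V"
  shows "multi_partial N \<alpha> F y = multi_partial N \<alpha> G y"
  unfolding multi_partial_eq_iterated_partial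
  by (rule iterated_partial_cong[OF assms(1,2)]) (use assms in auto)

lemma multi_partial_zero:
  assumes "openin (Euclidean_space N) V" "\<And>z. z \<in> V \<Longrightarrow> F z = 0" "y \<in> V"
  shows "multi_partial N \<alpha> F y = 0"
proof -
  have "partial i (\<lambda>y. 0) = (\<lambda>y. 0 :: 'a)" for i
    by (simp add: partial_def)
  then have "iterated_partial is (\<lambda>y. 0) = (\<lambda>y. 0 :: 'a)" for "is"
    by (induction "is") (simp_all add: iterated_partial_Cons)
  then show ?thesis
    using multi_partial_cong[OF assms(1), of F "\<lambda>y. 0"] assms(2,3)
    by (simp add: multi_partial_eq_iterated_partial)
qed

lemma smooth_on_cong:
  assumes "openin (Euclidean_space N) V" "\<And>z. z \<in> V \<Longrightarrow> F z = G z"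
  shows "smooth_on N V F \<longleftrightarrow> smooth_on N V G"
  using cont_diff_on_cong[OF assms] by (simp add: smooth_on_iff_cont_diff_on)

lemma smooth_on_subset: "smooth_on N V F \<Longrightarrow> W \<subseteq> V \<Longrightarrow> smooth_on N W F"
  unfolding smooth_on_iff_cont_diff_on using cont_diff_on_subset by blast

lemma smooth_on_local:
  assumes "openin (Euclidean_space N) V"
    and "\<And>y. y \<in> V \<Longrightarrow> \<exists>W. openin (Euclidean_space N) W \<and> y \<in> W \<and> smooth_on N W F"
  shows "smooth_on N V F"
  unfolding smooth_on_iff_cont_diff_on
  using cont_diff_on_local[OF assms(1)] assms(2) unfolding smooth_on_iff_cont_diff_on by metis

subsection \<open>The chain rule\<close>

text \<open>On a small cube the partial derivatives are within \<open>e\<close> of their values at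
  \<open>y0\<close>. Moving from \<open>y0\<close> to \<open>y\<close> one coordinate at a time, the
  mean value inequality on each of the \<open>N\<close> segments contributes \<open>e\<close> times
  its length.\<close>

lemma first_order_approximation:
  assumes V: "openin (Euclidean_space N) V" and y0: "y0 \<in> V"
    and F: "cont_diff_on (Suc 0) N V F" and e: "e > 0"
  obtains r where "r > 0" "cube N y0 r \<subseteq> V"
    "\<And>y. y \<in> cube N y0 r \<Longrightarrow>
       norm (F y - F y0 - (\<Sum>i<N. (y i - y0 i) *\<^sub>R partial i F y0)) \<le> e * (\<Sum>i<N. \<bar>y i - y0 i\<bar>)"
proof -
  define W where "W = V \<inter> (\<Inter>i<N. {y \<in> V. partial i F y \<in> ball (partial i F y0) e})"
  have W_D: "partial i F z \<in> ball (partial i F y0) e" if "z \<in> W" "i < N" for z i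
    using that by (auto simp: W_def)
  have "openin (top_of_set V) {y \<in> V. partial i F y \<in> ball (partial i F y0) e}" if "i < N" for i
    using continuous_openin_preimage_gen[of V "partial i F" "ball (partial i F y0) e"] F that
    by (simp add: vimage_def Int_def)
  moreover have "V \<subseteq> {y. \<forall>i\<ge>N. y i = 0}"
    using openin_subset[OF V] by (simp add: topspace_Euclidean_space)
  ultimately have "openin (Euclidean_space N) {y \<in> V. partial i F y \<in> ball (partial i F y0) e}"
    if "i < N" for i
    using V that openin_trans unfolding Euclidean_space_eq_top_of_set by blast
  then have "openin (Euclidean_space N) W"
    unfolding W_def using V by (cases "N = 0") (auto intro!: openin_Int openin_INT)
  moreover have "y0 \<in> W" using y0 e by (auto simp: W_def)
  ultimately obtain r where r: "r > 0" "cube N y0 r \<subseteq> W"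
    using openin_contains_cube by blast
  have y0_0: "y0 i = 0" if "i \<ge> N" for i
    using y0 that \<open>V \<subseteq> _\<close> by auto
  have "norm (F y - F y0 - (\<Sum>i<N. (y i - y0 i) *\<^sub>R partial i F y0)) \<le> e * (\<Sum>i<N. \<bar>y i - y0 i\<bar>)"
    if y: "y \<in> cube N y0 r" for y
  proof -
    \<comment> \<open>Corner \<open>j\<close> of the path: coordinates below \<open>j\<close> are
      already those of \<open>y\<close>, the others still those of \<open>y0\<close>.\<close>
    define p where "p j = (\<lambda>i. if i < j then y i else y0 i)" for j
    have "norm (F (p j) - F y0 - (\<Sum>i<j. (y i - y0 i) *\<^sub>R partial i F y0))
            \<le> e * (\<Sum>i<j. \<bar>y i - y0 i\<bar>)" if "j \<le> N" for j
      using that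
    proof (induction j)
      case 0
      then show ?case by (simp add: p_def)
    next
      case (Suc j)
      let ?D = "partial j F y0"
      have in_W: "(p j)(j := t) \<in> W" if "t \<in> closed_segment (y0 j) (y j)" for t
      proof -
        have "\<bar>t - y0 j\<bar> \<le> \<bar>y j - y0 j\<bar>"
          using that by (auto simp: closed_segment_eq_real_ivl split: if_splits)
        then have "\<bar>t - y0 j\<bar> \<le> r"
          using y Suc.prems unfolding cube_def by (smt (verit) Suc_le_eq mem_Collect_eq)
        then have "(p j)(j := t) \<in> cube N y0 r"
          using y Suc.prems y0_0 r(1) by (auto simp: cube_def p_def)
        then show ?thesis using r(2) by blast
      qed
      have "norm ((F ((p j)(j := y j)) - y j *\<^sub>R ?D) - (F ((p j)(j := y0 j)) - y0 j *\<^sub>R ?D))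
              \<le> e * norm (y j - y0 j)"
      \<comment> \<open>With the linear part subtracted, the derivative is the deviation of the
        partial derivative from its value at \<open>y0\<close>, hence at most \<open>e\<close> in
        norm.\<close>
      proof (rule differentiable_bound[where f = "\<lambda>t. F ((p j)(j := t)) - t *\<^sub>R ?D"
            and S = "closed_segment (y0 j) (y j)" and f' = "\<lambda>t h. h *\<^sub>R (partial j F ((p j)(j := t)) - ?D)"])
        fix t assume t: "t \<in> closed_segment (y0 j) (y j)"
        have *: "norm (partial j F ((p j)(j := t)) - ?D) \<le> e"
        proof -
          have "partial j F ((p j)(j := t)) \<in> ball ?D e"
            using W_D[OF in_W[OF t], of j] Suc.prems by (meson Suc_le_lessD)
          then show ?thesis by (simp add: dist_norm norm_minus_commute)
        qed
        show "onorm (\<lambda>h. h *\<^sub>R (partial j F ((p j)(j := t)) - ?D)) \<le> e"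
          using * by (intro onorm_le) (metis abs_ge_zero mult.commute mult_left_mono norm_scaleR real_norm_def)
        have "(p j)(j := t) \<in> V" using in_W[OF t] W_def by auto
        from has_partial[OF F _ this, of j] Suc.prems
        have "((\<lambda>s. F ((p j)(j := s))) has_vector_derivative partial j F ((p j)(j := t))) (at t)"
          by simp
        then have "((\<lambda>s. F ((p j)(j := s)) - s *\<^sub>R ?D) has_vector_derivative
            partial j F ((p j)(j := t)) - ?D) (at t)"
          by (auto intro!: derivative_eq_intros)
        then show "((\<lambda>s. F ((p j)(j := s)) - s *\<^sub>R ?D) has_derivative
            (\<lambda>h. h *\<^sub>R (partial j F ((p j)(j := t)) - ?D))) (at t within closed_segment (y0 j) (y j))"
          unfolding has_vector_derivative_def by (rule has_derivative_at_withinI)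
      qed auto
      moreover have "(p j)(j := y j) = p (Suc j)" "(p j)(j := y0 j) = p j"
        by (auto simp: p_def)
      ultimately have "norm (F (p (Suc j)) - F (p j) - (y j - y0 j) *\<^sub>R ?D) \<le> e * \<bar>y j - y0 j\<bar>"
        by (simp add: algebra_simps)
      with Suc have "norm ((F (p j) - F y0 - (\<Sum>i<j. (y i - y0 i) *\<^sub>R partial i F y0)) +
          (F (p (Suc j)) - F (p j) - (y j - y0 j) *\<^sub>R ?D)) \<le> e * (\<Sum>i<j. \<bar>y i - y0 i\<bar>) + e * \<bar>y j - y0 j\<bar>"
        by (intro norm_triangle_mono) auto
      then show ?case by (simp add: algebra_simps)
    qed
    from this[of N] have "norm (F (p N) - F y0 - (\<Sum>i<N. (y i - y0 i) *\<^sub>R partial i F y0))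
            \<le> e * (\<Sum>i<N. \<bar>y i - y0 i\<bar>)" by simp
    moreover have "p N = y"
      using y y0_0 by (auto simp: p_def cube_def)
    ultimately show ?thesis by simp
  qed
  note approx = this
  have "cube N y0 r \<subseteq> V" using r W_def by auto
  from that[OF r(1) this approx] show ?thesis by blast
qed

lemma has_vector_derivative_small:
  assumes "\<And>e. e > 0 \<Longrightarrow> \<forall>\<^sub>F t in nhds t0. norm (E t - E t0) \<le> e * \<bar>t - t0\<bar>"
  shows "(E has_vector_derivative 0) (at t0)"
  unfolding has_vector_derivative_def has_derivative_at_alt
  using assms unfolding eventually_nhds_metric by (auto simp: dist_norm)

text \<open>Along the curve, \<open>F\<close> is its value at \<open>t0\<close>, plus the linear
  expression \<open>L\<close> in the increments of the curve, plus a remainder. \<open>L\<close> has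
  the claimed derivative, and the remainder is o(t - t0) because the curve satisfies a Lipschitz
  bound at \<open>t0\<close>.\<close>

lemma has_vector_derivative_along_curve:
  assumes V: "openin (Euclidean_space N) V" and F: "cont_diff_on (Suc 0) N V F"
    and V0: "\<forall>\<^sub>F t in nhds t0. \<gamma> t \<in> V"
    and \<gamma>: "\<And>i. i < N \<Longrightarrow> ((\<lambda>t. \<gamma> t i) has_vector_derivative \<gamma>' i) (at t0)"
  shows "((\<lambda>t. F (\<gamma> t)) has_vector_derivative (\<Sum>i<N. \<gamma>' i *\<^sub>R partial i F (\<gamma> t0))) (at t0)"
proof -
  define L where "L t = (\<Sum>i<N. (\<gamma> t i - \<gamma> t0 i) *\<^sub>R partial i F (\<gamma> t0))" for t
  \<comment> \<open>The sum of the Lipschitz constants of the coordinates. It is 0 for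
    \<open>N = 0\<close>, hence the divisor \<open>B + 1\<close> below.\<close>
  define B where "B = (\<Sum>i<N. \<bar>\<gamma>' i\<bar> + 1)"
  have B: "B \<ge> 0" by (auto simp: B_def intro!: sum_nonneg)
  have in_V: "\<gamma> t0 \<in> V" using V0 by (rule eventually_nhds_x_imp_x)
  have lip: "\<forall>\<^sub>F t in nhds t0. \<bar>\<gamma> t i - \<gamma> t0 i\<bar> \<le> (\<bar>\<gamma>' i\<bar> + 1) * \<bar>t - t0\<bar>" if "i < N" for i
  proof -
    have "\<forall>e>0. \<exists>d>0. \<forall>t. norm (t - t0) < d \<longrightarrow>
        norm (\<gamma> t i - \<gamma> t0 i - (t - t0) *\<^sub>R \<gamma>' i) \<le> e * norm (t - t0)"
      using \<gamma>[OF that] unfolding has_vector_derivative_def has_derivative_at_alt by blast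
    \<comment> \<open>Differentiability with error factor 1 already yields the Lipschitz
      bound.\<close>
    from this[rule_format, of 1] obtain d where d: "d > 0"
      "\<And>t. \<bar>t - t0\<bar> < d \<Longrightarrow> \<bar>\<gamma> t i - \<gamma> t0 i - (t - t0) * \<gamma>' i\<bar> \<le> \<bar>t - t0\<bar>"
      by auto
    have "\<bar>\<gamma> t i - \<gamma> t0 i\<bar> \<le> (\<bar>\<gamma>' i\<bar> + 1) * \<bar>t - t0\<bar>" if "\<bar>t - t0\<bar> < d" for t
    proof -
      have "\<bar>\<gamma> t i - \<gamma> t0 i\<bar> \<le> \<bar>(t - t0) * \<gamma>' i\<bar> + \<bar>t - t0\<bar>"
        using d(2)[OF that] by linarith
      then show ?thesis by (simp add: abs_mult distrib_left mult.commute)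
    qed
    then show ?thesis using d(1) unfolding eventually_nhds_metric by (auto simp: dist_real_def)
  qed
  have small: "\<forall>\<^sub>F t in nhds t0. norm (F (\<gamma> t) - F (\<gamma> t0) - L t) \<le> e * \<bar>t - t0\<bar>" if "e > 0" for e
  proof -
    have e': "e / (B + 1) > 0" using that B by simp
    obtain r where r: "r > 0" "cube N (\<gamma> t0) r \<subseteq> V"
      "\<And>y. y \<in> cube N (\<gamma> t0) r \<Longrightarrow>
         norm (F y - F (\<gamma> t0) - (\<Sum>i<N. (y i - \<gamma> t0 i) *\<^sub>R partial i F (\<gamma> t0)))
           \<le> e / (B + 1) * (\<Sum>i<N. \<bar>y i - \<gamma> t0 i\<bar>)"
      using first_order_approximation[OF V in_V F e'] by blast
    have "\<forall>\<^sub>F t in nhds t0. \<forall>i\<in>{..<N}. \<bar>\<gamma> t i - \<gamma> t0 i\<bar> \<le> (\<bar>\<gamma>' i\<bar> + 1) * \<bar>t - t0\<bar>"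
      using lip by (intro eventually_ball_finite) auto
    \<comment> \<open>So close to \<open>t0\<close> that the Lipschitz bounds keep the curve inside
      the cube of radius \<open>r\<close>.\<close>
    moreover have "\<forall>\<^sub>F t in nhds t0. \<forall>i\<in>{..<N}. \<bar>t - t0\<bar> \<le> r / (\<bar>\<gamma>' i\<bar> + 1)"
    proof (intro eventually_ball_finite ballI)
      fix i
      have "r / (\<bar>\<gamma>' i\<bar> + 1) > 0" using r(1) by (simp add: add_nonneg_pos)
      then show "\<forall>\<^sub>F t in nhds t0. \<bar>t - t0\<bar> \<le> r / (\<bar>\<gamma>' i\<bar> + 1)"
        unfolding eventually_nhds_metric by (auto simp: dist_real_def intro: less_imp_le)
    qed auto
    ultimately show ?thesis using V0
    proof eventually_elim
      case (elim t)
      have "\<bar>\<gamma> t i - \<gamma> t0 i\<bar> \<le> r" if "i < N" for i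
      proof -
        have "\<bar>\<gamma> t i - \<gamma> t0 i\<bar> \<le> (\<bar>\<gamma>' i\<bar> + 1) * \<bar>t - t0\<bar>" using elim that by auto
        also have "\<dots> \<le> (\<bar>\<gamma>' i\<bar> + 1) * (r / (\<bar>\<gamma>' i\<bar> + 1))"
          using elim that by (intro mult_left_mono) auto
        also have "\<dots> = r" by (simp add: add_nonneg_eq_0_iff)
        finally show ?thesis .
      qed
      then have "\<gamma> t \<in> cube N (\<gamma> t0) r"
        using elim(3) openin_subset[OF V] by (auto simp: cube_def topspace_Euclidean_space)
      then have "norm (F (\<gamma> t) - F (\<gamma> t0) - L t) \<le> e / (B + 1) * (\<Sum>i<N. \<bar>\<gamma> t i - \<gamma> t0 i\<bar>)"
        unfolding L_def by (rule r(3))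
      also have "(\<Sum>i<N. \<bar>\<gamma> t i - \<gamma> t0 i\<bar>) \<le> (\<Sum>i<N. (\<bar>\<gamma>' i\<bar> + 1) * \<bar>t - t0\<bar>)"
        using elim by (intro sum_mono) auto
      also have "\<dots> = B * \<bar>t - t0\<bar>" by (simp add: B_def sum_distrib_right)
      also have "e / (B + 1) * (B * \<bar>t - t0\<bar>) \<le> e * \<bar>t - t0\<bar>"
      proof -
        have "e / (B + 1) * B \<le> e" using B that by (simp add: field_simps)
        then show ?thesis by (metis abs_ge_zero mult.assoc mult_right_mono)
      qed
      finally show ?case using that B by (simp add: mult_left_mono divide_right_mono)
    qed
  qed
  have "((\<lambda>t. F (\<gamma> t) - F (\<gamma> t0) - L t) has_vector_derivative 0) (at t0)"
    by (rule has_vector_derivative_small) (use small in \<open>simp add: L_def\<close>)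
  moreover have "(L has_vector_derivative (\<Sum>i<N. \<gamma>' i *\<^sub>R partial i F (\<gamma> t0))) (at t0)"
  proof -
    have "((\<lambda>t. (\<gamma> t i - \<gamma> t0 i) *\<^sub>R partial i F (\<gamma> t0)) has_vector_derivative
        \<gamma>' i *\<^sub>R partial i F (\<gamma> t0)) (at t0)" if "i < N" for i
    proof -
      have "((\<lambda>t. \<gamma> t i - \<gamma> t0 i) has_vector_derivative \<gamma>' i - 0) (at t0)"
        by (intro has_vector_derivative_diff \<gamma> that has_vector_derivative_const)
      from bounded_linear.has_vector_derivative[OF bounded_linear_scaleR_left this]
      show ?thesis by simp
    qed
    then show ?thesis unfolding L_def by (intro has_vector_derivative_sum) auto
  qed
  ultimately have "((\<lambda>t. (F (\<gamma> t) - F (\<gamma> t0) - L t) + L t) has_vector_derivative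
      0 + (\<Sum>i<N. \<gamma>' i *\<^sub>R partial i F (\<gamma> t0))) (at t0)"
    by (rule has_vector_derivative_add)
  from has_vector_derivative_add[OF this has_vector_derivative_const[of "F (\<gamma> t0)"]]
  show ?thesis by simp
qed

lemma continuous_on_Euclidean_componentwise:
  assumes "\<And>i. i < N \<Longrightarrow> continuous_on V (\<lambda>y. \<Phi> y i)" "\<And>y i. y \<in> V \<Longrightarrow> i \<ge> N \<Longrightarrow> \<Phi> y i = 0"
  shows "continuous_on V (\<Phi> :: _ \<Rightarrow> nat \<Rightarrow> real)"
proof (rule continuous_on_coordinatewise_then_product)
  fix i
  show "continuous_on V (\<lambda>y. \<Phi> y i)"
  proof (cases "i < N")
    case False
    then show ?thesis using assms(2) by (intro continuous_on_eq[OF continuous_on_const[of V 0]]) auto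
  qed (use assms in auto)
qed

text \<open>The chain rule expresses the partial derivatives of the composite through composites of
  the functions \<open>partial i F\<close> with \<Phi>, so the induction on \<open>k\<close> has to
  treat all \<open>F\<close> simultaneously.\<close>

lemma cont_diff_on_compose:
  assumes V: "openin (Euclidean_space N) V" and V': "openin (Euclidean_space N') V'"
    and in_V': "\<And>y. y \<in> V \<Longrightarrow> \<Phi> y \<in> V'"
  shows "(\<And>i. i < N' \<Longrightarrow> cont_diff_on k N V (\<lambda>y. \<Phi> y i)) \<Longrightarrow> cont_diff_on k N' V' F \<Longrightarrow>
    cont_diff_on k N V (\<lambda>y. F (\<Phi> y))"
proof (induction k arbitrary: F)
  have cont: "continuous_on V (\<lambda>y. F (\<Phi> y))"
    if "\<And>i. i < N' \<Longrightarrow> continuous_on V (\<lambda>y. \<Phi> y i)" "continuous_on V' F" for F :: "_ \<Rightarrow> 'a"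
  proof (rule continuous_on_compose2[OF that(2)])
    show "continuous_on V \<Phi>"
      by (rule continuous_on_Euclidean_componentwise[of N'])
        (use that in_V' openin_subset[OF V'] in \<open>auto simp: topspace_Euclidean_space\<close>)
  qed (use in_V' in auto)
  case 0
  then show ?case using cont by auto
next
  case (Suc k)
  show ?case
  proof (rule cont_diff_on_SucI[OF V, where D = "\<lambda>j y. \<Sum>i<N'. partial j (\<lambda>y. \<Phi> y i) y *\<^sub>R partial i F (\<Phi> y)"])
    have IH: "cont_diff_on k N V (\<lambda>y. G (\<Phi> y))" if "cont_diff_on k N' V' G" for G :: "_ \<Rightarrow> 'a"
      using Suc.IH[OF _ that] Suc.prems(1) cont_diff_on_SucD by blast
    show "continuous_on V (\<lambda>y. F (\<Phi> y))"
      using IH[of F] Suc.prems(2) cont_diff_on_SucD cont_diff_on_imp_continuous by blast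
    fix j assume j: "j < N"
    show "((\<lambda>t. F (\<Phi> (y(j := t)))) has_vector_derivative
        (\<Sum>i<N'. partial j (\<lambda>y. \<Phi> y i) y *\<^sub>R partial i F (\<Phi> y))) (at (y j))" if y: "y \<in> V" for y
    proof -
      have "cont_diff_on (Suc 0) N' V' F"
        using Suc.prems(2) by (rule cont_diff_on_le) simp
      moreover have "\<forall>\<^sub>F t in nhds (y j). \<Phi> (y(j := t)) \<in> V'"
        using eventually_line_in[OF V y j] by eventually_elim (rule in_V')
      ultimately show ?thesis
        using has_vector_derivative_along_curve[OF V', where F = F and ?t0.0 = "y j" and
            \<gamma> = "\<lambda>t. \<Phi> (y(j := t))" and \<gamma>' = "\<lambda>i. partial j (\<lambda>y. \<Phi> y i) y"] has_partial[OF Suc.prems(1) j y]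
        by simp
    qed
    show "cont_diff_on k N V (\<lambda>y. \<Sum>i<N'. partial j (\<lambda>y. \<Phi> y i) y *\<^sub>R partial i F (\<Phi> y))"
      by (intro cont_diff_on_sum[OF V] cont_diff_on_scaleR[OF V] IH) (use Suc.prems j in auto)
  qed
qed

lemma smooth_on_compose:
  assumes "openin (Euclidean_space N) V" "openin (Euclidean_space N') V'"
    and "\<And>y. y \<in> V \<Longrightarrow> \<Phi> y \<in> V'"
    and "\<And>i. i < N' \<Longrightarrow> smooth_on N V (\<lambda>y. \<Phi> y i)" "smooth_on N' V' F"
  shows "smooth_on N V (\<lambda>y. F (\<Phi> y))"
  using assms(4,5) cont_diff_on_compose[OF assms(1-2), where \<Phi> = \<Phi> and F = F] assms(3)
  unfolding smooth_on_iff_cont_diff_on by blast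

subsection \<open>Termwise differentiation of series\<close>

text \<open>The hypothesis of the Weierstrass M-test near every point, with a majorant that may
  change from point to point.\<close>

definition locally_summable_on ::
  "nat \<Rightarrow> (nat \<Rightarrow> real) set \<Rightarrow> (nat \<Rightarrow> (nat \<Rightarrow> real) \<Rightarrow> 'k::real_normed_vector) \<Rightarrow> bool" where
  "locally_summable_on N V G \<longleftrightarrow> (\<forall>y\<in>V. \<exists>W B. openin (Euclidean_space N) W \<and> y \<in> W \<and>
     summable B \<and> (\<forall>m. \<forall>z\<in>W. norm (G m z) \<le> B m))"

lemma locally_summable_on_summable:
  fixes G :: "nat \<Rightarrow> (nat \<Rightarrow> real) \<Rightarrow> 'k::banach"
  assumes "locally_summable_on N V G" "y \<in> V"
  shows "summable (\<lambda>m. G m y)"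
  using assms unfolding locally_summable_on_def by (meson summable_comparison_test')

text \<open>On a coordinate line this is termwise differentiation of a series of functions of one
  real variable: the derivatives must converge uniformly on a small interval, and the series itself
  at one point of it.\<close>

lemma has_partial_suminf:
  fixes G :: "nat \<Rightarrow> (nat \<Rightarrow> real) \<Rightarrow> 'k::banach"
  assumes V: "openin (Euclidean_space N) V" and i: "i < N" and y: "y \<in> V"
    and G: "\<And>m. cont_diff_on (Suc 0) N V (G m)"
    and "locally_summable_on N V G" "locally_summable_on N V (\<lambda>m. partial i (G m))"
  shows "((\<lambda>t. suminf (\<lambda>m. G m (y(i := t)))) has_vector_derivative (suminf (\<lambda>m. partial i (G m) y))) (at (y i))"
proof -
  obtain W B where W: "openin (Euclidean_space N) W" "y \<in> W" "summable B"
    "\<And>m z. z \<in> W \<Longrightarrow> norm (partial i (G m) z) \<le> B m"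
    using assms(6) y unfolding locally_summable_on_def by metis
  have "\<forall>\<^sub>F t in nhds (y i). y(i := t) \<in> V \<inter> W"
    using V W y i by (intro eventually_line_in[of N]) auto
  then obtain d where d: "d > 0" "\<And>t. dist t (y i) < d \<Longrightarrow> y(i := t) \<in> V \<inter> W"
    unfolding eventually_nhds_metric by blast
  let ?S = "ball (y i) d"
  have in_VW: "y(i := t) \<in> V \<inter> W" if "t \<in> ?S" for t
    using d(2)[of t] that by (simp add: dist_commute)
  let ?g' = "\<lambda>t. suminf (\<lambda>m. partial i (G m) (y(i := t)))"
  have unif: "uniform_limit ?S (\<lambda>n t. \<Sum>m<n. partial i (G m) (y(i := t))) ?g' sequentially"
    using W(3,4) in_VW by (intro Weierstrass_m_test) auto
  have "\<exists>g. \<forall>t\<in>?S. (\<lambda>m. G m (y(i := t))) sums g t \<and>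
      (g has_derivative (\<lambda>h. h *\<^sub>R ?g' t)) (at t within ?S)"
  proof (rule has_derivative_series[where f' = "\<lambda>m t h. h *\<^sub>R partial i (G m) (y(i := t))" and x = "y i"])
    fix m t assume t: "t \<in> ?S"
    have "((\<lambda>s. G m (y(i := s))) has_vector_derivative partial i (G m) (y(i := t))) (at t)"
      using has_partial[OF G i, of "y(i := t)" m] in_VW[OF t] by simp
    then show "((\<lambda>s. G m (y(i := s))) has_derivative (\<lambda>h. h *\<^sub>R partial i (G m) (y(i := t)))) (at t within ?S)"
      unfolding has_vector_derivative_def by (rule has_derivative_at_withinI)
  next
    fix e :: real assume "e > 0"
    then have "\<forall>\<^sub>F n in sequentially. \<forall>t\<in>?S. dist (\<Sum>m<n. partial i (G m) (y(i := t))) (?g' t) < e"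
      using unif unfolding uniform_limit_iff by blast
    then show "\<forall>\<^sub>F n in sequentially. \<forall>t\<in>?S. \<forall>h.
        norm ((\<Sum>m<n. h *\<^sub>R partial i (G m) (y(i := t))) - h *\<^sub>R ?g' t) \<le> e * norm h"
    proof eventually_elim
      case (elim n)
      show ?case
      proof (intro ballI allI)
        fix t h assume "t \<in> ?S"
        then have "norm ((\<Sum>m<n. partial i (G m) (y(i := t))) - ?g' t) \<le> e"
          using elim by (auto simp: dist_norm intro: less_imp_le)
        then have "\<bar>h\<bar> * norm ((\<Sum>m<n. partial i (G m) (y(i := t))) - ?g' t) \<le> \<bar>h\<bar> * e"
          by (rule mult_left_mono) simp
        then show "norm ((\<Sum>m<n. h *\<^sub>R partial i (G m) (y(i := t))) - h *\<^sub>R ?g' t) \<le> e * norm h"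
          by (simp add: scaleR_sum_right[symmetric] scaleR_diff_right[symmetric] mult.commute)
      qed
    qed
  next
    show "(\<lambda>m. G m (y(i := y i))) sums (suminf (\<lambda>m. G m y))"
      using locally_summable_on_summable[OF assms(5) y] by (simp add: summable_sums)
  qed (use d in auto)
  then obtain g where g: "\<And>t. t \<in> ?S \<Longrightarrow> (\<lambda>m. G m (y(i := t))) sums g t"
    "\<And>t. t \<in> ?S \<Longrightarrow> (g has_derivative (\<lambda>h. h *\<^sub>R ?g' t)) (at t within ?S)"
    by blast
  have "(g has_vector_derivative ?g' (y i)) (at (y i))"
    using g(2)[of "y i"] d(1) by (simp add: has_vector_derivative_def at_within_open[OF _ open_ball])
  then have "((\<lambda>t. suminf (\<lambda>m. G m (y(i := t)))) has_vector_derivative ?g' (y i)) (at (y i))"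
    by (rule has_vector_derivative_transform_within_open[where S = ?S])
      (use d g(1) sums_unique in auto)
  then show ?thesis by simp
qed

text \<open>The hypothesis reproduces itself for the series of derivatives: the word
  \<open>is\<close> applied to \<open>partial i (F m)\<close> is the word \<open>is @ [i]\<close>
  applied to \<open>F m\<close>. Hence it is required for all words and the induction is over all
  \<open>F\<close>.\<close>

lemma cont_diff_on_suminf:
  fixes F :: "nat \<Rightarrow> (nat \<Rightarrow> real) \<Rightarrow> 'k::banach"
  assumes V: "openin (Euclidean_space N) V"
  shows "(\<And>m. smooth_on N V (F m)) \<Longrightarrow>
    (\<And>is. set is \<subseteq> {..<N} \<Longrightarrow> locally_summable_on N V (\<lambda>m. iterated_partial is (F m))) \<Longrightarrow>
    cont_diff_on k N V (\<lambda>y. suminf (\<lambda>m. F m y))"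
proof (induction k arbitrary: F)
  have cont: "continuous_on V (\<lambda>y. suminf (\<lambda>m. F m y))"
    if "\<And>m. smooth_on N V (F m)" "locally_summable_on N V F" for F :: "nat \<Rightarrow> _ \<Rightarrow> 'k"
  proof -
    have "cont_diff_on 0 N V (\<lambda>y. suminf (\<lambda>m. F m y))"
    proof (rule cont_diff_on_local[OF V])
      fix y assume y: "y \<in> V"
      note summ = \<open>locally_summable_on N V F\<close>
      obtain W B where W: "openin (Euclidean_space N) W" "y \<in> W" "summable B"
        "\<And>m z. z \<in> W \<Longrightarrow> norm (F m z) \<le> B m"
        using summ y unfolding locally_summable_on_def by metis
      have "uniform_limit (V \<inter> W) (\<lambda>n z. \<Sum>m<n. F m z) (\<lambda>z. suminf (\<lambda>m. F m z)) sequentially"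
        using W(3,4) by (intro Weierstrass_m_test) auto
      moreover have "continuous_on (V \<inter> W) (F m)" for m
        using that(1)[of m] unfolding smooth_on_iff_cont_diff_on
        by (meson cont_diff_on_imp_continuous continuous_on_subset inf_le1)
      ultimately have "continuous_on (V \<inter> W) (\<lambda>z. suminf (\<lambda>m. F m z))"
        by (intro uniform_limit_theorem[OF always_eventually]) (auto intro!: continuous_intros)
      then show "\<exists>W. openin (Euclidean_space N) W \<and> y \<in> W \<and> cont_diff_on 0 N W (\<lambda>y. suminf (\<lambda>m. F m y))"
        using V W y by (intro exI[of _ "V \<inter> W"]) auto
    qed
    then show ?thesis by simp
  qed
  {
    case 0
    show ?case using cont[OF 0(1) 0(2)[of "[]", simplified]] by simp
  next
    case (Suc k)
    show ?case
    proof (rule cont_diff_on_SucI[OF V, where D = "\<lambda>i y. suminf (\<lambda>m. partial i (F m) y)"])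
      show "continuous_on V (\<lambda>y. suminf (\<lambda>m. F m y))"
        using cont[OF Suc.prems(1) Suc.prems(2)[of "[]", simplified]] .
      fix i assume i: "i < N"
      show "((\<lambda>t. suminf (\<lambda>m. F m (y(i := t)))) has_vector_derivative (suminf (\<lambda>m. partial i (F m) y))) (at (y i))"
        if "y \<in> V" for y
        using Suc.prems(1) Suc.prems(2)[of "[]"] Suc.prems(2)[of "[i]"] i
        by (intro has_partial_suminf[OF V i that]) (auto simp: smooth_on_iff_cont_diff_on iterated_partial_Cons
            simp del: cont_diff_on.simps)
      show "cont_diff_on k N V (\<lambda>y. suminf (\<lambda>m. partial i (F m) y))"
      proof (rule Suc.IH)
        show "smooth_on N V (partial i (F m))" for m
          using smooth_on_partial[OF Suc.prems(1) i] .
        show "locally_summable_on N V (\<lambda>m. iterated_partial is (partial i (F m)))"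
          if "set is \<subseteq> {..<N}" for "is"
          using Suc.prems(2)[of "is @ [i]"] that i by (simp add: iterated_partial_append iterated_partial_Cons)
      qed
    qed
  }
qed

lemma smooth_on_suminf:
  fixes F :: "nat \<Rightarrow> (nat \<Rightarrow> real) \<Rightarrow> 'k::banach"
  assumes "openin (Euclidean_space N) V" "\<And>m. smooth_on N V (F m)"
    and "\<And>is. set is \<subseteq> {..<N} \<Longrightarrow> locally_summable_on N V (\<lambda>m. iterated_partial is (F m))"
  shows "smooth_on N V (\<lambda>y. suminf (\<lambda>m. F m y))"
  using cont_diff_on_suminf assms unfolding smooth_on_iff_cont_diff_on by blast

text \<open>Smoothness of the sum is not all that matters: the sum is later inserted into
  bidifferential operators, which see the values of its derivatives.\<close>

lemma iterated_partial_suminf: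
  fixes F :: "nat \<Rightarrow> (nat \<Rightarrow> real) \<Rightarrow> 'k::banach"
  assumes V: "openin (Euclidean_space N) V" and F: "\<And>m. smooth_on N V (F m)"
    and S: "\<And>is. set is \<subseteq> {..<N} \<Longrightarrow> locally_summable_on N V (\<lambda>m. iterated_partial is (F m))"
  shows "set is \<subseteq> {..<N} \<Longrightarrow> y \<in> V \<Longrightarrow>
    (\<lambda>m. iterated_partial is (F m) y) sums iterated_partial is (\<lambda>y. suminf (\<lambda>m. F m y)) y"
proof (induction "is" arbitrary: y)
  case Nil
  then show ?case using locally_summable_on_summable[OF S[of "[]"]] by (simp add: summable_sums)
next
  case (Cons i "is")
  have "partial i (iterated_partial is (\<lambda>y. suminf (\<lambda>m. F m y))) y =
      partial i (\<lambda>y. suminf (\<lambda>m. iterated_partial is (F m) y)) y"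
    by (rule partial_cong[OF V]) (use Cons sums_unique in auto)
  also have "\<dots> = (suminf (\<lambda>m. partial i (iterated_partial is (F m)) y))"
  proof (rule partial_eqI, rule has_partial_suminf[OF V])
    have "cont_diff_on (Suc 0 + length is) N V (F m)" for m
      using F unfolding smooth_on_iff_cont_diff_on by blast
    then show "cont_diff_on (Suc 0) N V (iterated_partial is (F m))" for m
      by (rule cont_diff_on_iterated_partial) (use Cons in auto)
    show "locally_summable_on N V (\<lambda>m. partial i (iterated_partial is (F m)))"
      using S[OF Cons.prems(1)] by (simp add: iterated_partial_Cons)
  qed (use Cons S[of "is"] in auto)
  finally show ?case
    using locally_summable_on_summable[OF S[OF Cons.prems(1)] Cons.prems(2)]
    by (simp add: iterated_partial_Cons summable_sums)
qed

subsection \<open>Cut-off functions\<close>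

text \<open>The polynomial is there because the family p(1/t) exp(-1/t), unlike exp(-1/t) alone, is
  closed under differentiation.\<close>

definition flat :: "real poly \<Rightarrow> real \<Rightarrow> real" where
  "flat p t = (if t > 0 then poly p (inverse t) * exp (- inverse t) else 0)"

lemma poly_exp_tendsto_0: "((\<lambda>u. poly p u * exp (- u)) \<longlongrightarrow> (0::real)) at_top"
proof -
  have "((\<lambda>u. \<Sum>i\<le>Polynomial.degree p. Polynomial.coeff p i * (u ^ i / exp u)) \<longlongrightarrow> (\<Sum>i\<le>Polynomial.degree p. Polynomial.coeff p i * 0)) at_top"
    by (intro tendsto_intros tendsto_power_div_exp_0)
  then show ?thesis
    by (simp add: poly_altdef exp_minus sum_distrib_right divide_inverse mult.assoc)
qed

text \<open>With u = 1/t one has du/dt = -u^2, so the derivative of p(u) exp(-u) is u^2 (p - p')(u)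
  exp(-u); the factor \<open>[:0, 0, 1:]\<close> is u^2. At 0 the difference quotient is examined
  from both sides.\<close>

lemma flat_has_derivative:
  "(flat p has_real_derivative flat ([:0, 0, 1:] * (p - pderiv p)) t) (at t)"
proof -
  consider "t > 0" | "t < 0" | "t = 0" by linarith
  then show ?thesis
  proof cases
    case 1
    have "((\<lambda>t. poly p (inverse t) * exp (- inverse t)) has_real_derivative
        flat ([:0, 0, 1:] * (p - pderiv p)) t) (at t)"
      using 1 by (auto intro!: derivative_eq_intros simp: flat_def field_simps power2_eq_square)
    then show ?thesis
      by (rule has_field_derivative_transform_within_open[where S = "{0<..}"]) (use 1 in \<open>auto simp: flat_def\<close>)
  next
    case 2
    have "((\<lambda>t. 0) has_real_derivative flat ([:0, 0, 1:] * (p - pderiv p)) t) (at t)"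
      using 2 by (auto simp: flat_def)
    then show ?thesis
      by (rule has_field_derivative_transform_within_open[where S = "{..<0}"]) (use 2 in \<open>auto simp: flat_def\<close>)
  next
    case 3
    \<comment> \<open>The quotient p(1/h) exp(-1/h) / h is the same kind of expression for the
      polynomial u p(u), with \<open>[:0, 1:]\<close> for u.\<close>
    have "((\<lambda>h. poly ([:0, 1:] * p) (inverse h) * exp (- inverse h)) \<longlongrightarrow> 0) (at_right 0)"
      by (rule filterlim_compose[OF poly_exp_tendsto_0 filterlim_inverse_at_top_right])
    then have "((\<lambda>h. flat p h / h) \<longlongrightarrow> 0) (at_right 0)"
      by (rule Lim_transform_eventually)
        (auto simp: eventually_at_filter flat_def field_simps intro!: always_eventually)
    moreover have "((\<lambda>h. flat p h / h) \<longlongrightarrow> 0) (at_left 0)"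
      by (rule Lim_transform_eventually[OF tendsto_const[of 0]])
        (auto simp: eventually_at_filter flat_def intro!: always_eventually)
    ultimately have "((\<lambda>h. flat p h / h) \<longlongrightarrow> 0) (at 0)"
      by (simp add: filterlim_at_split)
    then show ?thesis
      using 3 by (simp add: DERIV_def flat_def)
  qed
qed

lemma cont_diff_on_flat:
  assumes V: "openin (Euclidean_space N) V"
  shows "cont_diff_on k N V u \<Longrightarrow> cont_diff_on k N V (\<lambda>y. flat p (u y))"
proof (induction k arbitrary: p)
  have cont: "continuous_on V (\<lambda>y. flat p (u y))" if "continuous_on V u" for p
  proof (rule continuous_on_compose2[OF _ that subset_UNIV])
    show "continuous_on UNIV (flat p)"
      using DERIV_isCont[OF flat_has_derivative] by (simp add: continuous_on_eq_continuous_at)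
  qed
  {
    case 0
    then show ?case using cont by auto
  next
    case (Suc k)
    let ?q = "[:0, 0, 1:] * (p - pderiv p)"
    show ?case
    proof (rule cont_diff_on_SucI[OF V, where D = "\<lambda>i y. partial i u y * flat ?q (u y)"])
      show "continuous_on V (\<lambda>y. flat p (u y))"
        using cont cont_diff_on_imp_continuous[OF Suc.prems] .
      fix i assume i: "i < N"
      show "((\<lambda>t. flat p (u (y(i := t)))) has_vector_derivative partial i u y * flat ?q (u y)) (at (y i))"
        if "y \<in> V" for y
      proof -
        have "(flat p has_real_derivative flat ?q (u (y(i := y i)))) (at (u (y(i := y i))))"
          by (rule flat_has_derivative)
        from field_vector_diff_chain_at[OF has_partial[OF Suc.prems i that] this]
        show ?thesis unfolding comp_def fun_upd_triv .
      qed
      show "cont_diff_on k N V (\<lambda>y. partial i u y * flat ?q (u y))"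
        by (intro cont_diff_on_mult[OF V] Suc.IH) (use Suc.prems cont_diff_on_SucD i in auto)
    qed
  }
qed

definition smooth_step :: "real \<Rightarrow> real" where
  "smooth_step t = flat 1 t * inverse (flat 1 t + flat 1 (1 - t))"

lemma flat_1_nonneg: "flat 1 t \<ge> 0" and flat_1_pos: "t > 0 \<Longrightarrow> flat 1 t > 0"
  by (simp_all add: flat_def)

text \<open>\<open>t\<close> and \<open>1 - t\<close> are never both nonpositive.\<close>

lemma smooth_step_denominator: "flat 1 t + flat 1 (1 - t) > 0"
  using flat_1_nonneg[of t] flat_1_nonneg[of "1 - t"] flat_1_pos[of t] flat_1_pos[of "1 - t"]
  by (cases "t > 0") auto

lemma smooth_step_eq_0: "t \<le> 0 \<Longrightarrow> smooth_step t = 0"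
  and smooth_step_eq_1: "t \<ge> 1 \<Longrightarrow> smooth_step t = 1"
  and smooth_step_nonneg: "smooth_step t \<ge> 0"
  using smooth_step_denominator[of t] flat_1_nonneg[of t] flat_1_pos[of t]
  by (auto simp: smooth_step_def flat_def)

text \<open>For u = (y i - a i) / r, both 2 + u and 2 - u are at least 1 exactly when |u| \<le> 1,
  and one of them is at most 0 exactly when |u| \<ge> 2. Hence the plateau of radius
  \<open>r\<close> and the support of radius \<open>2 * r\<close>.\<close>

definition cutoff :: "nat \<Rightarrow> (nat \<Rightarrow> real) \<Rightarrow> real \<Rightarrow> (nat \<Rightarrow> real) \<Rightarrow> real" where
  "cutoff N a r y = (\<Prod>i<N. smooth_step (2 + (y i - a i) / r) * smooth_step (2 - (y i - a i) / r))"

lemma smooth_on_cutoff: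
  assumes V: "openin (Euclidean_space N) V"
  shows "smooth_on N V (cutoff N a r)"
  unfolding smooth_on_iff_cont_diff_on
proof
  fix k
  have step: "cont_diff_on k N V (\<lambda>y. smooth_step (u y))" if "cont_diff_on k N V u" for u
  proof -
    have "cont_diff_on k N V (\<lambda>y. 1 + (-1) * u y)"
      by (intro cont_diff_on_add cont_diff_on_mult cont_diff_on_const V that)
    then have "cont_diff_on k N V (\<lambda>y. 1 - u y)" by simp
    then show ?thesis
      unfolding smooth_step_def using smooth_step_denominator
      by (intro cont_diff_on_mult cont_diff_on_inverse cont_diff_on_add cont_diff_on_flat V that)
        (metis less_irrefl)
  qed
  have "cont_diff_on k N V (\<lambda>y. 2 + (y i + - a i) * inverse r)"
    "cont_diff_on k N V (\<lambda>y. 2 + (y i + - a i) * (- inverse r))" for i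
    by (intro cont_diff_on_add cont_diff_on_mult cont_diff_on_const cont_diff_on_coordinate V)+
  then have "cont_diff_on k N V (\<lambda>y. 2 + (y i - a i) / r)" "cont_diff_on k N V (\<lambda>y. 2 - (y i - a i) / r)" for i
    by (simp_all add: field_simps)
  then show "cont_diff_on k N V (cutoff N a r)"
    unfolding cutoff_def[abs_def] by (intro cont_diff_on_prod cont_diff_on_mult step V)
qed

lemma cutoff_nonneg: "cutoff N a r y \<ge> 0"
  unfolding cutoff_def by (intro prod_nonneg mult_nonneg_nonneg ballI smooth_step_nonneg)

lemma cutoff_eq_1:
  assumes "r > 0" "\<And>i. i < N \<Longrightarrow> \<bar>y i - a i\<bar> \<le> r"
  shows "cutoff N a r y = 1"
  unfolding cutoff_def
proof (intro prod.neutral ballI)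
  fix i assume "i \<in> {..<N}"
  then have "\<bar>y i - a i\<bar> \<le> r" using assms(2) by simp
  then have "2 + (y i - a i) / r \<ge> 1" "2 - (y i - a i) / r \<ge> 1"
    using assms(1) by (auto simp: field_simps abs_le_iff)
  then show "smooth_step (2 + (y i - a i) / r) * smooth_step (2 - (y i - a i) / r) = 1"
    by (simp add: smooth_step_eq_1)
qed

lemma cutoff_eq_0:
  assumes "r > 0" "i < N" "\<bar>y i - a i\<bar> \<ge> 2 * r"
  shows "cutoff N a r y = 0"
proof -
  have "2 + (y i - a i) / r \<le> 0 \<or> 2 - (y i - a i) / r \<le> 0"
    using assms(1,3) by (auto simp: field_simps abs_real_def split: if_splits)
  then have "smooth_step (2 + (y i - a i) / r) * smooth_step (2 - (y i - a i) / r) = 0"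
    by (auto simp: smooth_step_eq_0)
  then show ?thesis
    unfolding cutoff_def using assms(2) by (intro prod_zero) auto
qed

section \<open>Smooth functions on manifolds\<close>

lemma smooth_on_mult:
  fixes F :: "(nat \<Rightarrow> real) \<Rightarrow> 'k::real_normed_algebra"
  assumes "openin (Euclidean_space N) V" "smooth_on N V F" "smooth_on N V G"
  shows "smooth_on N V (\<lambda>y. F y * G y)"
  using assms(2,3) cont_diff_on_mult[OF assms(1)] unfolding smooth_on_iff_cont_diff_on by blast

section \<open>Charts as homeomorphisms\<close>

lemma topological_chart_openin_image:
  assumes "topological_chart T N c" "openin T W" "W \<subseteq> fst c"
  shows "openin (Euclidean_space N) (snd c ` W)"
proof -
  have "openin (subtopology T (fst c)) W"
    using assms by (simp add: topological_chart_def openin_open_subtopology)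
  then have "openin (subtopology (Euclidean_space N) (snd c ` fst c)) (snd c ` W)"
    using assms homeomorphic_imp_open_map unfolding topological_chart_def open_map_def by blast
  then show ?thesis
    using assms by (simp add: topological_chart_def openin_open_subtopology)
qed

lemma topological_chart_openin_preimage:
  assumes "topological_chart T N c" "openin (Euclidean_space N) V"
  shows "openin T {x \<in> fst c. snd c x \<in> V}"
proof -
  have c: "openin T (fst c)" "openin (Euclidean_space N) (snd c ` fst c)"
    "continuous_map (subtopology T (fst c)) (subtopology (Euclidean_space N) (snd c ` fst c)) (snd c)"
    using assms(1) homeomorphic_imp_continuous_map unfolding topological_chart_def by auto
  have "continuous_map (subtopology T (fst c)) (Euclidean_space N) (snd c)"
    using c(3) continuous_map_in_subtopology by blast
  from openin_continuous_map_preimage[OF this assms(2)]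
  have "openin (subtopology T (fst c)) {x \<in> fst c. snd c x \<in> V}"
    using openin_subset[OF c(1)] by (simp add: Int_absorb1)
  then show ?thesis using c(1) by (simp add: openin_open_subtopology)
qed

lemma topological_chart_inj_on: "topological_chart T N c \<Longrightarrow> inj_on (snd c) (fst c)"
  unfolding topological_chart_def using openin_subset
  by (metis homeomorphic_imp_injective_map topspace_subtopology_subset)

lemma topological_chart_compactin:
  assumes c: "topological_chart T N c" and K: "compact K" "K \<subseteq> snd c ` fst c"
  shows "compactin T (inv_into (fst c) (snd c) ` K)"
proof -
  have sub: "fst c \<subseteq> topspace T" "snd c ` fst c \<subseteq> topspace (Euclidean_space N)"
    using c openin_subset unfolding topological_chart_def by blast+
  let ?L = "inv_into (fst c) (snd c) ` K"
  have L: "?L \<subseteq> fst c" "snd c ` ?L = K"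
    using K(2) by (auto simp: inv_into_into image_iff f_inv_into_f subset_iff)
  have "compactin (Euclidean_space N) K"
    using K sub unfolding Euclidean_space_eq_top_of_set
    by (auto simp: compactin_subtopology topspace_Euclidean_space)
  then have "compactin (subtopology (Euclidean_space N) (snd c ` fst c)) (snd c ` ?L)"
    using K(2) L(2) by (simp add: compactin_subtopology)
  then have "compactin (subtopology T (fst c)) ?L"
    using c L(1) sub(1) homeomorphic_map_compactness[of "subtopology T (fst c)" _ "snd c" ?L]
    unfolding topological_chart_def by (simp add: topspace_subtopology_subset)
  then show ?thesis by (simp add: compactin_subtopology)
qed

lemma topological_chart_restrict:
  assumes c: "topological_chart T N c" and U: "openin T U"
  shows "topological_chart T N (fst c \<inter> U, snd c)"
proof -
  have sub: "fst c \<subseteq> topspace T" "snd c ` fst c \<subseteq> topspace (Euclidean_space N)" and o: "openin T (fst c \<inter> U)"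
    using c U openin_subset unfolding topological_chart_def by blast+
  have "homeomorphic_map (subtopology (subtopology T (fst c)) U)
     (subtopology (subtopology (Euclidean_space N) (snd c ` fst c)) (snd c ` (fst c \<inter> U))) (snd c)"
  proof (rule homeomorphic_map_subtopologies)
    show "homeomorphic_map (subtopology T (fst c)) (subtopology (Euclidean_space N) (snd c ` fst c)) (snd c)"
      using c unfolding topological_chart_def by blast
  qed (use sub in \<open>auto simp: topspace_subtopology_subset\<close>)
  then show ?thesis
    using o topological_chart_openin_image[OF c o]
    by (simp add: topological_chart_def subtopology_subtopology Int_absorb1 image_mono)
qed

lemma local_rep_image: "x \<in> fst c \<Longrightarrow> inj_on (snd c) (fst c) \<Longrightarrow> local_rep c f (snd c x) = f x"
  by (simp add: local_rep_def)

text \<open>\<open>inv_into\<close> depends on the domain, so shrinking a chart changes the function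
  \<open>local_rep\<close>; only on the image of the smaller domain do its values remain the
  same.\<close>

lemma local_rep_restricted_chart:
  assumes "inj_on (snd c) (fst c)" "y \<in> snd c ` (fst c \<inter> U)"
  shows "local_rep (fst c \<inter> U, snd c) f y = local_rep c f y"
proof -
  obtain x where x: "x \<in> fst c \<inter> U" "y = snd c x" using assms(2) by blast
  have "inv_into (fst c \<inter> U) (snd c) y = x" "inv_into (fst c) (snd c) y = x"
    using x assms(1) by (auto intro: inv_into_f_f inj_on_subset)
  then show ?thesis by (simp add: local_rep_def)
qed

section \<open>Smooth manifolds and their open submanifolds\<close>

locale manifold =
  fixes M :: "'a mfd"
  assumes smooth_manifold: "smooth_manifold M"
begin

abbreviation (input) "N \<equiv> mdim M"

lemma Hausdorff: "Hausdorff_space (mtop M)"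
  and second_countable: "second_countable (mtop M)"
  and charts_cover: "(\<Union>c\<in>charts M. fst c) = points M"
  and in_charts_iff: "c \<in> charts M \<longleftrightarrow>
       topological_chart (mtop M) N c \<and> (\<forall>c'\<in>charts M. compatible_charts N c c')"
  using smooth_manifold unfolding smooth_manifold_def by blast+

lemma topological_chart: "c \<in> charts M \<Longrightarrow> topological_chart (mtop M) N c"
  using in_charts_iff by blast

lemma chart_openin: "c \<in> charts M \<Longrightarrow> openin (mtop M) (fst c)"
  and chart_image_openin: "c \<in> charts M \<Longrightarrow> openin (Euclidean_space N) (snd c ` fst c)"
  using topological_chart unfolding topological_chart_def by blast+

lemma chart_subset: "c \<in> charts M \<Longrightarrow> fst c \<subseteq> points M"
  using chart_openin openin_subset by blast

lemma chart_inj_on: "c \<in> charts M \<Longrightarrow> inj_on (snd c) (fst c)"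
  using topological_chart topological_chart_inj_on by blast

lemma local_rep_chart: "c \<in> charts M \<Longrightarrow> x \<in> fst c \<Longrightarrow> local_rep c f (snd c x) = f x"
  by (rule local_rep_image[OF _ chart_inj_on])

lemma chart_at:
  assumes "x \<in> points M"
  obtains c where "c \<in> charts M" "x \<in> fst c"
  using assms charts_cover by blast

text \<open>Maximality of the atlas makes the shrunken chart a member. Consequently every point has
  charts inside any prescribed neighbourhood.\<close>

lemma restricted_chart:
  assumes c: "c \<in> charts M" and U: "openin (mtop M) U"
  shows "(fst c \<inter> U, snd c) \<in> charts M"
  unfolding in_charts_iff[of "(fst c \<inter> U, snd c)"]
proof (intro conjI ballI)
  show "topological_chart (mtop M) N (fst c \<inter> U, snd c)"
    using topological_chart_restrict[OF topological_chart[OF c] U] .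
  fix c' assume c': "c' \<in> charts M"
  have comp: "smooth_transition N c c'" "smooth_transition N c' c"
    using c c' in_charts_iff unfolding compatible_charts_def by blast+
  have "smooth_on N (snd c ` (fst c \<inter> U \<inter> fst c')) (local_rep (fst c \<inter> U, snd c) f) \<longleftrightarrow>
      smooth_on N (snd c ` (fst c \<inter> U \<inter> fst c')) (local_rep c f)" for f :: "'a \<Rightarrow> real"
  proof (rule smooth_on_cong)
    show "openin (Euclidean_space N) (snd c ` (fst c \<inter> U \<inter> fst c'))"
      by (rule topological_chart_openin_image[OF topological_chart[OF c]])
        (use U chart_openin[OF c] chart_openin[OF c'] in auto)
  qed (use local_rep_restricted_chart[OF chart_inj_on[OF c]] in auto)
  then have "smooth_transition N (fst c \<inter> U, snd c) c'"
    using comp(1) unfolding smooth_transition_def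
    by (auto intro: smooth_on_subset[OF _ image_mono])
  moreover have "smooth_transition N c' (fst c \<inter> U, snd c)"
    using comp(2) unfolding smooth_transition_def
    by (auto intro: smooth_on_subset[OF _ image_mono])
  ultimately show "compatible_charts N (fst c \<inter> U, snd c) c'"
    by (simp add: compatible_charts_def)
qed

lemma chart_within:
  assumes "x \<in> U" "openin (mtop M) U"
  obtains c where "c \<in> charts M" "x \<in> fst c" "fst c \<subseteq> U"
proof -
  obtain c where c: "c \<in> charts M" "x \<in> fst c"
    using assms openin_subset chart_at by blast
  show ?thesis
    by (rule that[OF restricted_chart[OF c(1) assms(2)]]) (use c assms in auto)
qed

lemma points_open_submanifold: "openin (mtop M) U \<Longrightarrow> points (open_submanifold M U) = U"
  using openin_subset by (auto simp: open_submanifold_def)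

lemma openin_open_submanifold:
  "openin (mtop M) U \<Longrightarrow> openin (mtop (open_submanifold M U)) W \<longleftrightarrow> openin (mtop M) W \<and> W \<subseteq> U"
  by (simp add: open_submanifold_def openin_open_subtopology)

lemma smooth_manifold_open_submanifold:
  assumes U: "openin (mtop M) U"
  shows "smooth_manifold (open_submanifold M U)"
  unfolding smooth_manifold_def
proof (intro conjI allI)
  let ?U = "open_submanifold M U"
  show "Hausdorff_space (mtop ?U)" "second_countable (mtop ?U)"
    using Hausdorff second_countable
    by (simp_all add: open_submanifold_def Hausdorff_space_subtopology second_countable_subtopology)
  show "(\<Union>c\<in>charts ?U. fst c) = points ?U"
    unfolding points_open_submanifold[OF U]
  proof (intro equalityI subsetI)
    fix x assume "x \<in> U"
    then obtain c where "c \<in> charts M" "x \<in> fst c" "fst c \<subseteq> U" using chart_within[OF _ U] by blast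
    then show "x \<in> (\<Union>c\<in>charts ?U. fst c)" by (intro UN_I[of c]) (auto simp: open_submanifold_def)
  qed (auto simp: open_submanifold_def)
  fix c :: "'a chart"
  have top: "topological_chart (mtop ?U) N c \<longleftrightarrow> topological_chart (mtop M) N c \<and> fst c \<subseteq> U"
    using U by (auto simp: topological_chart_def open_submanifold_def openin_open_subtopology
        subtopology_subtopology Int_absorb1)
  \<comment> \<open>Maximality over \<open>U\<close>: compatibility with the charts inside
    \<open>U\<close> suffices, because a chart \<open>c'\<close> of \<open>M\<close> meets
    \<open>c\<close> only inside \<open>U\<close> and can be cut down to \<open>U\<close>.\<close>
  have "\<forall>c'\<in>charts M. compatible_charts N c c'"
    if c: "topological_chart (mtop M) N c" "fst c \<subseteq> U" and comp: "\<forall>c'\<in>charts ?U. compatible_charts N c c'"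
  proof
    fix c' assume c': "c' \<in> charts M"
    let ?c = "(fst c' \<inter> U, snd c')"
    have "?c \<in> charts ?U"
      using restricted_chart[OF c' U] by (simp add: open_submanifold_def)
    then have tr: "smooth_transition N c ?c" "smooth_transition N ?c c"
      using comp by (auto simp: compatible_charts_def)
    have eq: "fst c \<inter> (fst c' \<inter> U) = fst c \<inter> fst c'" "fst c' \<inter> U \<inter> fst c = fst c' \<inter> fst c"
      using c(2) by auto
    have "smooth_on N (snd c' ` (fst c' \<inter> fst c)) (local_rep ?c f) \<longleftrightarrow>
        smooth_on N (snd c' ` (fst c' \<inter> fst c)) (local_rep c' f)" for f :: "'a \<Rightarrow> real"
    proof (rule smooth_on_cong)
      show "openin (Euclidean_space N) (snd c' ` (fst c' \<inter> fst c))"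
        by (rule topological_chart_openin_image[OF topological_chart[OF c']])
          (use c chart_openin[OF c'] in \<open>auto simp: topological_chart_def\<close>)
    qed (rule local_rep_restricted_chart[OF chart_inj_on[OF c']], use c(2) in auto)
    then show "compatible_charts N c c'"
      using tr by (simp add: compatible_charts_def smooth_transition_def eq)
  qed
  then show "c \<in> charts ?U \<longleftrightarrow> topological_chart (mtop ?U) (mdim ?U) c \<and>
      (\<forall>c'\<in>charts ?U. compatible_charts (mdim ?U) c c')"
    using top in_charts_iff[of c] by (auto simp: open_submanifold_def)
qed

lemma mdim_open_submanifold [simp]: "mdim (open_submanifold M U) = N"
  by (simp add: open_submanifold_def)

lemma charts_open_submanifold: "charts (open_submanifold M U) = {c \<in> charts M. fst c \<subseteq> U}"
  by (simp add: open_submanifold_def)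

lemma chart_image_openin_subset:
  "c \<in> charts M \<Longrightarrow> openin (mtop M) W \<Longrightarrow> W \<subseteq> fst c \<Longrightarrow> openin (Euclidean_space N) (snd c ` W)"
  using topological_chart_openin_image topological_chart by blast

lemma smooth_on_local_rep_cong:
  assumes c: "c \<in> charts M" and W: "openin (mtop M) W" "W \<subseteq> fst c" and "\<And>x. x \<in> W \<Longrightarrow> f x = h x"
  shows "smooth_on N (snd c ` W) (local_rep c f) \<longleftrightarrow> smooth_on N (snd c ` W) (local_rep c h)"
  by (rule smooth_on_cong[OF chart_image_openin_subset[OF c W]])
    (use assms in \<open>auto simp: local_rep_chart subset_iff\<close>)

section \<open>Recognizing smooth functions\<close>

lemma smooth_functionsD:
  "f \<in> smooth_functions M \<Longrightarrow> c \<in> charts M \<Longrightarrow> smooth_on N (snd c ` fst c) (local_rep c f)"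
  "f \<in> smooth_functions M \<Longrightarrow> f \<in> extensional (points M)"
  by (simp_all add: smooth_functions_def)

lemma smooth_functions_eqI:
  "f \<in> smooth_functions M \<Longrightarrow> h \<in> smooth_functions M \<Longrightarrow> (\<And>x. x \<in> points M \<Longrightarrow> f x = h x) \<Longrightarrow> f = h"
  using smooth_functionsD(2) extensionalityI by blast

lemma restrict_in_smooth_functions:
  assumes "\<And>c. c \<in> charts M \<Longrightarrow> smooth_on N (snd c ` fst c) (local_rep c f)"
  shows "restrict f (points M) \<in> smooth_functions M"
  unfolding smooth_functions_def
proof (intro CollectI conjI ballI)
  fix c assume c: "c \<in> charts M"
  show "smooth_on N (snd c ` fst c) (local_rep c (restrict f (points M)))"
    by (subst smooth_on_local_rep_cong[OF c chart_openin[OF c] order_refl, where h = f])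
      (use assms[OF c] chart_subset[OF c] in auto)
qed auto

text \<open>One chart around each point suffices, because the coordinate changes are smooth.\<close>

lemma smooth_functionsI_chart:
  assumes ext: "f \<in> extensional (points M)"
    and loc: "\<And>x. x \<in> points M \<Longrightarrow> \<exists>c\<in>charts M. \<exists>W. openin (mtop M) W \<and> x \<in> W \<and> W \<subseteq> fst c \<and>
      smooth_on N (snd c ` W) (local_rep c f)"
  shows "f \<in> smooth_functions M"
  unfolding smooth_functions_def
proof (intro CollectI conjI ballI ext)
  fix c' assume c': "c' \<in> charts M"
  show "smooth_on N (snd c' ` fst c') (local_rep c' f)"
  proof (rule smooth_on_local[OF chart_image_openin[OF c']])
    fix y assume "y \<in> snd c' ` fst c'"
    then obtain x where x: "x \<in> fst c'" "y = snd c' x" by blast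
    then obtain c W where c: "c \<in> charts M" and W: "openin (mtop M) W" "x \<in> W" "W \<subseteq> fst c"
      and sm: "smooth_on N (snd c ` W) (local_rep c f)"
      using loc chart_subset[OF c'] by blast
    let ?W = "W \<inter> fst c'"
    have W': "openin (mtop M) ?W" "?W \<subseteq> fst c'" using W chart_openin[OF c'] by auto
    have V: "openin (Euclidean_space N) (snd c' ` ?W)"
      using chart_image_openin_subset[OF c' W'] .
    define \<Phi> where "\<Phi> y = snd c (inv_into (fst c') (snd c') y)" for y
    have inv: "inv_into (fst c') (snd c') (snd c' z) = z" if "z \<in> fst c'" for z
      using that chart_inj_on[OF c'] by simp
    have "smooth_on N (snd c' ` ?W) (\<lambda>y. local_rep c f (\<Phi> y))"
    proof (rule smooth_on_compose[OF V chart_image_openin_subset[OF c W(1,3)] _ _ sm])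
      show "\<Phi> y \<in> snd c ` W" if "y \<in> snd c' ` ?W" for y
        using that inv by (auto simp: \<Phi>_def)
      fix i assume "i < N"
      then have "smooth_on N (snd c' ` (fst c' \<inter> fst c)) (local_rep c' (\<lambda>x. snd c x i))"
        using c c' in_charts_iff unfolding compatible_charts_def smooth_transition_def by blast
      then show "smooth_on N (snd c' ` ?W) (\<lambda>y. \<Phi> y i)"
        unfolding \<Phi>_def local_rep_def by (rule smooth_on_subset) (use W in auto)
    qed
    moreover have "local_rep c f (\<Phi> z) = local_rep c' f z" if z: "z \<in> snd c' ` ?W" for z
    proof -
      obtain x where "x \<in> W" "x \<in> fst c'" "z = snd c' x" using z by blast
      moreover have "x \<in> fst c" using \<open>x \<in> W\<close> W(3) by blast
      ultimately show ?thesis by (simp add: \<Phi>_def inv local_rep_chart[OF c] local_rep_chart[OF c'])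
    qed
    ultimately have "smooth_on N (snd c' ` ?W) (local_rep c' f)"
      using smooth_on_cong[OF V, of "\<lambda>y. local_rep c f (\<Phi> y)" "local_rep c' f"] by blast
    then show "\<exists>V. openin (Euclidean_space N) V \<and> y \<in> V \<and> smooth_on N V (local_rep c' f)"
      using V x W by blast
  qed
qed

lemma smooth_functionsI_local:
  assumes ext: "f \<in> extensional (points M)"
    and loc: "\<And>x. x \<in> points M \<Longrightarrow> \<exists>W h. openin (mtop M) W \<and> x \<in> W \<and> h \<in> smooth_functions M \<and> (\<forall>z\<in>W. f z = h z)"
  shows "f \<in> smooth_functions M"
proof (rule smooth_functionsI_chart[OF ext])
  fix x assume x: "x \<in> points M"
  obtain W h where W: "openin (mtop M) W" "x \<in> W" "h \<in> smooth_functions M" "\<And>z. z \<in> W \<Longrightarrow> f z = h z"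
    using loc[OF x] by blast
  obtain c where c: "c \<in> charts M" "x \<in> fst c" "fst c \<subseteq> W" using chart_within[OF W(2,1)] by blast
  have "smooth_on N (snd c ` fst c) (local_rep c f)"
    using smooth_on_local_rep_cong[OF c(1) chart_openin[OF c(1)], of f h] smooth_functionsD(1)[OF W(3) c(1)] W(4) c(3)
    by auto
  then show "\<exists>c\<in>charts M. \<exists>W. openin (mtop M) W \<and> x \<in> W \<and> W \<subseteq> fst c \<and> smooth_on N (snd c ` W) (local_rep c f)"
    using c chart_openin by blast
qed

lemma restrict_smooth_functions:
  assumes "f \<in> smooth_functions M" and U: "openin (mtop M) U"
  shows "restrict f U \<in> smooth_functions (open_submanifold M U)"
proof -
  interpret U: manifold "open_submanifold M U"
    using smooth_manifold_open_submanifold[OF U] by unfold_locales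
  have "restrict f (points (open_submanifold M U)) \<in> smooth_functions (open_submanifold M U)"
    by (rule U.restrict_in_smooth_functions) (use assms smooth_functionsD in \<open>auto simp: charts_open_submanifold\<close>)
  then show ?thesis by (simp add: points_open_submanifold[OF U])
qed

section \<open>Pointwise operations on smooth functions\<close>

lemma smooth_const: "(\<lambda>x\<in>points M. a) \<in> smooth_functions M"
  by (rule restrict_in_smooth_functions)
    (auto simp: local_rep_def smooth_on_iff_cont_diff_on intro!: cont_diff_on_const chart_image_openin)

lemma smooth_add:
  assumes "f \<in> smooth_functions M" "h \<in> smooth_functions M"
  shows "(\<lambda>x\<in>points M. f x + h x) \<in> smooth_functions M"
  using smooth_functionsD(1)[OF assms(1)] smooth_functionsD(1)[OF assms(2)]
  by (intro restrict_in_smooth_functions)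
    (auto simp: local_rep_def[abs_def] smooth_on_iff_cont_diff_on intro!: cont_diff_on_add chart_image_openin)

lemma smooth_mult:
  fixes f :: "'a \<Rightarrow> 'k::real_normed_algebra"
  assumes "f \<in> smooth_functions M" "h \<in> smooth_functions M"
  shows "(\<lambda>x\<in>points M. f x * h x) \<in> smooth_functions M"
  using smooth_functionsD(1)[OF assms(1)] smooth_functionsD(1)[OF assms(2)]
  by (intro restrict_in_smooth_functions)
    (auto simp: local_rep_def[abs_def] smooth_on_iff_cont_diff_on intro!: cont_diff_on_mult chart_image_openin)

lemma smooth_scale:
  fixes f :: "'a \<Rightarrow> 'k::real_normed_algebra"
  assumes "f \<in> smooth_functions M"
  shows "(\<lambda>x\<in>points M. a * f x) \<in> smooth_functions M"
  using smooth_functionsD(1)[OF assms(1)]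
  by (intro restrict_in_smooth_functions)
    (auto simp: local_rep_def[abs_def] smooth_on_iff_cont_diff_on
      intro!: cont_diff_on_mult cont_diff_on_const chart_image_openin)

lemma smooth_sum:
  assumes "\<And>j. j \<in> J \<Longrightarrow> f j \<in> smooth_functions M"
  shows "(\<lambda>x\<in>points M. \<Sum>j\<in>J. f j x) \<in> smooth_functions M"
  using smooth_functionsD(1)[OF assms]
  by (intro restrict_in_smooth_functions)
    (auto simp: local_rep_def[abs_def] smooth_on_iff_cont_diff_on intro!: cont_diff_on_sum chart_image_openin)

lemma smooth_inverse:
  fixes f :: "'a \<Rightarrow> 'k::real_normed_field"
  assumes "f \<in> smooth_functions M" "\<And>x. x \<in> points M \<Longrightarrow> f x \<noteq> 0"
  shows "(\<lambda>x\<in>points M. inverse (f x)) \<in> smooth_functions M"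
proof (rule restrict_in_smooth_functions)
  fix c assume c: "c \<in> charts M"
  have "inv_into (fst c) (snd c) y \<in> points M" if "y \<in> snd c ` fst c" for y
    using chart_subset[OF c] inv_into_into[OF that] by blast
  then show "smooth_on N (snd c ` fst c) (local_rep c (\<lambda>x. inverse (f x)))"
    using smooth_functionsD(1)[OF assms(1) c] assms(2)
    by (auto simp: local_rep_def[abs_def] smooth_on_iff_cont_diff_on intro!: cont_diff_on_inverse chart_image_openin[OF c])
qed

subsection \<open>Bump functions and extension by zero\<close>

text \<open>Nonnegative real values, also for complex scalars, exclude cancellation when bumps are
  summed with positive coefficients. \<open>T\<close> is closed in the whole manifold, so the
  function is 0 near every point outside \<open>W\<close>, not merely at it.\<close>

definition bump :: "'a set \<Rightarrow> 'a set \<Rightarrow> ('a \<Rightarrow> 'k::real_normed_field) \<Rightarrow> bool" where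
  "bump W B \<beta> \<longleftrightarrow> \<beta> \<in> smooth_functions M \<and> openin (mtop M) B \<and> (\<forall>x\<in>B. \<beta> x = 1) \<and>
     (\<forall>x\<in>points M. \<exists>t\<ge>0. \<beta> x = of_real t) \<and>
     (\<exists>T. closedin (mtop M) T \<and> T \<subseteq> W \<and> (\<forall>x\<in>points M - T. \<beta> x = 0))"

lemma ex_bump:
  assumes W: "openin (mtop M) W" "x \<in> W"
  obtains B and \<beta> :: "'a \<Rightarrow> 'k::real_normed_field" where "bump W B \<beta>" "x \<in> B" "B \<subseteq> W"
proof -
  obtain c where c: "c \<in> charts M" "x \<in> fst c" "fst c \<subseteq> W" using chart_within[OF W(2,1)] by blast
  let ?a = "snd c x"
  obtain r' where r': "r' > 0" "cube N ?a r' \<subseteq> snd c ` fst c"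
    using openin_contains_cube[OF chart_image_openin[OF c(1)]] c(2) by blast
  \<comment> \<open>Half the radius for the plateau, so that the support of radius
    \<open>2 * r\<close> still fits into the chart.\<close>
  define r where "r = r' / 2"
  have r: "r > 0" "cube N ?a (2 * r) \<subseteq> snd c ` fst c" using r' by (simp_all add: r_def)
  define T where "T = inv_into (fst c) (snd c) ` cube N ?a (2 * r)"
  define B where "B = {z \<in> fst c. snd c z \<in> {y. (\<forall>i\<ge>N. y i = 0) \<and> (\<forall>i<N. \<bar>y i - ?a i\<bar> < r)}}"
  define \<beta> :: "'a \<Rightarrow> 'k" where
    "\<beta> = (\<lambda>z\<in>points M. if z \<in> fst c then of_real (cutoff N ?a r (snd c z)) else 0)"
  have zero: "snd c z i = 0" if "z \<in> fst c" "i \<ge> N" for z i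
    using that openin_subset[OF chart_image_openin[OF c(1)]] by (auto simp: topspace_Euclidean_space)
  \<comment> \<open>A set closed in the chart domain need not be closed in the manifold; compactness
    together with the Hausdorff property makes it so.\<close>
  have T: "closedin (mtop M) T"
    unfolding T_def
    by (intro compactin_imp_closedin[OF Hausdorff] topological_chart_compactin[OF topological_chart[OF c(1)]]
        compact_cube r(2))
  have T_sub: "T \<subseteq> fst c" using r(2) by (auto simp: T_def intro: inv_into_into)
  have \<beta>_T: "\<beta> z = 0" if "z \<in> points M - T" for z
  proof (cases "z \<in> fst c")
    case True
    have "snd c z \<notin> cube N ?a (2 * r)"
      using that True chart_inj_on[OF c(1)] by (force simp: T_def)
    then obtain i where "i < N" "\<bar>snd c z i - ?a i\<bar> \<ge> 2 * r"
      using zero[OF True] by (fastforce simp: cube_def)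
    then show ?thesis using that True cutoff_eq_0[OF r(1)] by (simp add: \<beta>_def)
  qed (use that in \<open>simp add: \<beta>_def\<close>)
  have "\<beta> \<in> smooth_functions M"
  proof (rule smooth_functionsI_chart)
    fix z assume z: "z \<in> points M"
    show "\<exists>c\<in>charts M. \<exists>W. openin (mtop M) W \<and> z \<in> W \<and> W \<subseteq> fst c \<and> smooth_on N (snd c ` W) (local_rep c \<beta>)"
    proof (cases "z \<in> fst c")
      case True
      have "smooth_on N (snd c ` fst c) (local_rep c \<beta>) \<longleftrightarrow>
          smooth_on N (snd c ` fst c) (\<lambda>y. of_real (cutoff N ?a r y) :: 'k)"
        by (rule smooth_on_cong[OF chart_image_openin[OF c(1)]])
          (use chart_subset[OF c(1)] in \<open>auto simp: \<beta>_def local_rep_chart[OF c(1)]\<close>)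
      moreover have "smooth_on N (snd c ` fst c) (\<lambda>y. of_real (cutoff N ?a r y) :: 'k)"
        using smooth_on_cutoff[OF chart_image_openin[OF c(1)]] unfolding smooth_on_iff_cont_diff_on
        by (intro allI bounded_linear.cont_diff_on[OF bounded_linear_of_real chart_image_openin[OF c(1)]]) blast
      ultimately show ?thesis
        using c(1) True chart_openin[OF c(1)] by (intro bexI[of _ c] exI[of _ "fst c"] conjI) auto
    next
      case False
      then have zT: "z \<in> points M - T" using z T_sub by auto
      have "openin (mtop M) (points M - T)" using T by (simp add: closedin_def)
      then obtain c' where c': "c' \<in> charts M" "z \<in> fst c'" "fst c' \<subseteq> points M - T"
        using chart_within[OF zT] by blast
      have "smooth_on N (snd c' ` fst c') (local_rep c' \<beta>) \<longleftrightarrow>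
          smooth_on N (snd c' ` fst c') (local_rep c' (\<lambda>x. 0 :: 'k))"
        by (rule smooth_on_local_rep_cong) (use c' chart_openin \<beta>_T in auto)
      then have "smooth_on N (snd c' ` fst c') (local_rep c' \<beta>)"
        by (simp add: local_rep_def smooth_on_iff_cont_diff_on cont_diff_on_const chart_image_openin[OF c'(1)])
      then show ?thesis using c' chart_openin[OF c'(1)] by (intro bexI[of _ c'] exI[of _ "fst c'"] conjI) auto
    qed
  qed (simp add: \<beta>_def)
  moreover have "openin (mtop M) B"
    unfolding B_def by (rule topological_chart_openin_preimage[OF topological_chart[OF c(1)] open_cube_openin])
  moreover have "\<beta> z = 1" if "z \<in> B" for z
    using that chart_subset[OF c(1)] cutoff_eq_1[OF r(1), of N "snd c z" ?a]
    by (auto simp: B_def \<beta>_def less_imp_le)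
  moreover have "\<exists>t\<ge>0. \<beta> z = of_real t" if "z \<in> points M" for z
    using that cutoff_nonneg[of N ?a r "snd c z"] by (auto simp: \<beta>_def intro: exI[of _ 0])
  ultimately have "bump W B \<beta>"
    unfolding bump_def using T T_sub c(3) \<beta>_T by (intro conjI exI[of _ T] ballI) auto
  moreover have "x \<in> B" "B \<subseteq> W" using c r(1) zero[OF c(2)] by (auto simp: B_def)
  ultimately show ?thesis by (rule that)
qed

definition extend_by_zero :: "'a set \<Rightarrow> ('a \<Rightarrow> 'k::real_normed_field) \<Rightarrow> ('a \<Rightarrow> 'k) \<Rightarrow> 'a \<Rightarrow> 'k" where
  "extend_by_zero U \<beta> f = (\<lambda>x\<in>points M. if x \<in> U then \<beta> x * f x else 0)"

text \<open>The closed support of \<beta> lies in \<open>U\<close>, so a point outside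
  \<open>U\<close> has a neighbourhood on which the extension is 0. What \<open>f\<close> does near
  the boundary of \<open>U\<close> is invisible.\<close>

lemma extend_by_zero_smooth:
  assumes U: "openin (mtop M) U" and b: "bump U B \<beta>" and f: "f \<in> smooth_functions (open_submanifold M U)"
  shows "extend_by_zero U \<beta> f \<in> smooth_functions M"
proof (rule smooth_functionsI_chart)
  interpret U: manifold "open_submanifold M U"
    using smooth_manifold_open_submanifold[OF U] by unfold_locales
  obtain T where T: "closedin (mtop M) T" "T \<subseteq> U" "\<And>x. x \<in> points M - T \<Longrightarrow> \<beta> x = 0"
    and \<beta>: "\<beta> \<in> smooth_functions M"
    using b unfolding bump_def by blast
  fix x assume x: "x \<in> points M"
  show "\<exists>c\<in>charts M. \<exists>W. openin (mtop M) W \<and> x \<in> W \<and> W \<subseteq> fst c \<and>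
      smooth_on N (snd c ` W) (local_rep c (extend_by_zero U \<beta> f))"
  proof (cases "x \<in> U")
    case True
    then obtain c where c: "c \<in> charts M" "x \<in> fst c" "fst c \<subseteq> U" using chart_within[OF _ U] by blast
    have "smooth_on N (snd c ` fst c) (local_rep c f)"
    proof -
      have "c \<in> charts (open_submanifold M U)" using c by (simp add: charts_open_submanifold)
      from U.smooth_functionsD(1)[OF f this] show ?thesis unfolding mdim_open_submanifold .
    qed
    then have "smooth_on N (snd c ` fst c) (\<lambda>y. local_rep c \<beta> y * local_rep c f y)"
      by (rule smooth_on_mult[OF chart_image_openin[OF c(1)] smooth_functionsD(1)[OF \<beta> c(1)]])
    then have "smooth_on N (snd c ` fst c) (local_rep c (\<lambda>x. \<beta> x * f x))"
      by (simp add: local_rep_def)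
    moreover have "smooth_on N (snd c ` fst c) (local_rep c (extend_by_zero U \<beta> f)) \<longleftrightarrow>
        smooth_on N (snd c ` fst c) (local_rep c (\<lambda>x. \<beta> x * f x))"
      by (rule smooth_on_local_rep_cong)
        (use c chart_openin chart_subset[OF c(1)] in \<open>auto simp: extend_by_zero_def\<close>)
    ultimately show ?thesis using c chart_openin[OF c(1)] by (intro bexI[of _ c] exI[of _ "fst c"] conjI) auto
  next
    case False
    then have xT: "x \<in> points M - T" using x T(2) by auto
    have "openin (mtop M) (points M - T)" using T by (simp add: closedin_def)
    then obtain c where c: "c \<in> charts M" "x \<in> fst c" "fst c \<subseteq> points M - T"
      using chart_within[OF xT] by blast
    have "smooth_on N (snd c ` fst c) (local_rep c (extend_by_zero U \<beta> f)) \<longleftrightarrow>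
        smooth_on N (snd c ` fst c) (local_rep c (\<lambda>x. 0 :: 'b))"
      by (rule smooth_on_local_rep_cong) (use c chart_openin T(3) in \<open>auto simp: extend_by_zero_def\<close>)
    then have "smooth_on N (snd c ` fst c) (local_rep c (extend_by_zero U \<beta> f))"
      by (simp add: local_rep_def smooth_on_iff_cont_diff_on cont_diff_on_const chart_image_openin[OF c(1)])
    then show ?thesis using c chart_openin[OF c(1)] by (intro bexI[of _ c] exI[of _ "fst c"] conjI) auto
  qed
qed (simp add: extend_by_zero_def)

lemma extend_by_zero_eq:
  "bump U B \<beta> \<Longrightarrow> x \<in> B \<Longrightarrow> x \<in> U \<Longrightarrow> extend_by_zero U \<beta> f x = f x"
  unfolding bump_def extend_by_zero_def using openin_subset by fastforce

end

section \<open>Localization of bidifferential operators\<close>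

context manifold
begin

section \<open>Locality of bidifferential operators\<close>

lemma chart_multi_partial_cong:
  assumes "c \<in> charts M" "openin (mtop M) W" "x \<in> W" "x \<in> fst c" "\<And>z. z \<in> W \<Longrightarrow> f z = h z"
  shows "chart_multi_partial N c \<alpha> f x = chart_multi_partial N c \<alpha> h x"
  unfolding chart_multi_partial_def
proof (rule multi_partial_cong)
  show "openin (Euclidean_space N) (snd c ` (W \<inter> fst c))"
    by (rule chart_image_openin_subset) (use assms chart_openin[OF assms(1)] in auto)
qed (use assms in \<open>auto simp: local_rep_chart\<close>)

lemma chart_multi_partial_zero:
  assumes "c \<in> charts M" "openin (mtop M) W" "x \<in> W" "x \<in> fst c" "\<And>z. z \<in> W \<Longrightarrow> f z = 0"
  shows "chart_multi_partial N c \<alpha> f x = 0"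
  unfolding chart_multi_partial_def
proof (rule multi_partial_zero)
  show "openin (Euclidean_space N) (snd c ` (W \<inter> fst c))"
    by (rule chart_image_openin_subset) (use assms chart_openin[OF assms(1)] in auto)
qed (use assms in \<open>auto simp: local_rep_chart\<close>)

abbreviation (input) expansion where
  "expansion l A c f g x \<equiv> \<Sum>\<alpha>\<in>multi_indices N l. \<Sum>\<beta>\<in>multi_indices N l.
     A \<alpha> \<beta> x * chart_multi_partial N c \<alpha> f x * chart_multi_partial N c \<beta> g x"

lemma bidifferential_closed:
  "bidifferential_operator M C \<Longrightarrow> f \<in> smooth_functions M \<Longrightarrow> h \<in> smooth_functions M \<Longrightarrow> C f h \<in> smooth_functions M"
  unfolding bidifferential_operator_def bilinear_on_smooth_def by blast

lemma bidifferential_expansion: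
  assumes "bidifferential_operator M C" "c \<in> charts M"
  obtains A l where "\<And>f h x. f \<in> smooth_functions M \<Longrightarrow> h \<in> smooth_functions M \<Longrightarrow> x \<in> fst c \<Longrightarrow>
    C f h x = expansion l A c f h x"
proof -
  obtain l where "\<forall>c\<in>charts M. \<exists>A.
       (\<forall>\<alpha>\<in>multi_indices N l. \<forall>\<beta>\<in>multi_indices N l. A \<alpha> \<beta> \<in> smooth_functions (open_submanifold M (fst c))) \<and>
       (\<forall>f\<in>smooth_functions M. \<forall>g\<in>smooth_functions M. \<forall>x\<in>fst c.
          C f g x = expansion l A c f g x)"
    using assms(1) unfolding bidifferential_operator_def by (elim conjE exE)
  from bspec[OF this assms(2)] show ?thesis
    using that by (elim exE conjE) blast
qed

text \<open>A finite expansion in partial derivatives at \<open>x\<close> depends only on the germs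
  of the two arguments at \<open>x\<close>.\<close>

lemma bidifferential_local:
  assumes C: "bidifferential_operator M C"
    and s: "f \<in> smooth_functions M" "f' \<in> smooth_functions M" "h \<in> smooth_functions M" "h' \<in> smooth_functions M"
    and W: "openin (mtop M) W" "x \<in> W" "\<And>z. z \<in> W \<Longrightarrow> f z = f' z" "\<And>z. z \<in> W \<Longrightarrow> h z = h' z"
  shows "C f h x = C f' h' x"
proof -
  obtain c where c: "c \<in> charts M" "x \<in> fst c" using chart_within[OF W(2,1)] by blast
  obtain A l where A: "\<And>f h x. f \<in> smooth_functions M \<Longrightarrow> h \<in> smooth_functions M \<Longrightarrow> x \<in> fst c \<Longrightarrow>
    C f h x = expansion l A c f h x"
    by (rule bidifferential_expansion[OF C c(1)]) blast
  have "chart_multi_partial N c \<alpha> f x = chart_multi_partial N c \<alpha> f' x"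
    "chart_multi_partial N c \<alpha> h x = chart_multi_partial N c \<alpha> h' x" for \<alpha>
    by (rule chart_multi_partial_cong[OF c(1) W(1,2) c(2)]; use W in simp)+
  then show ?thesis by (simp add: A[OF s(1,3) c(2)] A[OF s(2,4) c(2)])
qed

lemma bidifferential_local_zero:
  assumes C: "bidifferential_operator M C"
    and s: "f \<in> smooth_functions M" "h \<in> smooth_functions M"
    and W: "openin (mtop M) W" "x \<in> W" "(\<forall>z\<in>W. f z = 0) \<or> (\<forall>z\<in>W. h z = 0)"
  shows "C f h x = 0"
proof -
  obtain c where c: "c \<in> charts M" "x \<in> fst c" using chart_within[OF W(2,1)] by blast
  obtain A l where A: "\<And>f h x. f \<in> smooth_functions M \<Longrightarrow> h \<in> smooth_functions M \<Longrightarrow> x \<in> fst c \<Longrightarrow>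
    C f h x = expansion l A c f h x"
    by (rule bidifferential_expansion[OF C c(1)]) blast
  have "(\<forall>\<alpha>. chart_multi_partial N c \<alpha> f x = 0) \<or> (\<forall>\<alpha>. chart_multi_partial N c \<alpha> h x = 0)"
    using W(3) chart_multi_partial_zero[OF c(1) W(1,2) c(2)] by blast
  then show ?thesis by (auto simp: A[OF s c(2)])
qed

text \<open>At each point the localization is computed by means of extensions of the germs to all of M.\<close>

lemma ex_localization:
  fixes C :: "('a, 'k::real_normed_field) bi_op"
  assumes U: "openin (mtop M) U" and C: "bidifferential_operator M C"
  shows "\<exists>D. bidifferential_operator (open_submanifold M U) D \<and>
    (\<forall>f\<in>smooth_functions M. \<forall>g\<in>smooth_functions M. restrict (C f g) U = D (restrict f U) (restrict g U))"
proof -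
  interpret U: manifold "open_submanifold M U"
    using smooth_manifold_open_submanifold[OF U] by unfold_locales
  note pU = points_open_submanifold[OF U]
  let ?S = "smooth_functions (open_submanifold M U)"
  have "\<exists>B \<beta>. bump U B (\<beta> :: 'a \<Rightarrow> 'k) \<and> x \<in> B \<and> B \<subseteq> U" if "x \<in> U" for x
    by (rule ex_bump[OF U that]) blast
  then obtain B and \<beta> :: "'a \<Rightarrow> 'a \<Rightarrow> 'k" where
    b: "\<And>x. x \<in> U \<Longrightarrow> bump U (B x) (\<beta> x)" "\<And>x. x \<in> U \<Longrightarrow> x \<in> B x" "\<And>x. x \<in> U \<Longrightarrow> B x \<subseteq> U"
    by metis
  define ext where "ext x f = extend_by_zero U (\<beta> x) f" for x f
  define D where "D f g = (\<lambda>x\<in>U. C (ext x f) (ext x g) x)" for f g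
  have oB: "openin (mtop M) (B x)" if "x \<in> U" for x
    using b(1)[OF that] by (simp add: bump_def)
  have ext_smooth: "ext x f \<in> smooth_functions M" if "x \<in> U" "f \<in> ?S" for x f
    unfolding ext_def by (rule extend_by_zero_smooth[OF U b(1)[OF that(1)] that(2)])
  have ext_eq: "ext x f z = f z" if "x \<in> U" "z \<in> B x" for x f z
    unfolding ext_def using extend_by_zero_eq[OF b(1)[OF that(1)] that(2)] b(3) that by blast
  \<comment> \<open>\<open>D\<close> uses a new extension at every point. By locality a single
    extension computes it on all of \<open>B x\<close>, and there \<open>D f g\<close> coincides
    with a global smooth function.\<close>
  have near: "D f g z = C (ext x f) (ext x g) z"
    if fg: "f \<in> ?S" "g \<in> ?S"
      and x: "x \<in> U" and z: "z \<in> B x" for f g x z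
  proof -
    have zU: "z \<in> U" using b(3)[OF x] z by blast
    have "C (ext z f) (ext z g) z = C (ext x f) (ext x g) z"
      by (rule bidifferential_local[OF C, of _ _ _ _ "B x \<inter> B z"])
        (use fg x z zU b(2)[OF zU] in \<open>auto intro!: ext_smooth openin_Int oB simp: ext_eq\<close>)
    then show ?thesis using zU by (simp add: D_def)
  qed
  have lin: "ext x (\<lambda>y\<in>U. a * f y + b * g y) = (\<lambda>y\<in>points M. a * ext x f y + b * ext x g y)" for x a b f g
    by (auto simp: ext_def extend_by_zero_def restrict_def algebra_simps)
  have "bidifferential_operator (open_submanifold M U) D"
    unfolding bidifferential_operator_def mdim_open_submanifold
  proof (intro conjI)
    show "bilinear_on_smooth (open_submanifold M U) D"
      unfolding bilinear_on_smooth_def pU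
    proof (intro conjI ballI allI)
      fix f g :: "'a \<Rightarrow> 'k" assume fg: "f \<in> ?S" "g \<in> ?S"
      show "D f g \<in> ?S"
      proof (rule U.smooth_functionsI_local)
        fix x assume "x \<in> points (open_submanifold M U)"
        then have x: "x \<in> U" by (simp add: pU)
        have "restrict (C (ext x f) (ext x g)) U \<in> ?S"
          by (intro restrict_smooth_functions[OF _ U] bidifferential_closed[OF C] ext_smooth x fg)
        then show "\<exists>W h. openin (mtop (open_submanifold M U)) W \<and> x \<in> W \<and>
            h \<in> ?S \<and> (\<forall>z\<in>W. D f g z = h z)"
          using near[OF fg x] b(2,3)[OF x] oB[OF x]
          by (intro exI[of _ "B x"] exI[of _ "restrict (C (ext x f) (ext x g)) U"])
            (auto simp: openin_open_submanifold[OF U])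
      qed (simp add: D_def pU)
    next
      fix f g h :: "'a \<Rightarrow> 'k" and a b' x
      assume fgh: "f \<in> ?S" "g \<in> ?S"
        "h \<in> ?S" and x: "x \<in> U"
      have "x \<in> points M" using x openin_subset[OF U] by blast
      then have "C (\<lambda>y\<in>points M. a * ext x f y + b' * ext x g y) (ext x h) x =
            a * C (ext x f) (ext x h) x + b' * C (ext x g) (ext x h) x \<and>
          C (ext x h) (\<lambda>y\<in>points M. a * ext x f y + b' * ext x g y) x =
            a * C (ext x h) (ext x f) x + b' * C (ext x h) (ext x g) x"
        using C ext_smooth[OF x] fgh unfolding bidifferential_operator_def bilinear_on_smooth_def by blast
      then show "D (\<lambda>y\<in>U. a * f y + b' * g y) h x = a * D f h x + b' * D g h x"
        "D h (\<lambda>y\<in>U. a * f y + b' * g y) x = a * D h f x + b' * D h g x"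
        using x by (simp_all add: D_def lin)
    qed
  next
    obtain l where l: "\<forall>c\<in>charts M. \<exists>A.
       (\<forall>\<alpha>\<in>multi_indices N l. \<forall>\<beta>\<in>multi_indices N l. A \<alpha> \<beta> \<in> smooth_functions (open_submanifold M (fst c))) \<and>
       (\<forall>f\<in>smooth_functions M. \<forall>g\<in>smooth_functions M. \<forall>x\<in>fst c.
          C f g x = expansion l A c f g x)"
      using C unfolding bidifferential_operator_def by (elim conjE exE)
    show "\<exists>l. \<forall>c\<in>charts (open_submanifold M U). \<exists>A.
       (\<forall>\<alpha>\<in>multi_indices N l. \<forall>\<beta>\<in>multi_indices N l.
          A \<alpha> \<beta> \<in> smooth_functions (open_submanifold (open_submanifold M U) (fst c))) \<and>
       (\<forall>f\<in>?S. \<forall>g\<in>?S. \<forall>x\<in>fst c.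
          D f g x = expansion l A c f g x)"
    proof (intro exI[of _ l] ballI)
      fix c assume "c \<in> charts (open_submanifold M U)"
      then have c: "c \<in> charts M" "fst c \<subseteq> U" by (auto simp: charts_open_submanifold)
      \<comment> \<open>The chart domain carries the same submanifold structure from
        \<open>M\<close> and from \<open>U\<close>, so the coefficient functions of \<open>C\<close>
        serve unchanged for \<open>D\<close>.\<close>
      have sub: "open_submanifold (open_submanifold M U) (fst c) = open_submanifold M (fst c)"
        using c(2) by (auto simp: open_submanifold_def subtopology_subtopology Int_absorb1)
      obtain A where A: "\<forall>\<alpha>\<in>multi_indices N l. \<forall>\<beta>\<in>multi_indices N l. A \<alpha> \<beta> \<in> smooth_functions (open_submanifold M (fst c))"
        "\<forall>f\<in>smooth_functions M. \<forall>g\<in>smooth_functions M. \<forall>x\<in>fst c.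
          C f g x = expansion l A c f g x"
        using bspec[OF l c(1)] by (elim exE conjE)
      have "D f g x = expansion l A c f g x"
        if fg: "f \<in> ?S" "g \<in> ?S"
          and x: "x \<in> fst c" for f g x
      proof -
        have xU: "x \<in> U" using x c(2) by blast
        have "chart_multi_partial N c \<alpha> (ext x f) x = chart_multi_partial N c \<alpha> f x" for \<alpha> f
          by (rule chart_multi_partial_cong[OF c(1) oB[OF xU] b(2)[OF xU] x]) (rule ext_eq[OF xU])
        then show ?thesis
          using A(2)[rule_format, OF ext_smooth[OF xU fg(1)] ext_smooth[OF xU fg(2)] x] xU
          by (simp add: D_def)
      qed
      then show "\<exists>A. (\<forall>\<alpha>\<in>multi_indices N l. \<forall>\<beta>\<in>multi_indices N l.
            A \<alpha> \<beta> \<in> smooth_functions (open_submanifold (open_submanifold M U) (fst c))) \<and>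
          (\<forall>f\<in>?S. \<forall>g\<in>?S. \<forall>x\<in>fst c.
             D f g x = expansion l A c f g x)"
        using A(1) unfolding sub by (intro exI[of _ A] conjI ballI) auto
    qed
  qed
  moreover have "restrict (C f g) U = D (restrict f U) (restrict g U)"
    if "f \<in> smooth_functions M" "g \<in> smooth_functions M" for f g
  proof
    fix x
    show "restrict (C f g) U x = D (restrict f U) (restrict g U) x"
    proof (cases "x \<in> U")
      case True
      have "C f g x = C (ext x (restrict f U)) (ext x (restrict g U)) x"
        by (rule bidifferential_local[OF C, of _ _ _ _ "B x"])
          (use that True b(2,3)[OF True] in
            \<open>auto intro!: ext_smooth oB restrict_smooth_functions[OF _ U] simp: ext_eq subset_iff\<close>)
      then show ?thesis using True by (simp add: D_def)
    qed (simp add: D_def)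
  qed
  ultimately show ?thesis by blast
qed

lemma
  assumes "openin (mtop M) U" "bidifferential_operator M C"
  shows localization_bidifferential: "bidifferential_operator (open_submanifold M U) (localization M U C)"
    and localization_restrict: "f \<in> smooth_functions M \<Longrightarrow> g \<in> smooth_functions M \<Longrightarrow>
      localization M U C (restrict f U) (restrict g U) = restrict (C f g) U"
  using someI_ex[OF ex_localization[OF assms]] unfolding localization_def[symmetric] by simp_all

text \<open>Locality of the chosen operator replaces \<open>f\<close> and \<open>g\<close> by the
  restrictions of \<open>F\<close> and \<open>G\<close>, where its values are prescribed by
  \<open>C\<close>. The choice made by \<open>SOME\<close> is thereby irrelevant.\<close>

lemma localization_eq:
  assumes U: "openin (mtop M) U" and C: "bidifferential_operator M C"
    and f: "f \<in> smooth_functions (open_submanifold M U)" "F \<in> smooth_functions M"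
    and g: "g \<in> smooth_functions (open_submanifold M U)" "G \<in> smooth_functions M"
    and W: "openin (mtop M) W" "W \<subseteq> U" "x \<in> W" "\<And>z. z \<in> W \<Longrightarrow> f z = F z" "\<And>z. z \<in> W \<Longrightarrow> g z = G z"
  shows "localization M U C f g x = C F G x"
proof -
  interpret U: manifold "open_submanifold M U"
    using smooth_manifold_open_submanifold[OF U] by unfold_locales
  have "localization M U C f g x = localization M U C (restrict F U) (restrict G U) x"
    by (rule U.bidifferential_local[OF localization_bidifferential[OF U C], of _ _ _ _ W])
      (use assms in \<open>auto intro!: restrict_smooth_functions simp: openin_open_submanifold[OF U] subset_iff\<close>)
  also have "\<dots> = C F G x"
    using localization_restrict[OF U C f(2) g(2)] W by auto
  finally show ?thesis .
qed

end

section \<open>Summation with small coefficients\<close>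

lemma iterated_partial_scaleR:
  assumes V: "openin (Euclidean_space N) V" and F: "smooth_on N V F"
  shows "set is \<subseteq> {..<N} \<Longrightarrow> y \<in> V \<Longrightarrow> iterated_partial is (\<lambda>y. a *\<^sub>R F y) y = a *\<^sub>R iterated_partial is F y"
proof (induction "is" arbitrary: y)
  case (Cons i "is")
  have "cont_diff_on (Suc 0 + length is) N V F"
    using F unfolding smooth_on_iff_cont_diff_on by blast
  then have isN: "cont_diff_on (Suc 0) N V (iterated_partial is F)"
    by (rule cont_diff_on_iterated_partial) (use Cons in auto)
  have "partial i (iterated_partial is (\<lambda>y. a *\<^sub>R F y)) y = partial i (\<lambda>y. a *\<^sub>R iterated_partial is F y) y"
    by (rule partial_cong[OF V]) (use Cons in auto)
  also have "\<dots> = a *\<^sub>R partial i (iterated_partial is F) y"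
  proof (rule partial_eqI)
    have "((\<lambda>t. iterated_partial is F (y(i := t))) has_vector_derivative partial i (iterated_partial is F) y) (at (y i))"
      by (rule has_partial[OF isN]) (use Cons in auto)
    then show "((\<lambda>t. a *\<^sub>R iterated_partial is F (y(i := t))) has_vector_derivative
        a *\<^sub>R partial i (iterated_partial is F) y) (at (y i))"
      by (rule bounded_linear.has_vector_derivative[OF bounded_linear_scaleR_right])
  qed
  finally show ?case by (simp add: iterated_partial_Cons)
qed simp

context manifold
begin

section \<open>Countable covers and convergence with all derivatives\<close>

lemma countable_subcover:
  assumes U: "openin (mtop M) U" and O: "\<And>i. i \<in> I \<Longrightarrow> openin (mtop M) (B i)" "U \<subseteq> (\<Union>i\<in>I. B i)"
  obtains J where "countable J" "J \<subseteq> I" "U \<subseteq> (\<Union>i\<in>J. B i)"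
proof -
  interpret U: manifold "open_submanifold M U"
    using smooth_manifold_open_submanifold[OF U] by unfold_locales
  have "Lindelof_space (mtop (open_submanifold M U))"
    by (rule second_countable_imp_Lindelof_space[OF U.second_countable])
  moreover have "\<forall>W\<in>(\<lambda>i. U \<inter> B i) ` I. openin (mtop (open_submanifold M U)) W"
    using O(1) U by (auto simp: openin_open_submanifold[OF U])
  moreover have "\<Union> ((\<lambda>i. U \<inter> B i) ` I) = points (open_submanifold M U)"
    using O(2) by (auto simp: points_open_submanifold[OF U])
  ultimately obtain \<V> where V: "countable \<V>" "\<V> \<subseteq> (\<lambda>i. U \<inter> B i) ` I" "\<Union> \<V> = points (open_submanifold M U)"
    unfolding Lindelof_space_def by meson
  obtain J where "countable J" "J \<subseteq> I" "\<V> = (\<lambda>i. U \<inter> B i) ` J"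
    using V(1,2) countable_subset_image[of \<V> "\<lambda>i. U \<inter> B i" I] by blast
  then show ?thesis
    using V(3) by (intro that[of J]) (auto simp: points_open_submanifold[OF U])
qed

text \<open>The closed cubes are compact and give rise to countably many seminorms; the open ones
  are the neighbourhoods on which the resulting bounds are used.\<close>

lemma ex_countable_cubes:
  obtains \<K> :: "('a chart \<times> (nat \<Rightarrow> real) \<times> real) set"
  where "countable \<K>" "\<And>c a r. (c, a, r) \<in> \<K> \<Longrightarrow> c \<in> charts M \<and> cube N a r \<subseteq> snd c ` fst c"
    "\<And>x. x \<in> points M \<Longrightarrow> \<exists>(c, a, r)\<in>\<K>. x \<in> fst c \<and> (\<forall>i<N. \<bar>snd c x i - a i\<bar> < r)"
proof -
  define I where "I = {(c, a, r). c \<in> charts M \<and> cube N a r \<subseteq> snd c ` fst c}"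
  define B where "B = (\<lambda>(c::'a chart, a, r). {z \<in> fst c. snd c z \<in> {y. (\<forall>i\<ge>N. y i = 0) \<and> (\<forall>i<N. \<bar>y i - a i\<bar> < r)}})"
  have "openin (mtop M) (B i)" if "i \<in> I" for i
  proof -
    obtain c a r where i: "i = (c, a, r)" by (rule prod_cases3)
    with that have "topological_chart (mtop M) N c" using topological_chart by (auto simp: I_def)
    from topological_chart_openin_preimage[OF this open_cube_openin] show ?thesis
      by (simp add: i B_def)
  qed
  moreover have "points M \<subseteq> (\<Union>i\<in>I. B i)"
  proof
    fix x assume "x \<in> points M"
    then obtain c where c: "c \<in> charts M" "x \<in> fst c" by (rule chart_at)
    then obtain r where r: "r > 0" "cube N (snd c x) r \<subseteq> snd c ` fst c"
      using openin_contains_cube[OF chart_image_openin[OF c(1)], of "snd c x"] by blast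
    have "\<forall>i\<ge>N. snd c x i = 0"
      using c(2) openin_subset[OF chart_image_openin[OF c(1)]] by (auto simp: topspace_Euclidean_space)
    then have "(c, snd c x, r) \<in> I" "x \<in> B (c, snd c x, r)"
      using c r by (auto simp: I_def B_def)
    then show "x \<in> (\<Union>i\<in>I. B i)" by blast
  qed
  ultimately obtain J where J: "countable J" "J \<subseteq> I" "points M \<subseteq> (\<Union>i\<in>J. B i)"
    by (rule countable_subcover[OF openin_topspace])
  show ?thesis
  proof (rule that[OF J(1)])
    show "c \<in> charts M \<and> cube N a r \<subseteq> snd c ` fst c" if "(c, a, r) \<in> J" for c a r
      using J(2) that by (auto simp: I_def)
    show "\<exists>(c, a, r)\<in>J. x \<in> fst c \<and> (\<forall>i<N. \<bar>snd c x i - a i\<bar> < r)" if x: "x \<in> points M" for x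
    proof -
      obtain i where i: "i \<in> J" "x \<in> B i" using J(3) x by blast
      obtain c a r where "i = (c, a, r)" by (rule prod_cases3)
      with i show ?thesis by (intro bexI[of _ i]) (auto simp: B_def)
    qed
  qed
qed

text \<open>The part of convergence in the space of smooth functions that is used below: in one
  chart around each point all derivatives converge at the point, and these determine the value of a
  bidifferential operator there.\<close>

definition smoothly_sums :: "(nat \<Rightarrow> 'a \<Rightarrow> 'k::real_normed_vector) \<Rightarrow> ('a \<Rightarrow> 'k) \<Rightarrow> (nat \<Rightarrow> real) \<Rightarrow> bool" where
  "smoothly_sums h g \<epsilon> \<longleftrightarrow> g \<in> smooth_functions M \<and> (\<forall>x\<in>points M. \<exists>c\<in>charts M. x \<in> fst c \<and>
     (\<forall>\<alpha>. (\<lambda>m. \<epsilon> m *\<^sub>R chart_multi_partial N c \<alpha> (h m) x) sums chart_multi_partial N c \<alpha> g x))"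

text \<open>Countably many seminorms (bounds of iterated partial derivatives on the cubes) control
  convergence in the space of smooth functions, so a diagonal choice makes all the series converge.\<close>

lemma ex_small_coefficients:
  fixes h :: "nat \<Rightarrow> nat \<Rightarrow> 'a \<Rightarrow> 'k::{real_normed_field, banach}"
  assumes h: "\<And>j m. h j m \<in> smooth_functions M"
  obtains \<epsilon> :: "nat \<Rightarrow> real" where "\<And>m. \<epsilon> m > 0"
    "\<And>j. smoothly_sums (h j) (\<lambda>x\<in>points M. suminf (\<lambda>m. \<epsilon> m *\<^sub>R h j m x)) \<epsilon>"
proof -
  obtain \<K> :: "('a chart \<times> (nat \<Rightarrow> real) \<times> real) set"
    where K: "countable \<K>" "\<And>c a r. (c, a, r) \<in> \<K> \<Longrightarrow> c \<in> charts M \<and> cube N a r \<subseteq> snd c ` fst c"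
    "\<And>x. x \<in> points M \<Longrightarrow> \<exists>(c, a, r)\<in>\<K>. x \<in> fst c \<and> (\<forall>i<N. \<bar>snd c x i - a i\<bar> < r)"
    by (rule ex_countable_cubes) blast
  \<comment> \<open>A seminorm is indexed by a cube in a chart and a word of partial
    derivatives.\<close>
  define I where "I = \<K> \<times> {is. set is \<subseteq> {..<N}}"
  have "countable {is. set is \<subseteq> {..<N}}"
    by (rule countable_subset[OF subset_UNIV]) simp
  with K(1) have cI: "countable I" by (simp add: I_def)
  have "\<exists>p\<ge>0. \<forall>y\<in>cube N a r. norm (iterated_partial is (local_rep c (h j m)) y) \<le> p"
    if "((c, a, r), is) \<in> I" for c a r "is" j m
  proof -
    have c: "c \<in> charts M" "cube N a r \<subseteq> snd c ` fst c" and isN: "set is \<subseteq> {..<N}"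
      using that K(2)[of c a r] by (simp_all add: I_def)
    have "continuous_on (snd c ` fst c) (iterated_partial is (local_rep c (h j m)))"
      using smooth_functionsD(1)[OF h c(1)] isN unfolding smooth_on_def by blast
    then have "compact (iterated_partial is (local_rep c (h j m)) ` cube N a r)"
      using c(2) by (intro compact_continuous_image compact_cube) (rule continuous_on_subset)
    then have "bounded (iterated_partial is (local_rep c (h j m)) ` cube N a r)"
      by (rule compact_imp_bounded)
    then obtain p where "p > 0" "\<forall>z\<in>iterated_partial is (local_rep c (h j m)) ` cube N a r. norm z \<le> p"
      using bounded_pos by blast
    then show ?thesis by (intro exI[of _ p]) auto
  qed
  then have "\<forall>i j m. \<exists>p. i \<in> I \<longrightarrow> p \<ge> 0 \<and>
      (\<forall>y\<in>cube N (fst (snd (fst i))) (snd (snd (fst i))). norm (iterated_partial (snd i) (local_rep (fst (fst i)) (h j m)) y) \<le> p)"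
    by (metis prod.collapse)
  then obtain p where p: "\<And>i j m. i \<in> I \<Longrightarrow> p i j m \<ge> 0"
    "\<And>i j m y. i \<in> I \<Longrightarrow> y \<in> cube N (fst (snd (fst i))) (snd (snd (fst i))) \<Longrightarrow>
       norm (iterated_partial (snd i) (local_rep (fst (fst i)) (h j m)) y) \<le> p i j m"
    by metis
  \<comment> \<open>Stage \<open>m\<close> takes care of the first \<open>m + 1\<close> seminorms
    and the first \<open>m + 1\<close> series, a finite number of bounds; each fixed pair of a
    seminorm and a series is covered from some stage on.\<close>
  define P where "P m = (\<Sum>i\<in>{i \<in> I. to_nat_on I i \<le> m}. \<Sum>j\<le>m. p i j m)" for m
  define \<epsilon> where "\<epsilon> m = (1/2) ^ m / (1 + P m)" for m
  have P: "P m \<ge> 0" for m unfolding P_def by (intro sum_nonneg) (use p(1) in auto)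
  have \<epsilon>: "\<epsilon> m > 0" for m using P[of m] by (simp add: \<epsilon>_def)
  have summ: "summable (\<lambda>m. \<epsilon> m * p i j m)" if i: "i \<in> I" for i j
  proof (rule summable_comparison_test_ev[OF _ summable_geometric[of "1/2 :: real"]])
    \<comment> \<open>Once \<open>m\<close> has passed both indices, \<open>p i j m\<close> is among
      the summands of \<open>P m\<close>; the finitely many earlier terms do not affect
      summability.\<close>
    have "norm (\<epsilon> m * p i j m) \<le> (1/2) ^ m" if m: "m \<ge> max (to_nat_on I i) j" for m
    proof -
      have fin: "finite {i \<in> I. to_nat_on I i \<le> m}"
      proof (rule inj_on_finite)
        show "inj_on (to_nat_on I) {i \<in> I. to_nat_on I i \<le> m}"
          by (rule inj_on_subset[OF inj_on_to_nat_on[OF cI]]) auto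
      qed (rule image_subsetI, auto)
      have "p i j m \<le> (\<Sum>j\<le>m. p i j m)"
        by (rule member_le_sum) (use p(1)[OF i] m in auto)
      also have "\<dots> \<le> P m"
        unfolding P_def by (rule member_le_sum[OF _ _ fin]) (use i m p(1) in \<open>auto intro: sum_nonneg\<close>)
      finally have "p i j m / (1 + P m) \<le> 1" using P[of m] by simp
      then have "(1/2) ^ m * (p i j m / (1 + P m)) \<le> (1/2) ^ m * 1"
        by (intro mult_left_mono) auto
      then show ?thesis
        using P[of m] p(1)[OF i, of j m] by (simp add: \<epsilon>_def abs_mult)
    qed
    then show "\<forall>\<^sub>F m in sequentially. norm (\<epsilon> m * p i j m) \<le> (1/2) ^ m"
      unfolding eventually_sequentially by blast
  qed simp
  let ?g = "\<lambda>j. (\<lambda>x\<in>points M. suminf (\<lambda>m. \<epsilon> m *\<^sub>R h j m x))"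
  have local: "\<exists>c\<in>charts M. x \<in> fst c \<and> (\<exists>W. openin (mtop M) W \<and> x \<in> W \<and> W \<subseteq> fst c \<and>
      smooth_on N (snd c ` W) (local_rep c (?g j))) \<and>
      (\<forall>\<alpha>. (\<lambda>m. \<epsilon> m *\<^sub>R chart_multi_partial N c \<alpha> (h j m) x) sums chart_multi_partial N c \<alpha> (?g j) x)"
    if x: "x \<in> points M" for x j
  proof -
    obtain c a r where car: "(c, a, r) \<in> \<K>" "x \<in> fst c" "\<And>i. i < N \<Longrightarrow> \<bar>snd c x i - a i\<bar> < r"
      using K(3)[OF x] by blast
    have c: "c \<in> charts M" "cube N a r \<subseteq> snd c ` fst c" using K(2)[OF car(1)] by auto
    define V where "V = {y. (\<forall>i\<ge>N. y i = 0) \<and> (\<forall>i<N. \<bar>y i - a i\<bar> < r)}"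
    have V: "openin (Euclidean_space N) V" unfolding V_def by (rule open_cube_openin)
    have V_cube: "V \<subseteq> cube N a r" by (auto simp: V_def cube_def)
    have V_sub: "V \<subseteq> snd c ` fst c" using V_cube c(2) by blast
    define W where "W = {z \<in> fst c. snd c z \<in> V}"
    have W: "openin (mtop M) W" "W \<subseteq> fst c" "snd c ` W = V"
      using topological_chart_openin_preimage[OF topological_chart[OF c(1)] V] V_sub by (auto simp: W_def)
    have "snd c x \<in> V"
      using car openin_subset[OF chart_image_openin[OF c(1)]] by (auto simp: V_def topspace_Euclidean_space)
    then have xW: "x \<in> W" using car(2) by (simp add: W_def)
    let ?F = "\<lambda>m y. \<epsilon> m *\<^sub>R local_rep c (h j m) y"
    have Fsmooth: "smooth_on N V (local_rep c (h j m))" for m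
      by (rule smooth_on_subset[OF smooth_functionsD(1)[OF h c(1)] V_sub])
    have F: "smooth_on N V (?F m)" for m
      using Fsmooth unfolding smooth_on_iff_cont_diff_on
      by (intro allI cont_diff_on_scaleR[OF V] cont_diff_on_const[OF V]) blast
    have S: "locally_summable_on N V (\<lambda>m. iterated_partial is (?F m))" if isN: "set is \<subseteq> {..<N}" for "is"
      unfolding locally_summable_on_def
    proof (intro ballI exI conjI allI)
      have i: "((c, a, r), is) \<in> I" using car(1) isN by (simp add: I_def)
      show "summable (\<lambda>m. \<epsilon> m * p ((c, a, r), is) j m)" by (rule summ[OF i])
      fix m z assume z: "z \<in> V"
      have "norm (iterated_partial is (local_rep c (h j m)) z) \<le> p ((c, a, r), is) j m"
        using p(2)[OF i, of z j m] V_cube z by auto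
      then show "norm (iterated_partial is (?F m) z) \<le> \<epsilon> m * p ((c, a, r), is) j m"
        using \<epsilon>[of m] by (simp add: iterated_partial_scaleR[OF V Fsmooth isN z] mult_left_mono)
    qed (rule V)
    have eq: "local_rep c (?g j) y = suminf (\<lambda>m. ?F m y)" if y: "y \<in> V" for y
    proof -
      obtain z where z: "z \<in> fst c" "y = snd c z" using V_sub y by blast
      then show ?thesis using chart_subset[OF c(1)] by (auto simp: local_rep_chart[OF c(1)])
    qed
    have "smooth_on N V (\<lambda>y. suminf (\<lambda>m. ?F m y))"
      by (rule smooth_on_suminf[OF V F S])
    then have "smooth_on N (snd c ` W) (local_rep c (?g j))"
      unfolding W(3)
      using smooth_on_cong[OF V, of "local_rep c (?g j)" "\<lambda>y. suminf (\<lambda>m. ?F m y)"] eq by blast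
    moreover have "(\<lambda>m. \<epsilon> m *\<^sub>R chart_multi_partial N c \<alpha> (h j m) x) sums chart_multi_partial N c \<alpha> (?g j) x" for \<alpha>
    proof -
      define js where "js = concat (map (\<lambda>i. replicate (\<alpha> i) i) [0..<N])"
      have js: "set js \<subseteq> {..<N}" by (auto simp: js_def)
      note y = \<open>snd c x \<in> V\<close>
      have "(\<lambda>m. iterated_partial js (?F m) (snd c x)) sums
          iterated_partial js (\<lambda>y. suminf (\<lambda>m. ?F m y)) (snd c x)"
        by (rule iterated_partial_suminf[OF V F S js y])
      moreover have "iterated_partial js (local_rep c (?g j)) (snd c x) =
          iterated_partial js (\<lambda>y. suminf (\<lambda>m. ?F m y)) (snd c x)"
        by (rule iterated_partial_cong[OF V eq js y])
      ultimately show ?thesis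
        unfolding chart_multi_partial_def multi_partial_eq_iterated_partial js_def[symmetric]
          iterated_partial_scaleR[OF V Fsmooth js y] by metis
    qed
    ultimately show ?thesis
      using c(1) car(2) W(1,2) xW by (intro bexI[of _ c] conjI exI[of _ W]) auto
  qed
  have "smoothly_sums (h j) (?g j) \<epsilon>" for j
    unfolding smoothly_sums_def
  proof (intro conjI ballI)
    show "?g j \<in> smooth_functions M"
    proof (rule smooth_functionsI_chart)
      fix x assume "x \<in> points M"
      from local[OF this, of j] show "\<exists>c\<in>charts M. \<exists>W. openin (mtop M) W \<and> x \<in> W \<and> W \<subseteq> fst c \<and>
          smooth_on N (snd c ` W) (local_rep c (?g j))"
        by (elim bexE conjE exE) (intro bexI exI conjI, auto)
    qed simp
    show "\<exists>c\<in>charts M. x \<in> fst c \<and> (\<forall>\<alpha>. (\<lambda>m. \<epsilon> m *\<^sub>R chart_multi_partial N c \<alpha> (h j m) x) sums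
         chart_multi_partial N c \<alpha> (?g j) x)" if "x \<in> points M" for x
      using local[OF that, of j] by (elim bexE conjE exE) (intro bexI conjI, auto)
  qed
  with \<epsilon> show ?thesis by (rule that)
qed

lemma chart_multi_partial_0:
  assumes "c \<in> charts M" "x \<in> fst c"
  shows "chart_multi_partial N c (\<lambda>i. 0) f x = (f x :: 'b::real_normed_vector)"
proof -
  have "foldr (\<lambda>i. partial i ^^ 0) xs F = F" for xs and F :: "(nat \<Rightarrow> real) \<Rightarrow> 'b"
    by (induction xs) auto
  then show ?thesis
    unfolding chart_multi_partial_def multi_partial_def using local_rep_chart[OF assms] by metis
qed

lemma smoothly_sums_sums:
  assumes "smoothly_sums h g \<epsilon>" "x \<in> points M"
  shows "(\<lambda>m. \<epsilon> m *\<^sub>R h m x) sums g x"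
proof -
  obtain c where c: "c \<in> charts M" "x \<in> fst c"
    "\<And>\<alpha>. (\<lambda>m. \<epsilon> m *\<^sub>R chart_multi_partial N c \<alpha> (h m) x) sums chart_multi_partial N c \<alpha> g x"
    using assms unfolding smoothly_sums_def by blast
  from c(3)[of "\<lambda>i. 0"] show ?thesis by (simp add: chart_multi_partial_0[OF c(1,2)])
qed

text \<open>In a chart the value at \<open>x\<close> is a finite linear combination of derivatives
  of the second argument at \<open>x\<close>, and these are summed termwise by assumption.\<close>

lemma bidifferential_sums:
  fixes C :: "('a, 'k::real_normed_field) bi_op"
  assumes C: "bidifferential_operator M C" and f: "f \<in> smooth_functions M"
    and h: "\<And>m. h m \<in> smooth_functions M" and sums: "smoothly_sums h g \<epsilon>" and x: "x \<in> points M"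
  shows "(\<lambda>m. \<epsilon> m *\<^sub>R C f (h m) x) sums C f g x"
proof -
  have g: "g \<in> smooth_functions M" using sums by (simp add: smoothly_sums_def)
  obtain c where c: "c \<in> charts M" "x \<in> fst c"
    "\<And>\<alpha>. (\<lambda>m. \<epsilon> m *\<^sub>R chart_multi_partial N c \<alpha> (h m) x) sums chart_multi_partial N c \<alpha> g x"
    using sums x unfolding smoothly_sums_def by blast
  obtain A l where A: "\<And>f h x. f \<in> smooth_functions M \<Longrightarrow> h \<in> smooth_functions M \<Longrightarrow> x \<in> fst c \<Longrightarrow>
    C f h x = expansion l A c f h x"
    by (rule bidifferential_expansion[OF C c(1)]) blast
  have "(\<lambda>m. \<Sum>\<alpha>\<in>multi_indices N l. \<Sum>\<beta>\<in>multi_indices N l.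
      A \<alpha> \<beta> x * chart_multi_partial N c \<alpha> f x * (\<epsilon> m *\<^sub>R chart_multi_partial N c \<beta> (h m) x)) sums C f g x"
    unfolding A[OF f g c(2)] by (intro sums_sum sums_mult c(3))
  then show ?thesis
    by (simp add: A[OF f h c(2)] scaleR_sum_right)
qed

subsection \<open>A common denominator\<close>

text \<open>Bumps come in pairs: \<beta> has its support inside a set \<open>E\<close> on which
  \<gamma> is 1, while \<gamma> has its support inside \<open>U\<close>. Then \<gamma> times
  \<open>q p\<close> extends by zero to the manifold and agrees with \<open>q p\<close> wherever
  \<beta> is not locally 0, so applying \<open>C l\<close> to this extension and \<beta> gives a
  global function. The weighted sum of these functions is the extension \<open>G\<close>.\<close>

lemma ex_common_denominator:
  fixes C :: "nat \<Rightarrow> ('a, 'k::{real_normed_field, banach}) bi_op" and q :: "nat \<Rightarrow> 'a \<Rightarrow> 'k"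
  assumes U: "openin (mtop M) U" and C: "\<And>l. bidifferential_operator M (C l)"
    and q: "\<And>p. q p \<in> smooth_functions (open_submanifold M U)"
  obtains g where "g \<in> smooth_functions M" "\<And>x. x \<in> U \<Longrightarrow> g x \<noteq> 0"
    "\<And>l p. \<exists>G\<in>smooth_functions M. \<forall>x\<in>U. localization M U (C l) (q p) (restrict g U) x = G x"
    "\<And>l f x. f \<in> smooth_functions M \<Longrightarrow> x \<in> points M - U \<Longrightarrow> C l f g x = 0"
proof -
  define good where "good = {(B, E, \<beta>, \<gamma>). bump E B (\<beta> :: 'a \<Rightarrow> 'k) \<and> bump U E (\<gamma> :: 'a \<Rightarrow> 'k) \<and> E \<subseteq> U}"
  have cover: "U \<subseteq> (\<Union>i\<in>good. fst i)"
  proof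
    fix x assume x: "x \<in> U"
    obtain E and \<gamma> :: "'a \<Rightarrow> 'k" where E: "bump U E \<gamma>" "x \<in> E" "E \<subseteq> U" by (rule ex_bump[OF U x])
    have "openin (mtop M) E" using E(1) by (simp add: bump_def)
    then obtain B and \<beta> :: "'a \<Rightarrow> 'k" where "bump E B \<beta>" "x \<in> B" "B \<subseteq> E" by (rule ex_bump) (use E in auto)
    then have "(B, E, \<beta>, \<gamma>) \<in> good" "x \<in> fst (B, E, \<beta>, \<gamma>)" using E by (auto simp: good_def)
    then show "x \<in> (\<Union>i\<in>good. fst i)" by blast
  qed
  have "openin (mtop M) (fst i)" if "i \<in> good" for i
    using that by (auto simp: good_def bump_def)
  from countable_subcover[OF U this cover] obtain J where J: "countable J" "J \<subseteq> good" "U \<subseteq> (\<Union>i\<in>J. fst i)"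
    by blast
  \<comment> \<open>The trivial quadruple makes the index set nonempty, even for empty
    \<open>U\<close>, so that the natural numbers enumerate it.\<close>
  define J' where "J' = insert ({}, {}, (\<lambda>x\<in>points M. 0), (\<lambda>x\<in>points M. 0)) J"
  have triv: "bump W {} (\<lambda>x\<in>points M. 0 :: 'k)" for W
    unfolding bump_def using smooth_const[of 0] by (auto intro: exI[of _ "{}"])
  have J': "countable J'" "J' \<subseteq> good" "J' \<noteq> {}"
    using J(1,2) triv by (auto simp: J'_def good_def)
  define s where "s = from_nat_into J'"
  have range_s: "range s = J'" unfolding s_def using J' by simp
  define B E \<beta> \<gamma> where "B m = fst (s m)" and "E m = fst (snd (s m))" and
    "\<beta> m = fst (snd (snd (s m)))" and "\<gamma> m = snd (snd (snd (s m)))" for m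
  have "s m \<in> good" for m using range_s J'(2) by blast
  then have b: "bump (E m) (B m) (\<beta> m)" "bump U (E m) (\<gamma> m)" "E m \<subseteq> U" for m
    unfolding good_def B_def E_def \<beta>_def \<gamma>_def by (auto simp: split_beta)
  have cov: "\<exists>m. x \<in> B m" if x: "x \<in> U" for x
  proof -
    obtain i where i: "i \<in> J" "x \<in> fst i" using J(3) x by blast
    have "i \<in> range s" unfolding range_s J'_def using i(1) by (rule insertI2)
    then obtain m where "i = s m" by (rule rangeE)
    then show ?thesis using i(2) by (auto simp: B_def)
  qed
  have \<beta>: "\<beta> m \<in> smooth_functions M" and oE: "openin (mtop M) (E m)" for m
    using b(1,2)[of m] by (simp_all add: bump_def)
  \<comment> \<open>Closedness of the support yields vanishing on a neighbourhood, which is what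
    derivatives need.\<close>
  have \<beta>_zero: "\<exists>W. openin (mtop M) W \<and> x \<in> W \<and> (\<forall>z\<in>W. \<beta> m z = 0)" if "x \<in> points M" "x \<notin> E m" for x m
  proof -
    obtain T where T: "closedin (mtop M) T" "T \<subseteq> E m" "\<And>x. x \<in> points M - T \<Longrightarrow> \<beta> m x = 0"
      using b(1)[of m] unfolding bump_def by blast
    then show ?thesis using that by (intro exI[of _ "points M - T"]) (auto simp: closedin_def)
  qed
  define Q where "Q m p = extend_by_zero U (\<gamma> m) (q p)" for m p
  have Q: "Q m p \<in> smooth_functions M" for m p
    unfolding Q_def by (rule extend_by_zero_smooth[OF U b(2) q])
  \<comment> \<open>Series 0 yields \<open>g\<close> itself, series \<open>Suc k\<close> belongs to
    the pair \<open>(l, p)\<close> coded by \<open>k\<close>; one choice of coefficients serves all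
    of them.\<close>
  define h where "h j m = (case j of 0 \<Rightarrow> \<beta> m
    | Suc k \<Rightarrow> C (fst (prod_decode k)) (Q m (snd (prod_decode k))) (\<beta> m))" for j m
  have h: "h j m \<in> smooth_functions M" for j m
    unfolding h_def by (auto split: nat.split intro!: \<beta> bidifferential_closed[OF C] Q)
  obtain \<epsilon> :: "nat \<Rightarrow> real" where \<epsilon>: "\<And>m. \<epsilon> m > 0"
    "\<And>j. smoothly_sums (h j) (\<lambda>x\<in>points M. suminf (\<lambda>m. \<epsilon> m *\<^sub>R h j m x)) \<epsilon>"
    by (rule ex_small_coefficients[where h = h]) (use h in blast)+
  define H where "H j = (\<lambda>x\<in>points M. suminf (\<lambda>m. \<epsilon> m *\<^sub>R h j m x))" for j
  let ?g = "H 0"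
  have Hs: "smoothly_sums (h j) (H j) \<epsilon>" for j unfolding H_def by (rule \<epsilon>(2))
  have H: "H j \<in> smooth_functions M" for j using Hs by (simp add: smoothly_sums_def)
  have H_sums: "(\<lambda>m. \<epsilon> m *\<^sub>R h j m x) sums H j x" if "x \<in> points M" for j x
    by (rule smoothly_sums_sums[OF Hs that])
  have "h 0 = \<beta>" by (rule ext) (simp add: h_def)
  then have C_sums: "(\<lambda>m. \<epsilon> m *\<^sub>R C l f (\<beta> m) x) sums C l f ?g x"
    if "x \<in> points M" "f \<in> smooth_functions M" for l f x
    using bidifferential_sums[OF C that(2) \<beta> _ that(1)] Hs[of 0] by simp
  show ?thesis
  proof (rule that[OF H[of 0]])
    fix x assume x: "x \<in> U"
    then have xM: "x \<in> points M" using openin_subset[OF U] by blast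
    have "\<exists>t\<ge>0. \<beta> m x = of_real t" for m using b(1)[of m] xM by (simp add: bump_def)
    then obtain t where t: "\<And>m. t m \<ge> (0::real)" "\<And>m. \<beta> m x = of_real (t m)" by metis
    obtain m where m: "x \<in> B m" using cov[OF x] by blast
    then have "\<beta> m x = 1" using b(1)[of m] by (simp add: bump_def)
    then have tm: "t m = 1" using t(2)[of m] by (metis of_real_eq_1_iff)
    have sums: "(\<lambda>m. of_real (\<epsilon> m * t m)) sums ?g x"
      using H_sums[OF xM, of 0] t(2) by (simp add: h_def scaleR_conv_of_real)
    \<comment> \<open>The bumps are nonnegative at \<open>x\<close> and one of them is 1 there, so a
      sum with positive coefficients cannot vanish.\<close>
    show "?g x \<noteq> 0"
    proof
      assume "?g x = 0"
      then have "(\<lambda>m. \<epsilon> m * t m) sums 0"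
        using sums sums_of_real_iff[of "\<lambda>m. \<epsilon> m * t m" 0, where 'a = 'k] by simp
      then have "\<epsilon> m * t m = 0"
        using suminf_eq_zero_iff[of "\<lambda>m. \<epsilon> m * t m"] \<epsilon>(1) t(1)
        by (metis less_imp_le mult_nonneg_nonneg sums_summable sums_unique)
      then show False using tm \<epsilon>(1)[of m] by simp
    qed
  next
    fix l p
    define j where "j = Suc (prod_encode (l, p))"
    have hj: "h j m = C l (Q m p) (\<beta> m)" for m by (simp add: h_def j_def)
    have "localization M U (C l) (q p) (restrict ?g U) x = H j x" if x: "x \<in> U" for x
    proof -
      have xM: "x \<in> points M" using openin_subset[OF U] x by blast
      obtain D and \<delta> :: "'a \<Rightarrow> 'k" where D: "bump U D \<delta>" "x \<in> D" "D \<subseteq> U" by (rule ex_bump[OF U x])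
      have oD: "openin (mtop M) D" using D(1) by (simp add: bump_def)
      \<comment> \<open>An extension of the germ of \<open>q p\<close> at \<open>x\<close> that is
        independent of \<open>m\<close>, so that the single operator \<open>C l q'\<close> can be
        applied termwise to the series of \<open>g\<close>.\<close>
      define q' where "q' = extend_by_zero U \<delta> (q p)"
      have q': "q' \<in> smooth_functions M" unfolding q'_def by (rule extend_by_zero_smooth[OF U D(1) q])
      have q'_eq: "q' z = q p z" if "z \<in> D" for z
        unfolding q'_def using extend_by_zero_eq[OF D(1) that] D(3) that by blast
      have "localization M U (C l) (q p) (restrict ?g U) x = C l q' ?g x"
        by (rule localization_eq[OF U C q q' restrict_smooth_functions[OF H U] H oD D(3,2)])
          (use q'_eq D(3) in auto)
      \<comment> \<open>If \<open>x\<close> is in \<open>E m\<close>, both \<open>Q m p\<close> and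
        \<open>q'\<close> coincide with \<open>q p\<close> near \<open>x\<close>; otherwise
        \<open>\<beta> m\<close> vanishes near \<open>x\<close> and both sides are 0.\<close>
      moreover have eq: "C l (Q m p) (\<beta> m) x = C l q' (\<beta> m) x" for m
      proof (cases "x \<in> E m")
        case True
        have Q_eq: "Q m p z = q p z" if "z \<in> E m" for z
          unfolding Q_def using extend_by_zero_eq[OF b(2) that] b(3) that by blast
        show ?thesis
          by (rule bidifferential_local[OF C Q q' \<beta> \<beta>, of "D \<inter> E m"])
            (use True D(2) oD oE in \<open>auto simp: Q_eq q'_eq\<close>)
      next
        case False
        from \<beta>_zero[OF xM False] obtain W where W: "openin (mtop M) W" "x \<in> W" "\<forall>z\<in>W. \<beta> m z = 0" by blast
        show ?thesis
          using bidifferential_local_zero[OF C Q \<beta> W(1,2) disjI2[OF W(3)]]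
            bidifferential_local_zero[OF C q' \<beta> W(1,2) disjI2[OF W(3)]] by simp
      qed
      moreover have "H j x = C l q' ?g x"
        by (rule sums_unique2[OF H_sums[OF xM]]) (use C_sums[OF xM q'] in \<open>simp add: hj eq\<close>)
      ultimately show ?thesis by simp
    qed
    then show "\<exists>G\<in>smooth_functions M. \<forall>x\<in>U. localization M U (C l) (q p) (restrict ?g U) x = G x"
      using H by blast
  next
    fix l and f :: "'a \<Rightarrow> 'k" and x assume f: "f \<in> smooth_functions M" and x: "x \<in> points M - U"
    \<comment> \<open>Every single bump vanishes near \<open>x\<close>, though the sum
      \<open>g\<close> need not; termwise application of \<open>C l f\<close> still gives 0 at
      \<open>x\<close>.\<close>
    have "C l f (\<beta> m) x = 0" for m
    proof -
      have "x \<in> points M" "x \<notin> E m" using x b(3)[of m] by auto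
      from \<beta>_zero[OF this] obtain W where W: "openin (mtop M) W" "x \<in> W" "\<forall>z\<in>W. \<beta> m z = 0" by blast
      show ?thesis by (rule bidifferential_local_zero[OF C f \<beta> W(1,2) disjI2[OF W(3)]])
    qed
    then have "(\<lambda>m. 0) sums C l f ?g x" using C_sums[of x f l] f x by simp
    then show "C l f ?g x = 0" using sums_unique2 sums_zero by blast
  qed
qed

end

section \<open>Algebras of fractions\<close>

lemma unital_algebraI:
  fixes A (structure)
  assumes "cring K"
    and "\<And>x y. \<lbrakk>x \<in> carrier A; y \<in> carrier A\<rbrakk> \<Longrightarrow> x \<oplus> y \<in> carrier A"
    and "\<zero> \<in> carrier A"
    and "\<And>x y z. \<lbrakk>x \<in> carrier A; y \<in> carrier A; z \<in> carrier A\<rbrakk> \<Longrightarrow> (x \<oplus> y) \<oplus> z = x \<oplus> (y \<oplus> z)"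
    and "\<And>x y. \<lbrakk>x \<in> carrier A; y \<in> carrier A\<rbrakk> \<Longrightarrow> x \<oplus> y = y \<oplus> x"
    and "\<And>x. x \<in> carrier A \<Longrightarrow> \<zero> \<oplus> x = x"
    and "\<And>x. x \<in> carrier A \<Longrightarrow> \<exists>y\<in>carrier A. y \<oplus> x = \<zero>"
    and "\<And>x y. \<lbrakk>x \<in> carrier A; y \<in> carrier A\<rbrakk> \<Longrightarrow> x \<otimes> y \<in> carrier A"
    and "\<one> \<in> carrier A"
    and "\<And>x y z. \<lbrakk>x \<in> carrier A; y \<in> carrier A; z \<in> carrier A\<rbrakk> \<Longrightarrow> (x \<otimes> y) \<otimes> z = x \<otimes> (y \<otimes> z)"
    and "\<And>x. x \<in> carrier A \<Longrightarrow> \<one> \<otimes> x = x"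
    and "\<And>x. x \<in> carrier A \<Longrightarrow> x \<otimes> \<one> = x"
    and "\<And>x y z. \<lbrakk>x \<in> carrier A; y \<in> carrier A; z \<in> carrier A\<rbrakk> \<Longrightarrow> (x \<oplus> y) \<otimes> z = x \<otimes> z \<oplus> y \<otimes> z"
    and "\<And>x y z. \<lbrakk>x \<in> carrier A; y \<in> carrier A; z \<in> carrier A\<rbrakk> \<Longrightarrow> z \<otimes> (x \<oplus> y) = z \<otimes> x \<oplus> z \<otimes> y"
    and "\<And>a x. \<lbrakk>a \<in> carrier K; x \<in> carrier A\<rbrakk> \<Longrightarrow> a \<odot> x \<in> carrier A"
    and "\<And>a b x. \<lbrakk>a \<in> carrier K; b \<in> carrier K; x \<in> carrier A\<rbrakk> \<Longrightarrow> (a \<oplus>\<^bsub>K\<^esub> b) \<odot> x = a \<odot> x \<oplus> b \<odot> x"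
    and "\<And>a x y. \<lbrakk>a \<in> carrier K; x \<in> carrier A; y \<in> carrier A\<rbrakk> \<Longrightarrow> a \<odot> (x \<oplus> y) = a \<odot> x \<oplus> a \<odot> y"
    and "\<And>a b x. \<lbrakk>a \<in> carrier K; b \<in> carrier K; x \<in> carrier A\<rbrakk> \<Longrightarrow> (a \<otimes>\<^bsub>K\<^esub> b) \<odot> x = a \<odot> (b \<odot> x)"
    and "\<And>x. x \<in> carrier A \<Longrightarrow> \<one>\<^bsub>K\<^esub> \<odot> x = x"
    and "\<And>a x y. \<lbrakk>a \<in> carrier K; x \<in> carrier A; y \<in> carrier A\<rbrakk> \<Longrightarrow> (a \<odot> x) \<otimes> y = a \<odot> (x \<otimes> y)"
    and "\<And>a x y. \<lbrakk>a \<in> carrier K; x \<in> carrier A; y \<in> carrier A\<rbrakk> \<Longrightarrow> x \<otimes> (a \<odot> y) = a \<odot> (x \<otimes> y)"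
  shows "unital_algebra K A"
proof -
  have ab: "abelian_group A" by (rule abelian_groupI) (use assms in auto)
  have mon: "monoid A" by (rule monoidI) (use assms in auto)
  have "ring A" by (rule ringI[OF ab mon]) (use assms in auto)
  moreover have "Module.module K A" by (rule moduleI[OF assms(1) ab]) (use assms in auto)
  moreover have "unital_algebra_axioms K A" by unfold_locales (use assms in auto)
  ultimately show ?thesis using unital_algebra.intro by blast
qed

text \<open>The algebra axioms for \<open>A\<close> are inherited through \<open>g\<close>. For the
  localization it is therefore enough to compare the operations with those of a known
  algebra.\<close>

lemma unital_algebra_image:
  assumes B: "unital_algebra K B" and inj: "inj_on g (carrier B)" and carrier: "carrier A = g ` carrier B"
    and add: "\<And>x y. \<lbrakk>x \<in> carrier B; y \<in> carrier B\<rbrakk> \<Longrightarrow> g x \<oplus>\<^bsub>A\<^esub> g y = g (x \<oplus>\<^bsub>B\<^esub> y)"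
    and mult: "\<And>x y. \<lbrakk>x \<in> carrier B; y \<in> carrier B\<rbrakk> \<Longrightarrow> g x \<otimes>\<^bsub>A\<^esub> g y = g (x \<otimes>\<^bsub>B\<^esub> y)"
    and smult: "\<And>a x. \<lbrakk>a \<in> carrier K; x \<in> carrier B\<rbrakk> \<Longrightarrow> a \<odot>\<^bsub>A\<^esub> g x = g (a \<odot>\<^bsub>B\<^esub> x)"
    and one: "\<one>\<^bsub>A\<^esub> = g \<one>\<^bsub>B\<^esub>" and zero: "\<zero>\<^bsub>A\<^esub> = g \<zero>\<^bsub>B\<^esub>"
  shows "algebra_isomorphic K A B"
proof -
  interpret B: unital_algebra K B by (rule B)
  have A: "unital_algebra K A"
  proof (rule unital_algebraI)
    fix x assume "x \<in> carrier A"
    then obtain b where b: "x = g b" "b \<in> carrier B" by (auto simp: carrier)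
    then have "g (\<ominus>\<^bsub>B\<^esub> b) \<in> carrier A" "g (\<ominus>\<^bsub>B\<^esub> b) \<oplus>\<^bsub>A\<^esub> x = \<zero>\<^bsub>A\<^esub>"
      by (simp_all add: carrier add zero B.l_neg)
    then show "\<exists>y\<in>carrier A. y \<oplus>\<^bsub>A\<^esub> x = \<zero>\<^bsub>A\<^esub>" by blast
    show "x \<oplus>\<^bsub>A\<^esub> y = y \<oplus>\<^bsub>A\<^esub> x" if y: "y \<in> carrier A" for y
    proof -
      obtain c where c: "y = g c" "c \<in> carrier B" using y by (auto simp: carrier)
      show ?thesis unfolding b(1) c(1) add[OF b(2) c(2)] add[OF c(2) b(2)] B.a_comm[OF b(2) c(2)] ..
    qed
  qed (auto simp: carrier add mult smult one zero B.R.is_cring B.a_assoc B.m_assoc B.l_distr B.r_distr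
      B.smult_l_distr B.smult_r_distr B.smult_assoc1 B.smult_mult_left B.smult_mult_right)
  let ?h = "inv_into (carrier B) g"
  have h: "?h (g x) = x" if "x \<in> carrier B" for x
    using inj that by simp
  have "?h \<in> algebra_hom K A B"
    unfolding algebra_hom_def ring_hom_def by (auto simp: carrier add mult smult one h)
  moreover have "bij_betw ?h (carrier A) (carrier B)"
    unfolding carrier using inj by (intro bij_betw_inv_into) (simp add: bij_betw_def)
  ultimately show ?thesis
    using A B unfolding algebra_isomorphic_def by blast
qed

section \<open>Consequences of the axioms of right fractions\<close>

locale algebra_of_fractions =
  fixes K :: "'c ring" and R :: "('c, 'r) module" (structure) and S :: "'r set" and Q :: "('c, 'q) module" and \<eta> :: "'r \<Rightarrow> 'q"
  assumes fractions: "right_algebra_of_fractions K R S Q \<eta>"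
begin

sublocale R: unital_algebra K R
  using fractions unfolding right_algebra_of_fractions_def by blast

sublocale Q: unital_algebra K Q
  using fractions unfolding right_algebra_of_fractions_def by blast

sublocale S: submonoid S R
  using fractions unfolding right_algebra_of_fractions_def by blast

lemma S_carrier [simp, intro]: "s \<in> S \<Longrightarrow> s \<in> carrier R"
  using S.subset by blast

lemma \<eta>_hom: "\<eta> \<in> ring_hom R Q"
  using fractions unfolding right_algebra_of_fractions_def algebra_hom_def by blast

lemma
  shows \<eta>_closed [simp, intro]: "x \<in> carrier R \<Longrightarrow> \<eta> x \<in> carrier Q"
    and \<eta>_mult: "x \<in> carrier R \<Longrightarrow> y \<in> carrier R \<Longrightarrow> \<eta> (x \<otimes> y) = \<eta> x \<otimes>\<^bsub>Q\<^esub> \<eta> y"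
    and \<eta>_add: "x \<in> carrier R \<Longrightarrow> y \<in> carrier R \<Longrightarrow> \<eta> (x \<oplus> y) = \<eta> x \<oplus>\<^bsub>Q\<^esub> \<eta> y"
    and \<eta>_one: "\<eta> \<one> = \<one>\<^bsub>Q\<^esub>"
    and \<eta>_zero: "\<eta> \<zero> = \<zero>\<^bsub>Q\<^esub>"
  using \<eta>_hom ring_hom_zero[OF \<eta>_hom R.ring_axioms Q.ring_axioms]
  by (auto simp: ring_hom_def)

lemma \<eta>_smult: "a \<in> carrier K \<Longrightarrow> x \<in> carrier R \<Longrightarrow> \<eta> (a \<odot> x) = a \<odot>\<^bsub>Q\<^esub> \<eta> x"
  using fractions unfolding right_algebra_of_fractions_def algebra_hom_def by blast

lemma \<eta>_Units: "s \<in> S \<Longrightarrow> \<eta> s \<in> Units Q"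
  using fractions unfolding right_algebra_of_fractions_def by blast

lemma unit_r_cancel:
  assumes "u \<in> Units Q" "x \<in> carrier Q" "y \<in> carrier Q" "x \<otimes>\<^bsub>Q\<^esub> u = y \<otimes>\<^bsub>Q\<^esub> u"
  shows "x = y"
proof -
  have "(x \<otimes>\<^bsub>Q\<^esub> u) \<otimes>\<^bsub>Q\<^esub> inv\<^bsub>Q\<^esub> u = (y \<otimes>\<^bsub>Q\<^esub> u) \<otimes>\<^bsub>Q\<^esub> inv\<^bsub>Q\<^esub> u" using assms(4) by simp
  then show ?thesis using assms(1-3) by (simp add: Q.m_assoc Q.Units_closed)
qed

lemma ex_fraction:
  assumes "q \<in> carrier Q"
  obtains r s where "r \<in> carrier R" "s \<in> S" "\<eta> r = q \<otimes>\<^bsub>Q\<^esub> \<eta> s"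
proof -
  obtain r s where rs: "r \<in> carrier R" "s \<in> S" "q = \<eta> r \<otimes>\<^bsub>Q\<^esub> inv\<^bsub>Q\<^esub> (\<eta> s)"
    using fractions assms unfolding right_algebra_of_fractions_def by blast
  then have "\<eta> r = q \<otimes>\<^bsub>Q\<^esub> \<eta> s"
    using \<eta>_Units[OF rs(2)] by (simp add: Q.m_assoc)
  then show ?thesis using rs that by blast
qed

lemma \<eta>_eq_zeroD:
  assumes "r \<in> carrier R" "\<eta> r = \<zero>\<^bsub>Q\<^esub>"
  obtains s where "s \<in> S" "r \<otimes> s = \<zero>"
proof -
  have "r \<in> a_kernel R Q \<eta>" using assms by (simp add: a_kernel_def')
  then show ?thesis
    using fractions that unfolding right_algebra_of_fractions_def by blast
qed

text \<open>The kernel condition for the difference turns an equality in \<open>Q\<close> into one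
  in \<open>R\<close>, at the price of a right factor from \<open>S\<close>.\<close>

lemma \<eta>_eqD:
  assumes "a \<in> carrier R" "b \<in> carrier R" "\<eta> a = \<eta> b"
  obtains t where "t \<in> S" "a \<otimes> t = b \<otimes> t"
proof -
  have "\<eta> (a \<ominus> b) \<oplus>\<^bsub>Q\<^esub> \<eta> b = \<eta> a"
    using assms(1,2) by (simp add: \<eta>_add[symmetric] R.minus_eq R.a_assoc R.l_neg)
  then have "\<eta> (a \<ominus> b) \<oplus>\<^bsub>Q\<^esub> \<eta> b = \<zero>\<^bsub>Q\<^esub> \<oplus>\<^bsub>Q\<^esub> \<eta> b"
    using assms by simp
  then have "\<eta> (a \<ominus> b) = \<zero>\<^bsub>Q\<^esub>"
    using assms(1,2) by (simp only: Q.add.r_cancel \<eta>_closed R.minus_closed Q.zero_closed)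
  then obtain t where t: "t \<in> S" "(a \<ominus> b) \<otimes> t = \<zero>"
    using \<eta>_eq_zeroD[of "a \<ominus> b"] assms(1,2) by blast
  have "a \<otimes> t = ((a \<ominus> b) \<oplus> b) \<otimes> t"
    using assms(1,2) by (simp add: R.minus_eq R.a_assoc R.l_neg)
  also have "\<dots> = b \<otimes> t"
    using assms(1,2) t by (simp add: R.l_distr)
  finally show ?thesis using t(1) that by blast
qed

text \<open>The left fraction s^-1 r, formed in \<open>Q\<close>, is also a right fraction r' s'^-1.
  Clearing denominators gives the Ore relation in \<open>Q\<close>, and a further factor
  \<open>t\<close> from \<open>S\<close> lifts it to \<open>R\<close>.\<close>

lemma right_Ore:
  assumes r: "r \<in> carrier R" and s: "s \<in> S"
  obtains r' s' where "r' \<in> carrier R" "s' \<in> S" "r \<otimes> s' = s \<otimes> r'"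
proof -
  have u: "\<eta> s \<in> Units Q" by (rule \<eta>_Units[OF s])
  then have i: "inv\<^bsub>Q\<^esub> (\<eta> s) \<in> carrier Q" by simp
  obtain r' s' where rs: "r' \<in> carrier R" "s' \<in> S" "\<eta> r' = (inv\<^bsub>Q\<^esub> (\<eta> s) \<otimes>\<^bsub>Q\<^esub> \<eta> r) \<otimes>\<^bsub>Q\<^esub> \<eta> s'"
    by (rule ex_fraction[of "inv\<^bsub>Q\<^esub> (\<eta> s) \<otimes>\<^bsub>Q\<^esub> \<eta> r"]) (use i r in auto)
  have "\<eta> (s \<otimes> r') = (\<eta> s \<otimes>\<^bsub>Q\<^esub> inv\<^bsub>Q\<^esub> (\<eta> s)) \<otimes>\<^bsub>Q\<^esub> (\<eta> r \<otimes>\<^bsub>Q\<^esub> \<eta> s')"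
    using rs r s i by (simp add: \<eta>_mult Q.m_assoc del: Q.Units_r_inv)
  also have "\<dots> = \<eta> (r \<otimes> s')"
    using u r rs(2) by (simp add: \<eta>_mult)
  finally obtain t where t: "t \<in> S" "(s \<otimes> r') \<otimes> t = (r \<otimes> s') \<otimes> t"
    using \<eta>_eqD[of "s \<otimes> r'" "r \<otimes> s'"] r s rs by blast
  show ?thesis
    by (rule that[of "r' \<otimes> t" "s' \<otimes> t"]) (use t r s rs in \<open>auto simp: R.m_assoc\<close>)
qed

lemma right_denominator_set: "right_denominator_set R S"
  unfolding right_denominator_set_def
proof (intro conjI ballI impI)
  show "submonoid S R" by (rule S.submonoid_axioms)
  show "\<exists>r'\<in>carrier R. \<exists>s'\<in>S. r \<otimes> s' = s \<otimes> r'" if "r \<in> carrier R" "s \<in> S" for r s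
    using right_Ore[OF that] by metis
  fix r s' assume r: "r \<in> carrier R" and s': "s' \<in> S" and eq: "s' \<otimes> r = \<zero>"
  have u: "\<eta> s' \<in> Units Q" by (rule \<eta>_Units[OF s'])
  have "\<eta> s' \<otimes>\<^bsub>Q\<^esub> \<eta> r = \<zero>\<^bsub>Q\<^esub>"
    using eq r s' \<eta>_zero by (simp add: \<eta>_mult[symmetric])
  then have "(inv\<^bsub>Q\<^esub> (\<eta> s') \<otimes>\<^bsub>Q\<^esub> \<eta> s') \<otimes>\<^bsub>Q\<^esub> \<eta> r = \<zero>\<^bsub>Q\<^esub>"
    using u r s' by (simp add: Q.m_assoc del: Q.Units_l_inv)
  then have "\<eta> r = \<zero>\<^bsub>Q\<^esub>" using u r by simp
  then show "\<exists>s\<in>S. r \<otimes> s = \<zero>" using \<eta>_eq_zeroD[OF r] by metis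
qed

text \<open>All ways of writing \<open>q\<close> as r s^-1, expressed without inverses. These sets
  turn out to be the classes of \<open>fraction_rel\<close>.\<close>

definition representations :: "'q \<Rightarrow> ('r \<times> 'r) set" where
  "representations q = {(r, s). r \<in> carrier R \<and> s \<in> S \<and> \<eta> r = q \<otimes>\<^bsub>Q\<^esub> \<eta> s}"

lemma mem_representations:
  "(r, s) \<in> representations q \<longleftrightarrow> r \<in> carrier R \<and> s \<in> S \<and> \<eta> r = q \<otimes>\<^bsub>Q\<^esub> \<eta> s"
  by (simp add: representations_def)

lemma ex_representation: "q \<in> carrier Q \<Longrightarrow> \<exists>r s. (r, s) \<in> representations q"
  using ex_fraction unfolding mem_representations by metis

lemma inj_on_representations: "inj_on representations (carrier Q)"
proof (rule inj_onI)
  fix q q' assume q: "q \<in> carrier Q" "q' \<in> carrier Q" "representations q = representations q'"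
  obtain r s where rs: "(r, s) \<in> representations q" using ex_representation[OF q(1)] by blast
  moreover have "(r, s) \<in> representations q'" using rs q(3) by simp
  ultimately have "s \<in> S" "q \<otimes>\<^bsub>Q\<^esub> \<eta> s = q' \<otimes>\<^bsub>Q\<^esub> \<eta> s"
    unfolding mem_representations by metis+
  then show "q = q'" using unit_r_cancel[OF \<eta>_Units] q by blast
qed

text \<open>Two pairs are related exactly when they have the same value in \<open>Q\<close>.
  Independence of representatives thus reduces to calculations in \<open>Q\<close>.\<close>

lemma fraction_rel_iff:
  assumes q: "q \<in> carrier Q" and rs: "(r, s) \<in> representations q"
  shows "((r, s), (r', s')) \<in> fraction_rel R S \<longleftrightarrow> (r', s') \<in> representations q"
proof
  have r: "r \<in> carrier R" "s \<in> S" "\<eta> r = q \<otimes>\<^bsub>Q\<^esub> \<eta> s" using rs by (auto simp: mem_representations)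
  assume "((r, s), (r', s')) \<in> fraction_rel R S"
  then obtain b b' where b: "b \<in> carrier R" "b' \<in> carrier R" "s \<otimes> b = s' \<otimes> b'" "s \<otimes> b \<in> S"
    "r \<otimes> b = r' \<otimes> b'" and r': "r' \<in> carrier R" "s' \<in> S"
    unfolding fraction_rel_def by blast
  have u: "\<eta> s' \<in> Units Q" by (rule \<eta>_Units[OF r'(2)])
  \<comment> \<open>\<open>b'\<close> need not lie in \<open>S\<close>, but its image is invertible
    because \<open>\<eta> s'\<close> and its product with \<open>\<eta> b'\<close> are; this permits
    cancellation on the right.\<close>
  have "\<eta> s' \<otimes>\<^bsub>Q\<^esub> \<eta> b' \<in> Units Q"
    using \<eta>_Units[OF b(4)] b r' by (simp add: \<eta>_mult)
  then have "inv\<^bsub>Q\<^esub> (\<eta> s') \<otimes>\<^bsub>Q\<^esub> (\<eta> s' \<otimes>\<^bsub>Q\<^esub> \<eta> b') \<in> Units Q"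
    by (rule Q.Units_m_closed[OF Q.Units_inv_Units[OF u]])
  moreover have eq: "inv\<^bsub>Q\<^esub> (\<eta> s') \<otimes>\<^bsub>Q\<^esub> (\<eta> s' \<otimes>\<^bsub>Q\<^esub> \<eta> b') = \<eta> b'"
    using u b r' by (simp add: Q.m_assoc[symmetric])
  ultimately have ub: "\<eta> b' \<in> Units Q" by (simp only: eq)
  have "\<eta> r' \<otimes>\<^bsub>Q\<^esub> \<eta> b' = \<eta> (r \<otimes> b)" using b r' by (simp add: \<eta>_mult)
  also have "\<dots> = q \<otimes>\<^bsub>Q\<^esub> \<eta> (s \<otimes> b)" using b(1) r q by (simp add: \<eta>_mult Q.m_assoc)
  also have "\<dots> = (q \<otimes>\<^bsub>Q\<^esub> \<eta> s') \<otimes>\<^bsub>Q\<^esub> \<eta> b'" using b(2,3) r' q by (simp add: \<eta>_mult Q.m_assoc)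
  finally have "\<eta> r' = q \<otimes>\<^bsub>Q\<^esub> \<eta> s'"
    by (rule unit_r_cancel[OF ub, rotated 2]) (use r' q in auto)
  then show "(r', s') \<in> representations q" using r' by (simp add: mem_representations)
next
  have r: "r \<in> carrier R" "s \<in> S" "\<eta> r = q \<otimes>\<^bsub>Q\<^esub> \<eta> s" using rs by (auto simp: mem_representations)
  assume "(r', s') \<in> representations q"
  then have r': "r' \<in> carrier R" "s' \<in> S" "\<eta> r' = q \<otimes>\<^bsub>Q\<^esub> \<eta> s'" by (auto simp: mem_representations)
  obtain c' c where c: "c' \<in> carrier R" "c \<in> S" "s \<otimes> c = s' \<otimes> c'"
    by (rule right_Ore[of s s']) (use r r' in auto)
  have "\<eta> (r \<otimes> c) = q \<otimes>\<^bsub>Q\<^esub> \<eta> (s \<otimes> c)" using r c(2) q by (simp add: \<eta>_mult Q.m_assoc)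
  also have "\<dots> = \<eta> (r' \<otimes> c')" using r' c(1,3) q by (simp add: \<eta>_mult Q.m_assoc)
  \<comment> \<open>The numerators agree at first only in \<open>Q\<close>; the additional factor
    \<open>t\<close> makes them agree in \<open>R\<close>.\<close>
  finally obtain t where t: "t \<in> S" "(r \<otimes> c) \<otimes> t = (r' \<otimes> c') \<otimes> t"
    using \<eta>_eqD[of "r \<otimes> c" "r' \<otimes> c'"] r r' c by blast
  have "s \<otimes> (c \<otimes> t) = (s' \<otimes> c') \<otimes> t"
    using r r' c t by (simp add: R.m_assoc[symmetric])
  also have "\<dots> = s' \<otimes> (c' \<otimes> t)"
    using r r' c t by (simp add: R.m_assoc)
  finally have "s \<otimes> (c \<otimes> t) = s' \<otimes> (c' \<otimes> t)" .
  moreover have "r \<otimes> (c \<otimes> t) = r' \<otimes> (c' \<otimes> t)"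
    using r r' c t by (simp add: R.m_assoc)
  moreover have "s \<otimes> (c \<otimes> t) \<in> S" using r c t by simp
  ultimately have "\<exists>b\<in>carrier R. \<exists>b'\<in>carrier R.
      s \<otimes> b = s' \<otimes> b' \<and> s \<otimes> b \<in> S \<and> r \<otimes> b = r' \<otimes> b'"
    using c t by (rule_tac bexI[of _ "c \<otimes> t"], rule_tac bexI[of _ "c' \<otimes> t"]) auto
  then show "((r, s), (r', s')) \<in> fraction_rel R S"
    using r r' unfolding fraction_rel_def by blast
qed

lemma fraction_eq_representations:
  assumes "q \<in> carrier Q" "(r, s) \<in> representations q"
  shows "fraction R S r s = representations q"
  unfolding fraction_def using fraction_rel_iff[OF assms] by auto

lemma ex_value:
  assumes "r \<in> carrier R" "s \<in> S"
  shows "\<exists>q\<in>carrier Q. (r, s) \<in> representations q"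
proof
  have u: "\<eta> s \<in> Units Q" by (rule \<eta>_Units[OF assms(2)])
  then show "\<eta> r \<otimes>\<^bsub>Q\<^esub> inv\<^bsub>Q\<^esub> (\<eta> s) \<in> carrier Q" using assms by simp
  show "(r, s) \<in> representations (\<eta> r \<otimes>\<^bsub>Q\<^esub> inv\<^bsub>Q\<^esub> (\<eta> s))"
    using u assms by (simp add: mem_representations Q.m_assoc)
qed

lemma carrier_right_localization: "carrier (right_localization R S) = representations ` carrier Q"
proof (intro equalityI subsetI)
  fix p assume "p \<in> carrier (right_localization R S)"
  then obtain r s where rs: "r \<in> carrier R" "s \<in> S" "p = fraction R S r s"
    unfolding right_localization_def fraction_def by (auto elim!: quotientE)
  then show "p \<in> representations ` carrier Q"
    using ex_value[OF rs(1,2)] fraction_eq_representations by blast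
next
  fix p assume "p \<in> representations ` carrier Q"
  then obtain q where q: "q \<in> carrier Q" "p = representations q" by blast
  obtain r s where rs: "(r, s) \<in> representations q" using ex_representation[OF q(1)] by blast
  then have "p = fraction_rel R S `` {(r, s)}"
    using fraction_eq_representations[OF q(1) rs] q(2) by (simp add: fraction_def)
  then show "p \<in> carrier (right_localization R S)"
    using rs unfolding right_localization_def by (auto simp: mem_representations intro: quotientI)
qed

text \<open>For every admissible choice, \<eta> maps \<open>r\<^sub>1 \<otimes> r'\<close> to
  \<open>x\<close> times the image of
  \<open>s\<^sub>1 \<otimes> r' = r\<^sub>2 \<otimes> s'\<close>, that is to
  \<open>x \<otimes> y\<close> times the image of \<open>s\<^sub>2 \<otimes> s'\<close>. So all
  choices give one class, and the Ore condition provides at least one choice; this resolves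
  \<open>THE\<close>.\<close>

lemma right_localization_mult:
  assumes x: "x \<in> carrier Q" and y: "y \<in> carrier Q"
  shows "representations x \<otimes>\<^bsub>right_localization R S\<^esub> representations y = representations (x \<otimes>\<^bsub>Q\<^esub> y)"
proof -
  have val: "fraction R S (r\<^sub>1 \<otimes> r') (s\<^sub>2 \<otimes> s') = representations (x \<otimes>\<^bsub>Q\<^esub> y)"
    if *: "(r\<^sub>1, s\<^sub>1) \<in> representations x" "(r\<^sub>2, s\<^sub>2) \<in> representations y" "r' \<in> carrier R" "s' \<in> S"
      "r\<^sub>2 \<otimes> s' = s\<^sub>1 \<otimes> r'" for r\<^sub>1 s\<^sub>1 r\<^sub>2 s\<^sub>2 r' s'
  proof (rule fraction_eq_representations)
    have a: "r\<^sub>1 \<in> carrier R" "s\<^sub>1 \<in> S" "\<eta> r\<^sub>1 = x \<otimes>\<^bsub>Q\<^esub> \<eta> s\<^sub>1"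
      "r\<^sub>2 \<in> carrier R" "s\<^sub>2 \<in> S" "\<eta> r\<^sub>2 = y \<otimes>\<^bsub>Q\<^esub> \<eta> s\<^sub>2"
      using * by (auto simp: mem_representations)
    have "\<eta> (r\<^sub>1 \<otimes> r') = x \<otimes>\<^bsub>Q\<^esub> \<eta> (s\<^sub>1 \<otimes> r')" using a *(3) x by (simp add: \<eta>_mult Q.m_assoc)
    also have "\<dots> = x \<otimes>\<^bsub>Q\<^esub> (\<eta> r\<^sub>2 \<otimes>\<^bsub>Q\<^esub> \<eta> s')" using a(4) *(4,5) by (simp add: \<eta>_mult[symmetric])
    also have "\<dots> = (x \<otimes>\<^bsub>Q\<^esub> y) \<otimes>\<^bsub>Q\<^esub> \<eta> (s\<^sub>2 \<otimes> s')" using a *(4) x y by (simp add: \<eta>_mult Q.m_assoc)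
    finally show "(r\<^sub>1 \<otimes> r', s\<^sub>2 \<otimes> s') \<in> representations (x \<otimes>\<^bsub>Q\<^esub> y)"
      using a *(3,4) by (simp add: mem_representations)
  qed (use x y in simp)
  obtain r\<^sub>1 s\<^sub>1 where r1: "(r\<^sub>1, s\<^sub>1) \<in> representations x" using ex_representation[OF x] by blast
  obtain r\<^sub>2 s\<^sub>2 where r2: "(r\<^sub>2, s\<^sub>2) \<in> representations y" using ex_representation[OF y] by blast
  obtain r' s' where 3: "r' \<in> carrier R" "s' \<in> S" "r\<^sub>2 \<otimes> s' = s\<^sub>1 \<otimes> r'"
    by (rule right_Ore[of r\<^sub>2 s\<^sub>1]) (use r1 r2 in \<open>auto simp: mem_representations\<close>)
  show ?thesis
    unfolding right_localization_def monoid.simps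
  proof (rule the_equality, goal_cases)
    case 1
    show ?case using r1 r2 3 val[OF r1 r2 3] by metis
  next
    case 2
    then show ?case by - (elim exE conjE, hypsubst, rule val)
  qed
qed

lemma right_localization_add:
  assumes x: "x \<in> carrier Q" and y: "y \<in> carrier Q"
  shows "representations x \<oplus>\<^bsub>right_localization R S\<^esub> representations y = representations (x \<oplus>\<^bsub>Q\<^esub> y)"
proof -
  have val: "fraction R S (r\<^sub>1 \<otimes> c\<^sub>1 \<oplus> r\<^sub>2 \<otimes> c\<^sub>2) (s\<^sub>1 \<otimes> c\<^sub>1) = representations (x \<oplus>\<^bsub>Q\<^esub> y)"
    if *: "(r\<^sub>1, s\<^sub>1) \<in> representations x" "(r\<^sub>2, s\<^sub>2) \<in> representations y" "c\<^sub>1 \<in> S" "c\<^sub>2 \<in> carrier R"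
      "s\<^sub>1 \<otimes> c\<^sub>1 = s\<^sub>2 \<otimes> c\<^sub>2" for r\<^sub>1 s\<^sub>1 r\<^sub>2 s\<^sub>2 c\<^sub>1 c\<^sub>2
  proof (rule fraction_eq_representations)
    have a: "r\<^sub>1 \<in> carrier R" "s\<^sub>1 \<in> S" "\<eta> r\<^sub>1 = x \<otimes>\<^bsub>Q\<^esub> \<eta> s\<^sub>1"
      "r\<^sub>2 \<in> carrier R" "s\<^sub>2 \<in> S" "\<eta> r\<^sub>2 = y \<otimes>\<^bsub>Q\<^esub> \<eta> s\<^sub>2"
      using * by (auto simp: mem_representations)
    have "\<eta> (r\<^sub>1 \<otimes> c\<^sub>1) = x \<otimes>\<^bsub>Q\<^esub> \<eta> (s\<^sub>1 \<otimes> c\<^sub>1)" using a *(3) x by (simp add: \<eta>_mult Q.m_assoc)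
    moreover have "\<eta> (r\<^sub>2 \<otimes> c\<^sub>2) = y \<otimes>\<^bsub>Q\<^esub> \<eta> (s\<^sub>1 \<otimes> c\<^sub>1)" using a *(4,5) y by (simp add: \<eta>_mult Q.m_assoc)
    ultimately show "(r\<^sub>1 \<otimes> c\<^sub>1 \<oplus> r\<^sub>2 \<otimes> c\<^sub>2, s\<^sub>1 \<otimes> c\<^sub>1) \<in> representations (x \<oplus>\<^bsub>Q\<^esub> y)"
      using a *(3,4) x y by (simp add: mem_representations \<eta>_add Q.l_distr)
  qed (use x y in simp)
  obtain r\<^sub>1 s\<^sub>1 where r1: "(r\<^sub>1, s\<^sub>1) \<in> representations x" using ex_representation[OF x] by blast
  obtain r\<^sub>2 s\<^sub>2 where r2: "(r\<^sub>2, s\<^sub>2) \<in> representations y" using ex_representation[OF y] by blast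
  obtain c\<^sub>2 c\<^sub>1 where 3: "c\<^sub>2 \<in> carrier R" "c\<^sub>1 \<in> S" "s\<^sub>1 \<otimes> c\<^sub>1 = s\<^sub>2 \<otimes> c\<^sub>2"
    by (rule right_Ore[of s\<^sub>1 s\<^sub>2]) (use r1 r2 in \<open>auto simp: mem_representations\<close>)
  have 4: "s\<^sub>1 \<otimes> c\<^sub>1 \<in> S" using r1 3(2) by (simp add: mem_representations)
  show ?thesis
    unfolding right_localization_def ring.simps
  proof (rule the_equality, goal_cases)
    case 1
    show ?case using r1 r2 3 4 val[OF r1 r2 3(2,1,3)] by metis
  next
    case 2
    then show ?case by - (elim exE conjE, hypsubst, rule val)
  qed
qed

lemma right_localization_smult:
  assumes a: "a \<in> carrier K" and x: "x \<in> carrier Q"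
  shows "a \<odot>\<^bsub>right_localization R S\<^esub> representations x = representations (a \<odot>\<^bsub>Q\<^esub> x)"
proof -
  have val: "fraction R S (a \<odot> r) s = representations (a \<odot>\<^bsub>Q\<^esub> x)"
    if "(r, s) \<in> representations x" for r s
    by (rule fraction_eq_representations)
      (use that a x in \<open>auto simp: mem_representations \<eta>_smult Q.smult_mult_left\<close>)
  obtain r s where rs: "(r, s) \<in> representations x" using ex_representation[OF x] by blast
  show ?thesis
    unfolding right_localization_def module.simps
  proof (rule the_equality, goal_cases)
    case 1
    show ?case using rs val[OF rs] by metis
  next
    case 2
    then show ?case by - (elim exE conjE, hypsubst, rule val)
  qed
qed

lemma right_localization_isomorphic: "algebra_isomorphic K (right_localization R S) Q"
proof (rule unital_algebra_image[OF Q.unital_algebra_axioms inj_on_representations carrier_right_localization])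
  show "\<one>\<^bsub>right_localization R S\<^esub> = representations \<one>\<^bsub>Q\<^esub>"
    using fraction_eq_representations[of "\<one>\<^bsub>Q\<^esub>" "\<one>" "\<one>"]
    by (simp add: right_localization_def mem_representations \<eta>_one)
  show "\<zero>\<^bsub>right_localization R S\<^esub> = representations \<zero>\<^bsub>Q\<^esub>"
    using fraction_eq_representations[of "\<zero>\<^bsub>Q\<^esub>" "\<zero>" "\<one>"]
    by (simp add: right_localization_def mem_representations \<eta>_one \<eta>_zero)
qed (simp_all add: right_localization_add right_localization_mult right_localization_smult)

end

section \<open>Star products\<close>

lemma star_algebra_simps:
  "f \<in> carrier (star_algebra M C) \<longleftrightarrow> (\<forall>n. fps_nth f n \<in> smooth_functions M)"
  "fps_nth (f \<otimes>\<^bsub>star_algebra M C\<^esub> g) k = (\<lambda>x\<in>points M.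
     \<Sum>(l, p, q) \<in> {(l, p, q). l + p + q = k}. C l (fps_nth f p) (fps_nth g q) x)"
  "fps_nth (f \<oplus>\<^bsub>star_algebra M C\<^esub> g) k = (\<lambda>x\<in>points M. fps_nth f k x + fps_nth g k x)"
  "fps_nth (a \<odot>\<^bsub>star_algebra M C\<^esub> f) k = (\<lambda>x\<in>points M. \<Sum>i\<le>k. fps_nth a i * fps_nth f (k - i) x)"
  "fps_nth \<one>\<^bsub>star_algebra M C\<^esub> k = (\<lambda>x\<in>points M. if k = 0 then 1 else 0)"
  "fps_nth \<zero>\<^bsub>star_algebra M C\<^esub> k = (\<lambda>x\<in>points M. 0)"
  by (auto simp: star_algebra_def constant_series_def)

lemma fps_nth_constant_series: "fps_nth (constant_series M f) k = (if k = 0 then f else (\<lambda>x\<in>points M. 0))"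
  by (simp add: constant_series_def)

abbreviation triples :: "nat \<Rightarrow> (nat \<times> nat \<times> nat) set" where
  "triples k \<equiv> {(l, p, q). l + p + q = k}"

lemma finite_triples [simp]: "finite (triples k)"
  by (rule finite_subset[of _ "{..k} \<times> {..k} \<times> {..k}"]) auto

text \<open>Course-of-values recursion, for coefficients of formal series: \<Phi> reads only earlier
  entries.\<close>

lemma wf_recursion:
  fixes \<Phi> :: "(nat \<Rightarrow> 'b) \<Rightarrow> nat \<Rightarrow> 'b"
  assumes "\<And>k u v. (\<And>i. i < k \<Longrightarrow> u i = v i) \<Longrightarrow> \<Phi> u k = \<Phi> v k"
  shows "\<exists>u. \<forall>k. u k = \<Phi> u k"
proof (intro exI allI)
  fix k
  let ?u = "wfrec less_than \<Phi>"
  have "?u k = \<Phi> (cut ?u less_than k) k" by (rule wfrec) simp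
  also have "\<dots> = \<Phi> ?u k" by (rule assms) (simp add: cut_apply)
  finally show "?u k = \<Phi> ?u k" .
qed

section \<open>The star algebras over the manifold and over the open set\<close>

locale star_manifold = manifold M for M :: "'a mfd" +
  fixes C :: "nat \<Rightarrow> ('a, 'k::{real_normed_field, euclidean_space}) bi_op" and U :: "'a set"
  assumes star: "star_product M C" and U: "openin (mtop M) U"
begin

abbreviation "K \<equiv> ring_of_type_algebra :: 'k fps ring"
abbreviation "R \<equiv> star_algebra M C"
abbreviation "MU \<equiv> open_submanifold M U"
abbreviation "D \<equiv> \<lambda>k. localization M U (C k)"
abbreviation "Q \<equiv> star_algebra MU D"

lemma C: "bidifferential_operator M (C k)"
  and C_0: "f \<in> smooth_functions M \<Longrightarrow> g \<in> smooth_functions M \<Longrightarrow> C 0 f g = (\<lambda>x\<in>points M. f x * g x)"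
  and R_algebra: "unital_algebra K R"
  using star unfolding star_product_def by blast+

sublocale R: unital_algebra K R by (rule R_algebra)

sublocale U: manifold MU
  using smooth_manifold_open_submanifold[OF U] by unfold_locales

lemma pU [simp]: "points MU = U"
  by (rule points_open_submanifold[OF U])

lemma U_subset: "U \<subseteq> points M"
  by (rule openin_subset[OF U])

lemma D: "bidifferential_operator MU (D k)"
  by (rule localization_bidifferential[OF U C])

lemma R_nth: "f \<in> carrier R \<Longrightarrow> fps_nth f n \<in> smooth_functions M"
  and Q_nth: "g \<in> carrier Q \<Longrightarrow> fps_nth g n \<in> smooth_functions MU"
  by (simp_all add: star_algebra_simps)

text \<open>One map \<open>E\<close> and one neighbourhood \<open>B\<close> work for all functions
  at once, so identities involving several functions can be transported.\<close>

lemma ex_germ_extension: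
  assumes "x \<in> U"
  obtains B and E :: "('a \<Rightarrow> 'k) \<Rightarrow> 'a \<Rightarrow> 'k" where "openin (mtop M) B" "x \<in> B" "B \<subseteq> U"
    "\<And>f. f \<in> smooth_functions MU \<Longrightarrow> E f \<in> smooth_functions M" "\<And>f z. z \<in> B \<Longrightarrow> f z = E f z"
proof -
  obtain B and \<beta> :: "'a \<Rightarrow> 'k" where b: "bump U B \<beta>" "x \<in> B" "B \<subseteq> U" by (rule ex_bump[OF U assms])
  show ?thesis
  proof (rule that[of B "extend_by_zero U \<beta>"])
    show "openin (mtop M) B" using b(1) by (simp add: bump_def)
    show "f z = extend_by_zero U \<beta> f z" if "z \<in> B" for f z
      using extend_by_zero_eq[OF b(1) that] b(3) that by auto
  qed (use b extend_by_zero_smooth[OF U b(1)] in auto)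
qed

lemma D_0:
  assumes "f \<in> smooth_functions MU" "g \<in> smooth_functions MU" "x \<in> U"
  shows "D 0 f g x = f x * g x"
proof -
  obtain B and E :: "('a \<Rightarrow> 'k) \<Rightarrow> 'a \<Rightarrow> 'k" where B: "openin (mtop M) B" "x \<in> B" "B \<subseteq> U"
    "\<And>f. f \<in> smooth_functions MU \<Longrightarrow> E f \<in> smooth_functions M" "\<And>f z. z \<in> B \<Longrightarrow> f z = E f z"
    by (rule ex_germ_extension[OF assms(3)]) blast
  have "D 0 f g x = C 0 (E f) (E g) x"
    by (rule localization_eq[OF U C assms(1) B(4)[OF assms(1)] assms(2) B(4)[OF assms(2)] B(1,3,2) B(5) B(5)])
  then show ?thesis
    using B(5)[OF B(2), of f] B(5)[OF B(2), of g] U_subset assms by (auto simp: C_0 B(4))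
qed

definition agree :: "'a set \<Rightarrow> ('a \<Rightarrow> 'k) fps \<Rightarrow> ('a \<Rightarrow> 'k) fps \<Rightarrow> bool" where
  "agree W f F \<longleftrightarrow> (\<forall>n. \<forall>z\<in>W. fps_nth f n z = fps_nth F n z)"

lemma agree_mult:
  assumes "openin (mtop M) W" "W \<subseteq> U" "f \<in> carrier Q" "g \<in> carrier Q" "F \<in> carrier R" "G \<in> carrier R"
    "agree W f F" "agree W g G"
  shows "agree W (f \<otimes>\<^bsub>Q\<^esub> g) (F \<otimes>\<^bsub>R\<^esub> G)"
proof -
  have "D l (fps_nth f p) (fps_nth g q) z = C l (fps_nth F p) (fps_nth G q) z" if "z \<in> W" for l p q z
    by (rule localization_eq[OF U C Q_nth[OF assms(3)] R_nth[OF assms(5)] Q_nth[OF assms(4)] R_nth[OF assms(6)]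
          assms(1,2) that]) (use assms(7,8) in \<open>auto simp: agree_def\<close>)
  then show ?thesis
    using assms(2) U_subset by (auto simp: agree_def star_algebra_simps(2) intro!: sum.cong)
qed

lemma agree_add: "W \<subseteq> U \<Longrightarrow> agree W f F \<Longrightarrow> agree W g G \<Longrightarrow> agree W (f \<oplus>\<^bsub>Q\<^esub> g) (F \<oplus>\<^bsub>R\<^esub> G)"
  and agree_smult: "W \<subseteq> U \<Longrightarrow> agree W f F \<Longrightarrow> agree W (a \<odot>\<^bsub>Q\<^esub> f) (a \<odot>\<^bsub>R\<^esub> F)"
  and agree_one: "W \<subseteq> U \<Longrightarrow> agree W \<one>\<^bsub>Q\<^esub> \<one>\<^bsub>R\<^esub>"
  and agree_zero: "W \<subseteq> U \<Longrightarrow> agree W \<zero>\<^bsub>Q\<^esub> \<zero>\<^bsub>R\<^esub>"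
  using U_subset by (auto simp: agree_def star_algebra_simps subset_iff)

lemma Q_mult_closed: "f \<in> carrier Q \<Longrightarrow> g \<in> carrier Q \<Longrightarrow> f \<otimes>\<^bsub>Q\<^esub> g \<in> carrier Q"
  unfolding star_algebra_simps(1,2)
  by (auto simp: split_beta simp del: pU intro!: U.smooth_sum U.bidifferential_closed[OF D])

lemma Q_add_closed: "f \<in> carrier Q \<Longrightarrow> g \<in> carrier Q \<Longrightarrow> f \<oplus>\<^bsub>Q\<^esub> g \<in> carrier Q"
  using U.smooth_add by (auto simp: star_algebra_simps)

lemma Q_smult_closed:
  assumes "f \<in> carrier Q"
  shows "a \<odot>\<^bsub>Q\<^esub> f \<in> carrier Q"
proof -
  have "(\<lambda>x\<in>points MU. \<Sum>i\<le>k. fps_nth a i * fps_nth f (k - i) x) \<in> smooth_functions MU" for k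
  proof -
    have "(\<lambda>x\<in>points MU. \<Sum>i\<le>k. (\<lambda>x\<in>points MU. fps_nth a i * fps_nth f (k - i) x) x) \<in> smooth_functions MU"
      by (intro U.smooth_sum U.smooth_scale Q_nth[OF assms])
    also have "(\<lambda>x\<in>points MU. \<Sum>i\<le>k. (\<lambda>x\<in>points MU. fps_nth a i * fps_nth f (k - i) x) x) =
        (\<lambda>x\<in>points MU. \<Sum>i\<le>k. fps_nth a i * fps_nth f (k - i) x)"
      by (rule restrict_ext) simp
    finally show ?thesis .
  qed
  then show ?thesis unfolding star_algebra_simps(1,4) by blast
qed

lemma Q_one_closed: "\<one>\<^bsub>Q\<^esub> \<in> carrier Q" and Q_zero_closed: "\<zero>\<^bsub>Q\<^esub> \<in> carrier Q"
  using U.smooth_const by (auto simp: star_algebra_simps)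

text \<open>The algebra laws over \<open>U\<close> are local: near each point the series are
  replaced by global extensions, for which the law holds in \<open>R\<close>. \<open>s'\<close> and
  \<open>t'\<close> are the two sides of the law as functions of the extension map
  \<open>E\<close>.\<close>

lemma Q_eqI_extension:
  assumes "s \<in> carrier Q" "t \<in> carrier Q"
    and "\<And>B E. \<lbrakk>openin (mtop M) B; B \<subseteq> U; \<And>f. f \<in> carrier Q \<Longrightarrow> E f \<in> carrier R;
      \<And>f. agree B f (E f)\<rbrakk> \<Longrightarrow> agree B s (s' E) \<and> agree B t (t' E)"
    and "\<And>E. (\<And>f. f \<in> carrier Q \<Longrightarrow> E f \<in> carrier R) \<Longrightarrow> s' E = t' E"
  shows "s = t"
proof (rule fps_ext)
  fix n
  show "fps_nth s n = fps_nth t n"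
  proof (rule U.smooth_functions_eqI[OF Q_nth[OF assms(1)] Q_nth[OF assms(2)]])
    fix x assume "x \<in> points MU"
    then have x: "x \<in> U" by simp
    obtain B and E :: "('a \<Rightarrow> 'k) \<Rightarrow> 'a \<Rightarrow> 'k" where B: "openin (mtop M) B" "x \<in> B" "B \<subseteq> U"
      "\<And>f. f \<in> smooth_functions MU \<Longrightarrow> E f \<in> smooth_functions M" "\<And>f z. z \<in> B \<Longrightarrow> f z = E f z"
      by (rule ex_germ_extension[OF x]) blast
    define E' where "E' f = Abs_fps (\<lambda>n. E (fps_nth f n))" for f
    have E': "E' f \<in> carrier R" if "f \<in> carrier Q" for f
      using that B(4) by (simp add: E'_def star_algebra_simps(1))
    have "agree B s (s' E') \<and> agree B t (t' E')"
      by (rule assms(3)[OF B(1,3) E']) (use B(5) in \<open>auto simp: E'_def agree_def\<close>)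
    then show "fps_nth s n x = fps_nth t n x"
      using B(2) assms(4)[of E', OF E'] by (simp add: agree_def)
  qed
qed

lemma Q_algebra: "unital_algebra K Q"
proof (rule unital_algebraI)
  show "cring K" by (rule cring_from_type_algebra)
  note closed = Q_mult_closed Q_add_closed Q_smult_closed Q_one_closed Q_zero_closed
  note agree = agree_mult agree_add agree_smult agree_one agree_zero
  note R_closed = R.m_closed R.a_closed R.smult_closed R.one_closed R.zero_closed
  have K: "a \<in> carrier K" for a by (simp add: ring_of_type_algebra_def)
  show "\<one>\<^bsub>Q\<^esub> \<in> carrier Q" "\<zero>\<^bsub>Q\<^esub> \<in> carrier Q" by (rule closed)+
  fix f assume f: "f \<in> carrier Q"
  show "\<zero>\<^bsub>Q\<^esub> \<oplus>\<^bsub>Q\<^esub> f = f"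
    by (rule Q_eqI_extension[where s' = "\<lambda>E. \<zero>\<^bsub>R\<^esub> \<oplus>\<^bsub>R\<^esub> E f" and t' = "\<lambda>E. E f"])
      (use f in \<open>auto intro!: closed agree R.l_zero simp del: R.l_zero\<close>)
  show "\<one>\<^bsub>Q\<^esub> \<otimes>\<^bsub>Q\<^esub> f = f"
    by (rule Q_eqI_extension[where s' = "\<lambda>E. \<one>\<^bsub>R\<^esub> \<otimes>\<^bsub>R\<^esub> E f" and t' = "\<lambda>E. E f"])
      (use f in \<open>auto intro!: closed agree R.l_one simp del: R.l_one\<close>)
  show "f \<otimes>\<^bsub>Q\<^esub> \<one>\<^bsub>Q\<^esub> = f"
    by (rule Q_eqI_extension[where s' = "\<lambda>E. E f \<otimes>\<^bsub>R\<^esub> \<one>\<^bsub>R\<^esub>" and t' = "\<lambda>E. E f"])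
      (use f in \<open>auto intro!: closed agree R.r_one simp del: R.r_one\<close>)
  show "\<one>\<^bsub>K\<^esub> \<odot>\<^bsub>Q\<^esub> f = f"
    by (rule Q_eqI_extension[where s' = "\<lambda>E. \<one>\<^bsub>K\<^esub> \<odot>\<^bsub>R\<^esub> E f" and t' = "\<lambda>E. E f"])
      (use f in \<open>auto intro!: closed agree R.smult_one simp del: R.smult_one\<close>)
  show "\<exists>g\<in>carrier Q. g \<oplus>\<^bsub>Q\<^esub> f = \<zero>\<^bsub>Q\<^esub>"
  proof
    \<comment> \<open>The existence of negatives is not an equation to be transported, so the
      negative is written down directly.\<close>
    define g where "g = Abs_fps (\<lambda>n. \<lambda>x\<in>points MU. (-1) * fps_nth f n x)"
    show "g \<in> carrier Q"
      unfolding g_def star_algebra_simps(1) fps_nth_Abs_fps by (intro allI U.smooth_scale Q_nth[OF f])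
    show "g \<oplus>\<^bsub>Q\<^esub> f = \<zero>\<^bsub>Q\<^esub>"
      by (rule fps_ext) (auto simp: g_def star_algebra_simps)
  qed
  fix a b
  show "a \<odot>\<^bsub>Q\<^esub> f \<in> carrier Q" using f by (rule closed)
  show "(a \<oplus>\<^bsub>K\<^esub> b) \<odot>\<^bsub>Q\<^esub> f = a \<odot>\<^bsub>Q\<^esub> f \<oplus>\<^bsub>Q\<^esub> b \<odot>\<^bsub>Q\<^esub> f"
    by (rule Q_eqI_extension[where s' = "\<lambda>E. (a \<oplus>\<^bsub>K\<^esub> b) \<odot>\<^bsub>R\<^esub> E f" and
          t' = "\<lambda>E. a \<odot>\<^bsub>R\<^esub> E f \<oplus>\<^bsub>R\<^esub> b \<odot>\<^bsub>R\<^esub> E f"])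
      (use f in \<open>auto intro!: closed agree R.smult_l_distr simp: K\<close>)
  show "(a \<otimes>\<^bsub>K\<^esub> b) \<odot>\<^bsub>Q\<^esub> f = a \<odot>\<^bsub>Q\<^esub> (b \<odot>\<^bsub>Q\<^esub> f)"
    by (rule Q_eqI_extension[where s' = "\<lambda>E. (a \<otimes>\<^bsub>K\<^esub> b) \<odot>\<^bsub>R\<^esub> E f" and
          t' = "\<lambda>E. a \<odot>\<^bsub>R\<^esub> (b \<odot>\<^bsub>R\<^esub> E f)"])
      (use f in \<open>auto intro!: closed agree R.smult_assoc1 simp: K\<close>)
  fix g assume g: "g \<in> carrier Q"
  show "f \<oplus>\<^bsub>Q\<^esub> g \<in> carrier Q" "f \<otimes>\<^bsub>Q\<^esub> g \<in> carrier Q" using f g by (auto intro: closed)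
  show "f \<oplus>\<^bsub>Q\<^esub> g = g \<oplus>\<^bsub>Q\<^esub> f"
    by (rule Q_eqI_extension[where s' = "\<lambda>E. E f \<oplus>\<^bsub>R\<^esub> E g" and t' = "\<lambda>E. E g \<oplus>\<^bsub>R\<^esub> E f"])
      (use f g in \<open>auto intro!: closed agree R.a_comm\<close>)
  show "a \<odot>\<^bsub>Q\<^esub> (f \<oplus>\<^bsub>Q\<^esub> g) = a \<odot>\<^bsub>Q\<^esub> f \<oplus>\<^bsub>Q\<^esub> a \<odot>\<^bsub>Q\<^esub> g"
    by (rule Q_eqI_extension[where s' = "\<lambda>E. a \<odot>\<^bsub>R\<^esub> (E f \<oplus>\<^bsub>R\<^esub> E g)" and
          t' = "\<lambda>E. a \<odot>\<^bsub>R\<^esub> E f \<oplus>\<^bsub>R\<^esub> a \<odot>\<^bsub>R\<^esub> E g"])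
      (use f g in \<open>auto intro!: closed agree R.smult_r_distr simp: K\<close>)
  show "(a \<odot>\<^bsub>Q\<^esub> f) \<otimes>\<^bsub>Q\<^esub> g = a \<odot>\<^bsub>Q\<^esub> (f \<otimes>\<^bsub>Q\<^esub> g)"
    by (rule Q_eqI_extension[where s' = "\<lambda>E. (a \<odot>\<^bsub>R\<^esub> E f) \<otimes>\<^bsub>R\<^esub> E g" and
          t' = "\<lambda>E. a \<odot>\<^bsub>R\<^esub> (E f \<otimes>\<^bsub>R\<^esub> E g)"])
      (use f g in \<open>auto intro!: closed agree R.smult_mult_left simp: K\<close>)
  show "f \<otimes>\<^bsub>Q\<^esub> (a \<odot>\<^bsub>Q\<^esub> g) = a \<odot>\<^bsub>Q\<^esub> (f \<otimes>\<^bsub>Q\<^esub> g)"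
    by (rule Q_eqI_extension[where s' = "\<lambda>E. E f \<otimes>\<^bsub>R\<^esub> (a \<odot>\<^bsub>R\<^esub> E g)" and
          t' = "\<lambda>E. a \<odot>\<^bsub>R\<^esub> (E f \<otimes>\<^bsub>R\<^esub> E g)"])
      (use f g in \<open>auto intro!: closed agree R.smult_mult_right simp: K\<close>)
  fix h assume h: "h \<in> carrier Q"
  show "f \<oplus>\<^bsub>Q\<^esub> g \<oplus>\<^bsub>Q\<^esub> h = f \<oplus>\<^bsub>Q\<^esub> (g \<oplus>\<^bsub>Q\<^esub> h)"
    by (rule Q_eqI_extension[where s' = "\<lambda>E. E f \<oplus>\<^bsub>R\<^esub> E g \<oplus>\<^bsub>R\<^esub> E h" and
          t' = "\<lambda>E. E f \<oplus>\<^bsub>R\<^esub> (E g \<oplus>\<^bsub>R\<^esub> E h)"])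
      (use f g h in \<open>auto intro!: closed agree R.a_assoc\<close>)
  show "f \<otimes>\<^bsub>Q\<^esub> g \<otimes>\<^bsub>Q\<^esub> h = f \<otimes>\<^bsub>Q\<^esub> (g \<otimes>\<^bsub>Q\<^esub> h)"
    by (rule Q_eqI_extension[where s' = "\<lambda>E. E f \<otimes>\<^bsub>R\<^esub> E g \<otimes>\<^bsub>R\<^esub> E h" and
          t' = "\<lambda>E. E f \<otimes>\<^bsub>R\<^esub> (E g \<otimes>\<^bsub>R\<^esub> E h)"])
      (use f g h in \<open>auto intro!: closed agree R.m_assoc\<close>)
  show "(f \<oplus>\<^bsub>Q\<^esub> g) \<otimes>\<^bsub>Q\<^esub> h = f \<otimes>\<^bsub>Q\<^esub> h \<oplus>\<^bsub>Q\<^esub> g \<otimes>\<^bsub>Q\<^esub> h"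
    by (rule Q_eqI_extension[where s' = "\<lambda>E. (E f \<oplus>\<^bsub>R\<^esub> E g) \<otimes>\<^bsub>R\<^esub> E h" and
          t' = "\<lambda>E. E f \<otimes>\<^bsub>R\<^esub> E h \<oplus>\<^bsub>R\<^esub> E g \<otimes>\<^bsub>R\<^esub> E h"])
      (use f g h in \<open>auto intro!: closed agree R.l_distr\<close>)
  show "h \<otimes>\<^bsub>Q\<^esub> (f \<oplus>\<^bsub>Q\<^esub> g) = h \<otimes>\<^bsub>Q\<^esub> f \<oplus>\<^bsub>Q\<^esub> h \<otimes>\<^bsub>Q\<^esub> g"
    by (rule Q_eqI_extension[where s' = "\<lambda>E. E h \<otimes>\<^bsub>R\<^esub> (E f \<oplus>\<^bsub>R\<^esub> E g)" and
          t' = "\<lambda>E. E h \<otimes>\<^bsub>R\<^esub> E f \<oplus>\<^bsub>R\<^esub> E h \<otimes>\<^bsub>R\<^esub> E g"])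
      (use f g h in \<open>auto intro!: closed agree R.r_distr\<close>)
qed

sublocale Q: unital_algebra K Q by (rule Q_algebra)

subsection \<open>The restriction morphism\<close>

abbreviation "\<eta> \<equiv> restrict_series U :: ('a \<Rightarrow> 'k) fps \<Rightarrow> ('a \<Rightarrow> 'k) fps"
abbreviation "S \<equiv> nonvanishing_series M C U"

lemma fps_nth_restrict_series: "fps_nth (\<eta> f) n = restrict (fps_nth f n) U"
  by (simp add: restrict_series_def)

lemma agree_restrict_series: "agree U (\<eta> f) f"
  by (simp add: agree_def fps_nth_restrict_series)

lemma restrict_series_closed: "f \<in> carrier R \<Longrightarrow> \<eta> f \<in> carrier Q"
  using restrict_smooth_functions[OF _ U] by (auto simp: star_algebra_simps(1) fps_nth_restrict_series)

lemma Q_eqI_agree: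
  assumes "s \<in> carrier Q" "t \<in> carrier Q" "agree U s r" "agree U t r"
  shows "s = t"
proof (rule fps_ext)
  show "fps_nth s n = fps_nth t n" for n
    by (rule U.smooth_functions_eqI[OF Q_nth[OF assms(1)] Q_nth[OF assms(2)]])
      (use assms(3,4) in \<open>simp add: agree_def\<close>)
qed

text \<open>In each law both sides agree on all of \<open>U\<close> with one and the same element of
  \<open>R\<close>.\<close>

lemma restrict_series_hom: "\<eta> \<in> algebra_hom K R Q"
proof -
  note agree = agree_mult agree_add agree_smult agree_one agree_zero agree_restrict_series
  have "\<eta> (f \<otimes>\<^bsub>R\<^esub> g) = \<eta> f \<otimes>\<^bsub>Q\<^esub> \<eta> g" if "f \<in> carrier R" "g \<in> carrier R" for f g
    by (rule Q_eqI_agree[where r = "f \<otimes>\<^bsub>R\<^esub> g"])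
      (use that U in \<open>auto intro!: agree restrict_series_closed Q_mult_closed\<close>)
  moreover have "\<eta> (f \<oplus>\<^bsub>R\<^esub> g) = \<eta> f \<oplus>\<^bsub>Q\<^esub> \<eta> g" if "f \<in> carrier R" "g \<in> carrier R" for f g
    by (rule Q_eqI_agree[where r = "f \<oplus>\<^bsub>R\<^esub> g"])
      (use that in \<open>auto intro!: agree restrict_series_closed Q_add_closed\<close>)
  moreover have "\<eta> (a \<odot>\<^bsub>R\<^esub> f) = a \<odot>\<^bsub>Q\<^esub> \<eta> f" if "f \<in> carrier R" "a \<in> carrier K" for f a
    by (rule Q_eqI_agree[where r = "a \<odot>\<^bsub>R\<^esub> f"])
      (use that in \<open>auto intro!: agree restrict_series_closed Q_smult_closed\<close>)
  moreover have "\<eta> \<one>\<^bsub>R\<^esub> = \<one>\<^bsub>Q\<^esub>"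
    by (rule Q_eqI_agree[where r = "\<one>\<^bsub>R\<^esub>"])
      (auto intro!: agree restrict_series_closed Q_one_closed)
  ultimately show ?thesis
    using restrict_series_closed by (auto simp: algebra_hom_def ring_hom_def)
qed

text \<open>Only the order-zero coefficient is constrained, since lambda times an arbitrary series
  absorbs all higher ones.\<close>

lemma mem_S_iff: "f \<in> S \<longleftrightarrow> f \<in> carrier R \<and> (\<forall>x\<in>U. fps_nth f 0 x \<noteq> 0)"
proof
  assume "f \<in> S"
  then obtain g r where g: "g \<in> smooth_functions M" "\<forall>x\<in>U. g x \<noteq> 0" and r: "r \<in> carrier R"
    and f: "f = constant_series M g \<oplus>\<^bsub>R\<^esub> fps_X \<odot>\<^bsub>R\<^esub> r"
    unfolding nonvanishing_series_def nonvanishing_functions_def set_add_def set_mult_def by auto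
  have "fps_X \<in> carrier K" by (simp add: ring_of_type_algebra_def)
  moreover have "constant_series M g \<in> carrier R"
    using g smooth_const[of "0 :: 'k"] by (simp add: star_algebra_simps(1) fps_nth_constant_series)
  ultimately have "f \<in> carrier R" using f r by simp
  moreover have "fps_nth f 0 x \<noteq> 0" if "x \<in> U" for x
    using g that U_subset by (auto simp: f star_algebra_simps(3,4) fps_nth_constant_series)
  ultimately show "f \<in> carrier R \<and> (\<forall>x\<in>U. fps_nth f 0 x \<noteq> 0)" by blast
next
  assume f: "f \<in> carrier R \<and> (\<forall>x\<in>U. fps_nth f 0 x \<noteq> 0)"
  \<comment> \<open>The shift undoes multiplication by lambda, that is by
    \<open>fps_X\<close>.\<close>
  define r where "r = Abs_fps (\<lambda>n. fps_nth f (Suc n))"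
  have r: "r \<in> carrier R" using f by (simp add: r_def star_algebra_simps(1))
  have "f = constant_series M (fps_nth f 0) \<oplus>\<^bsub>R\<^esub> fps_X \<odot>\<^bsub>R\<^esub> r"
  proof (rule fps_ext)
    fix n
    have "fps_nth f n \<in> extensional (points M)"
      using f R_nth smooth_functionsD(2) by blast
    moreover have "fps_nth (constant_series M (fps_nth f 0) \<oplus>\<^bsub>R\<^esub> fps_X \<odot>\<^bsub>R\<^esub> r) n x = fps_nth f n x"
      if x: "x \<in> points M" for x
    proof (cases n)
      case (Suc m)
      have "(\<Sum>i\<le>n. fps_nth fps_X i * fps_nth r (n - i) x) =
          (\<Sum>i\<le>n. if i = 1 then fps_nth r (n - i) x else 0)"
        by (intro sum.cong) auto
      also have "\<dots> = fps_nth f n x" using Suc by (simp add: sum.delta r_def)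
      finally show ?thesis using x Suc by (simp add: star_algebra_simps(3,4) fps_nth_constant_series)
    qed (use x in \<open>simp add: star_algebra_simps(3,4) fps_nth_constant_series\<close>)
    ultimately show "fps_nth f n = fps_nth (constant_series M (fps_nth f 0) \<oplus>\<^bsub>R\<^esub> fps_X \<odot>\<^bsub>R\<^esub> r) n"
      by (intro extensionalityI[of _ "points M"]) (auto simp: star_algebra_simps(3))
  qed
  moreover have "fps_nth f 0 \<in> nonvanishing_functions M U"
    using f R_nth by (simp add: nonvanishing_functions_def)
  ultimately show "f \<in> S"
    using r unfolding nonvanishing_series_def set_add_def set_mult_def by auto
qed

section \<open>The multiplicative set and inverses over the open set\<close>

lemma mult_nth_0:
  assumes "f \<in> carrier R" "g \<in> carrier R" "x \<in> points M"
  shows "fps_nth (f \<otimes>\<^bsub>R\<^esub> g) 0 x = fps_nth f 0 x * fps_nth g 0 x"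
proof -
  have "triples 0 = {(0, 0, 0)}" by auto
  then show ?thesis
    using assms by (simp add: star_algebra_simps(2) C_0 R_nth)
qed

lemma submonoid_S: "submonoid S R"
proof
  show "f \<otimes>\<^bsub>R\<^esub> g \<in> S" if "f \<in> S" "g \<in> S" for f g
    using that U_subset mult_nth_0 by (fastforce simp: mem_S_iff)
  show "\<one>\<^bsub>R\<^esub> \<in> S" using U_subset by (auto simp: mem_S_iff star_algebra_simps(5))
qed (auto simp: mem_S_iff)

text \<open>The coefficients of a right inverse are determined recursively, because the term of
  index \<open>(0, 0, k)\<close> is the product of the invertible function \<open>f\<^sub>0\<close> with the k-th coefficient.\<close>

lemma ex_right_inverse:
  assumes f: "f \<in> carrier Q" and nz: "\<And>x. x \<in> U \<Longrightarrow> fps_nth f 0 x \<noteq> 0"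
  obtains u where "u \<in> carrier Q" "f \<otimes>\<^bsub>Q\<^esub> u = \<one>\<^bsub>Q\<^esub>" "\<And>x. x \<in> U \<Longrightarrow> fps_nth u 0 x \<noteq> 0"
proof -
  define T where "T k = triples k - {(0, 0, k)}" for k :: nat
  have T: "finite (T k)" "triples k = insert (0, 0, k) (T k)" "(0, 0, k) \<notin> T k" for k
    by (auto simp: T_def)
  have Tq: "q < k" if "(l, p, q) \<in> T k" for l p q k using that by (auto simp: T_def)
  define \<Phi> where "\<Phi> u k = (\<lambda>x\<in>U. ((if k = 0 then 1 else 0) -
      (\<Sum>(l, p, q)\<in>T k. D l (fps_nth f p) (u q) x)) * inverse (fps_nth f 0 x))" for u k
  have "\<Phi> u k = \<Phi> v k" if "\<And>i. i < k \<Longrightarrow> u i = v i" for k u v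
  proof -
    have "(\<Sum>(l, p, q)\<in>T k. D l (fps_nth f p) (u q) x) = (\<Sum>(l, p, q)\<in>T k. D l (fps_nth f p) (v q) x)" for x
      by (rule sum.cong) (use that Tq in \<open>auto split: prod.splits\<close>)
    then show ?thesis by (simp add: \<Phi>_def)
  qed
  from wf_recursion[of \<Phi>, OF this] obtain u where u: "\<And>k. u k = \<Phi> u k" by blast
  have us: "u k \<in> smooth_functions MU" for k
  proof (induction k rule: less_induct)
    case (less k)
    let ?s = "\<lambda>x\<in>points MU. \<Sum>t\<in>T k. (case t of (l, p, q) \<Rightarrow> D l (fps_nth f p) (u q)) x"
    have "?s \<in> smooth_functions MU"
    proof (rule U.smooth_sum)
      fix t assume "t \<in> T k"
      moreover obtain l p q where t: "t = (l, p, q)" by (rule prod_cases3)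
      ultimately have "u q \<in> smooth_functions MU" using Tq less by blast
      then show "(case t of (l, p, q) \<Rightarrow> D l (fps_nth f p) (u q)) \<in> smooth_functions MU"
        using U.bidifferential_closed[OF D Q_nth[OF f]] by (simp add: t)
    qed
    from U.smooth_mult[OF U.smooth_add[OF U.smooth_const[of "if k = 0 then 1 else 0"] U.smooth_scale[OF this, of "-1"]]
        U.smooth_inverse[OF Q_nth[OF f]], of 0] nz
    have "(\<lambda>x\<in>points MU. (\<lambda>x\<in>points MU. (\<lambda>x\<in>points MU. if k = 0 then 1 else 0) x +
        (\<lambda>x\<in>points MU. (-1) * ?s x) x) x * (\<lambda>x\<in>points MU. inverse (fps_nth f 0 x)) x) \<in> smooth_functions MU"
      by simp
    also have "(\<lambda>x\<in>points MU. (\<lambda>x\<in>points MU. (\<lambda>x\<in>points MU. if k = 0 then 1 else 0) x +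
        (\<lambda>x\<in>points MU. (-1) * ?s x) x) x * (\<lambda>x\<in>points MU. inverse (fps_nth f 0 x)) x) = \<Phi> u k"
      by (auto simp: \<Phi>_def fun_eq_iff case_prod_beta)
    finally show ?case by (simp add: u[symmetric])
  qed
  define v where "v = Abs_fps u"
  have v: "v \<in> carrier Q" using us by (simp add: v_def star_algebra_simps(1))
  show ?thesis
  proof (rule that[OF v])
    show "f \<otimes>\<^bsub>Q\<^esub> v = \<one>\<^bsub>Q\<^esub>"
    proof (rule fps_ext)
      fix k
      have "(\<Sum>(l, p, q)\<in>triples k. D l (fps_nth f p) (fps_nth v q) x) = (if k = 0 then 1 else 0)" if x: "x \<in> U" for x
      proof -
        have "(\<Sum>(l, p, q)\<in>triples k. D l (fps_nth f p) (fps_nth v q) x) =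
            fps_nth f 0 x * u k x + (\<Sum>(l, p, q)\<in>T k. D l (fps_nth f p) (u q) x)"
          unfolding T(2) using T(1,3) D_0[OF Q_nth[OF f] us x] by (simp add: v_def)
        also have "fps_nth f 0 x * u k x = (if k = 0 then 1 else 0) - (\<Sum>(l, p, q)\<in>T k. D l (fps_nth f p) (u q) x)"
          using x nz[OF x] by (subst u) (simp add: \<Phi>_def field_simps)
        finally show ?thesis by simp
      qed
      then show "fps_nth (f \<otimes>\<^bsub>Q\<^esub> v) k = fps_nth \<one>\<^bsub>Q\<^esub> k"
        unfolding star_algebra_simps(2,5) pU by (intro restrict_ext)
    qed
    show "fps_nth v 0 x \<noteq> 0" if x: "x \<in> U" for x
    proof -
      have "T 0 = {}" by (auto simp: T_def)
      then have "u 0 x = inverse (fps_nth f 0 x)" using x by (subst u) (simp add: \<Phi>_def)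
      then show ?thesis using nz[OF x] by (simp add: v_def)
    qed
  qed
qed

text \<open>The right inverse \<open>u\<close> again has a nowhere vanishing order-zero coefficient
  and hence a right inverse \<open>v\<close>. Then f = f (u v) = (f u) v = v, so \<open>u\<close> is
  inverse to \<open>f\<close> on both sides.\<close>

lemma Units_Q:
  assumes f: "f \<in> carrier Q" and nz: "\<And>x. x \<in> U \<Longrightarrow> fps_nth f 0 x \<noteq> 0"
  shows "f \<in> Units Q"
proof -
  obtain u where u: "u \<in> carrier Q" "f \<otimes>\<^bsub>Q\<^esub> u = \<one>\<^bsub>Q\<^esub>" "\<And>x. x \<in> U \<Longrightarrow> fps_nth u 0 x \<noteq> 0"
    using ex_right_inverse[OF f nz] by (metis (no_types, lifting))
  obtain v where v: "v \<in> carrier Q" "u \<otimes>\<^bsub>Q\<^esub> v = \<one>\<^bsub>Q\<^esub>"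
    using ex_right_inverse[OF u(1,3)] by (metis (no_types, lifting))
  have "f = f \<otimes>\<^bsub>Q\<^esub> (u \<otimes>\<^bsub>Q\<^esub> v)" using f v by simp
  also have "\<dots> = v" using f u v(1) by (simp add: Q.m_assoc[symmetric])
  finally have "u \<otimes>\<^bsub>Q\<^esub> f = \<one>\<^bsub>Q\<^esub>" using v(2) by simp
  then show ?thesis using f u by (auto simp: Units_def)
qed

lemma restrict_series_Units: "s \<in> S \<Longrightarrow> \<eta> s \<in> Units Q"
  by (rule Units_Q) (auto simp: mem_S_iff restrict_series_closed fps_nth_restrict_series)

section \<open>Fractions over the open set and the kernel of the restriction\<close>

lemma constant_series_in_S:
  "g \<in> smooth_functions M \<Longrightarrow> (\<And>x. x \<in> U \<Longrightarrow> g x \<noteq> 0) \<Longrightarrow> constant_series M g \<in> S"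
  using smooth_const by (auto simp: mem_S_iff star_algebra_simps(1) fps_nth_constant_series)

text \<open>For \<open>s\<close> constant in lambda, each coefficient of the product of
  \<open>q\<close> and \<open>s\<close> is a finite sum of the functions
  \<open>D l (fps_nth q p) (restrict g U)\<close>, and these extend to the manifold by the choice of
  \<open>g\<close>. The extended product is the numerator.\<close>

lemma ex_Q_fraction:
  assumes q: "q \<in> carrier Q"
  shows "\<exists>r\<in>carrier R. \<exists>s\<in>S. q = \<eta> r \<otimes>\<^bsub>Q\<^esub> inv\<^bsub>Q\<^esub> (\<eta> s)"
proof -
  obtain g where g: "g \<in> smooth_functions M" "\<And>x. x \<in> U \<Longrightarrow> g x \<noteq> 0"
    and ex: "\<And>l p. \<exists>G\<in>smooth_functions M. \<forall>x\<in>U. D l (fps_nth q p) (restrict g U) x = G x"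
    by (rule ex_common_denominator[OF U, where C = C and q = "fps_nth q"], rule C, rule Q_nth[OF q], blast)
  obtain G where G: "\<And>l p. G l p \<in> smooth_functions M"
    "\<And>l p x. x \<in> U \<Longrightarrow> D l (fps_nth q p) (restrict g U) x = G l p x"
    using ex by metis
  define s where "s = constant_series M g"
  have s: "s \<in> S" unfolding s_def by (rule constant_series_in_S[OF g])
  then have sR: "s \<in> carrier R" by (simp add: mem_S_iff)
  \<comment> \<open>Only triples with \<open>n = 0\<close> contribute, because the higher
    coefficients of \<open>s\<close> vanish.\<close>
  define r where "r = Abs_fps (\<lambda>k. \<lambda>x\<in>points M. \<Sum>t\<in>triples k.
      (case t of (l, p, n) \<Rightarrow> if n = 0 then G l p else (\<lambda>x\<in>points M. 0)) x)"
  have r: "r \<in> carrier R"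
    unfolding star_algebra_simps(1) r_def fps_nth_Abs_fps
  proof (intro allI smooth_sum)
    show "(case t of (l, p, n) \<Rightarrow> if n = 0 then G l p else (\<lambda>x\<in>points M. 0)) \<in> smooth_functions M" for t :: "nat \<times> nat \<times> nat"
      using G(1) smooth_const by (auto split: prod.split)
  qed
  have "q \<otimes>\<^bsub>Q\<^esub> \<eta> s = \<eta> r"
  proof (rule fps_ext)
    fix k
    have "D l (fps_nth q p) (fps_nth (\<eta> s) n) x = (if n = 0 then G l p else (\<lambda>x\<in>points M. 0)) x"
      if x: "x \<in> U" for l p n x
    proof (cases "n = 0")
      case True
      then show ?thesis using G(2)[OF x] by (simp add: fps_nth_restrict_series s_def fps_nth_constant_series)
    next
      case False
      have "D l (fps_nth q p) (fps_nth (\<eta> s) n) x = 0"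
        by (rule U.bidifferential_local_zero[OF D Q_nth[OF q] Q_nth[OF restrict_series_closed[OF sR]], of U])
          (use False U U_subset x in \<open>auto simp: fps_nth_restrict_series s_def fps_nth_constant_series openin_open_submanifold\<close>)
      then show ?thesis using False x U_subset by auto
    qed
    then show "fps_nth (q \<otimes>\<^bsub>Q\<^esub> \<eta> s) k = fps_nth (\<eta> r) k"
      unfolding star_algebra_simps(2) fps_nth_restrict_series pU r_def fps_nth_Abs_fps
      using U_subset by (intro restrict_ext) (auto simp: case_prod_beta intro!: sum.cong)
  qed
  moreover have u: "\<eta> s \<in> Units Q" by (rule restrict_series_Units[OF s])
  ultimately have "q = \<eta> r \<otimes>\<^bsub>Q\<^esub> inv\<^bsub>Q\<^esub> (\<eta> s)"
    using q by (metis Q.Units_closed Q.Units_inv_closed Q.Units_r_inv Q.m_assoc Q.r_one)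
  then show ?thesis using r s by blast
qed

lemma kernel_restrict_series:
  assumes r: "r \<in> carrier R"
  shows "\<eta> r = \<zero>\<^bsub>Q\<^esub> \<longleftrightarrow> (\<exists>s\<in>S. r \<otimes>\<^bsub>R\<^esub> s = \<zero>\<^bsub>R\<^esub>)"
proof
  assume "\<exists>s\<in>S. r \<otimes>\<^bsub>R\<^esub> s = \<zero>\<^bsub>R\<^esub>"
  then obtain s where s: "s \<in> S" "r \<otimes>\<^bsub>R\<^esub> s = \<zero>\<^bsub>R\<^esub>" by blast
  have hom: "\<eta> \<in> ring_hom R Q" using restrict_series_hom by (simp add: algebra_hom_def)
  have sR: "s \<in> carrier R" using s(1) by (simp add: mem_S_iff)
  have u: "\<eta> s \<in> Units Q" by (rule restrict_series_Units[OF s(1)])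
  have z: "\<eta> r \<otimes>\<^bsub>Q\<^esub> \<eta> s = \<zero>\<^bsub>Q\<^esub>"
    using s(2) ring_hom_mult[OF hom r sR] ring_hom_zero[OF hom R.ring_axioms Q.ring_axioms] by simp
  have "\<eta> r = (\<eta> r \<otimes>\<^bsub>Q\<^esub> \<eta> s) \<otimes>\<^bsub>Q\<^esub> inv\<^bsub>Q\<^esub> (\<eta> s)"
    using u restrict_series_closed[OF r] by (simp add: Q.m_assoc Q.Units_closed)
  then show "\<eta> r = \<zero>\<^bsub>Q\<^esub>" using u z by simp
next
  assume z: "\<eta> r = \<zero>\<^bsub>Q\<^esub>"
  have rz: "fps_nth r p x = 0" if "x \<in> U" for p x
  proof -
    have "restrict (fps_nth r p) U x = fps_nth \<zero>\<^bsub>Q\<^esub> p x" by (simp add: z[symmetric] fps_nth_restrict_series)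
    then show ?thesis using that by (simp add: star_algebra_simps(6))
  qed
  \<comment> \<open>Any series over \<open>U\<close> may stand for \<open>q\<close> here: vanishing
    off \<open>U\<close> concerns arguments that are smooth on all of \<open>M\<close>. The zero
    series is the simplest choice.\<close>
  obtain g where g: "g \<in> smooth_functions M" "\<And>x. x \<in> U \<Longrightarrow> g x \<noteq> 0"
    and off: "\<And>l f x. f \<in> smooth_functions M \<Longrightarrow> x \<in> points M - U \<Longrightarrow> C l f g x = 0"
    by (rule ex_common_denominator[OF U, where C = C and q = "fps_nth \<zero>\<^bsub>Q\<^esub>"], rule C,
        rule Q_nth[OF Q_zero_closed], blast)
  define s where "s = constant_series M g"
  have s: "s \<in> S" unfolding s_def by (rule constant_series_in_S[OF g])
  then have sR: "s \<in> carrier R" by (simp add: mem_S_iff)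
  have "C l (fps_nth r p) (fps_nth s n) x = 0" if x: "x \<in> points M" for l p n x
  proof -
    \<comment> \<open>Three reasons for a zero contribution: \<open>r\<close> vanishes on the open
      set \<open>U\<close> around \<open>x\<close>, the coefficient of \<open>s\<close> is 0, or
      \<open>g\<close> annihilates \<open>C l\<close> at points off \<open>U\<close>. The last one
      covers the boundary, where \<open>r\<close> need not vanish on a neighbourhood.\<close>
    consider "x \<in> U" | "n \<noteq> 0" | "x \<in> points M - U" "n = 0" using x by blast
    then show ?thesis
    proof cases
      case 1
      then show ?thesis
        by (intro bidifferential_local_zero[OF C R_nth[OF r] R_nth[OF sR] U]) (use rz in auto)
    next
      case 2
      then show ?thesis
        by (intro bidifferential_local_zero[OF C R_nth[OF r] R_nth[OF sR] openin_topspace x])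
          (simp add: s_def fps_nth_constant_series)
    next
      case 3
      then show ?thesis using off[OF R_nth[OF r]] by (simp add: s_def fps_nth_constant_series)
    qed
  qed
  then have "r \<otimes>\<^bsub>R\<^esub> s = \<zero>\<^bsub>R\<^esub>"
    by (intro fps_ext) (auto simp: star_algebra_simps(2,6) case_prod_beta intro!: restrict_ext sum.neutral)
  then show "\<exists>s\<in>S. r \<otimes>\<^bsub>R\<^esub> s = \<zero>\<^bsub>R\<^esub>" using s by blast
qed

lemma restriction_right_algebra_of_fractions: "right_algebra_of_fractions K R S Q \<eta>"
  unfolding right_algebra_of_fractions_def
proof (intro conjI ballI)
  show "a_kernel R Q \<eta> = {r \<in> carrier R. \<exists>s\<in>S. r \<otimes>\<^bsub>R\<^esub> s = \<zero>\<^bsub>R\<^esub>}"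
    using kernel_restrict_series by (auto simp: a_kernel_def')
qed (rule R_algebra submonoid_S Q_algebra restrict_series_hom restrict_series_Units ex_Q_fraction; assumption)+

end

theorem theorem2p1:
  fixes M :: "'a mfd"
    and \<pi> :: "'a bivector_components"
    and C :: "nat \<Rightarrow> ('a, 'k::{real_normed_field, euclidean_space}) bi_op"
    and \<Omega> :: "'a set"
  assumes "poisson_manifold M \<pi>"
    and "poisson_star_product M \<pi> C"
    and "openin (mtop M) \<Omega>"
  shows
    "let K = (ring_of_type_algebra :: 'k fps ring);
         R = star_algebra M C;
         R\<^sub>\<Omega> = localized_star_algebra M C \<Omega>;
         \<eta> = restrict_series \<Omega>;
         S = nonvanishing_series M C \<Omega>
     in right_algebra_of_fractions K R S R\<^sub>\<Omega> \<eta> \<and>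
        right_denominator_set R S \<and>
        algebra_isomorphic K (right_localization R S) R\<^sub>\<Omega>"
proof -
  interpret star_manifold M C \<Omega>
    using assms by unfold_locales (auto simp: poisson_manifold_def poisson_star_product_def)
  interpret algebra_of_fractions K R S Q \<eta>
    by unfold_locales (rule restriction_right_algebra_of_fractions)
  show ?thesis
    unfolding Let_def localized_star_algebra_def
    using restriction_right_algebra_of_fractions right_denominator_set right_localization_isomorphic
    by blast
qed

end
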